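(* Let $\kappa$ be a regular uncountable cardinal. The following are equivalent: (i) there exists a special $\kappa$-Aronszajn tree; (ii) there exist a streamlined $\kappa$-Aronszajn tree $K$, a club $D\subseteq\mathrm{acc}(\kappa)$ and a function $f:K\restriction D\to\kappa$ such that: $V^-(K)\supseteq D$; $f(x)<\mathrm{dom}(x)$ for all $x\in K\restriction D$; $f(x)\ne f(y)$ for all $x\subsetneq y$ in $K\restriction D$; and for all $x,y\in K$ and $\varepsilon\in\mathrm{dom}(x)\cap\mathrm{dom}(y)$, if $x(\varepsilon)=y(\varepsilon)$ then $x\restriction\varepsilon=y\restriction\varepsilon$; (iii) there exists a streamlined uniformly homogeneous special $\kappa$-Aronszajn tree $T$ for which $V(T)$ covers a club in $\kappa$; (iv) there exists a homogeneous special $\kappa$-Aronszajn tree $\mathbf T$ with $V(\mathbf T)=\mathrm{acc}(\kappa)$.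
   Context: $\kappa$-tree: a poset $(T,<_T)$ whose sets of predecessors are well-ordered (order type = height), levels $T_\alpha$ ($\alpha<\kappa$) nonempty of size $<\kappa$, $T_\kappa=\emptyset$. $\kappa$-Aronszajn: a $\kappa$-tree with no $\kappa$-branch. Special $\kappa$-Aronszajn: $\kappa$-Aronszajn and there is $\rho:T\to T$ with $\rho(x)<_T x$ for every non-minimal $x$ and such that for every $y\in T$, $\rho^{-1}\{y\}$ is covered by fewer than $\kappa$ antichains. Homogeneous: for every $\alpha$ and $s,t\in T_\alpha$ some automorphism sends $s$ to $t$. $\mathrm{acc}(\kappa)$: nonzero limit ordinals $<\kappa$. An $\alpha$-branch: linearly ordered subset with set of heights $\alpha$; vanishing if no upper bound. $V^-(\mathbf T)$: set of $\alpha\in\mathrm{acc}(\kappa)$ admitting a vanishing $\alpha$-branch; $V(\mathbf T)$: set of $\alpha\in\mathrm{acc}(\kappa)$ such that every node of height $<\alpha$ lies on a vanishing $\alpha$-branch. $H_\kappa$: sets of hereditary cardinality $<\kappa$. A streamlined $\kappa$-tree is a set $T\subseteq{}^{<\kappa}H_\kappa$ closed under restrictions with each $T_\alpha=T\cap{}^\alpha H_\kappa$ nonempty of size $<\kappa$, ordered by $\subsetneq$ (height of $t$ is $\mathrm{dom}(t)$); $T\restriction D=\{t\in T\mid\mathrm{dom}(t)\in D\}$. For $s,t$ with $\mathrm{dom}(s)\le\mathrm{dom}(t)$, $s*t$ is the function on $\mathrm{dom}(t)$ equal to $s$ on $\mathrm{dom}(s)$ and to $t$ elsewhere; $T$ is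 uniformly homogeneous iff $s*t\in T$ for all $s\in T_\alpha,t\in T_\beta$, $\alpha<\beta<\kappa$. *)

theory Defs
  imports Main
begin

unbundle cardinal_syntax

section \<open>Ordinals below \<open>\<kappa>\<close>\<close>

text \<open>The cardinal \<open>\<kappa>\<close> is the order type of a well-ordered type \<open>'k\<close>: the elements of \<open>'k\<close> are
  the ordinals below \<open>\<kappa>\<close>, and the ordinal \<open>\<alpha> < \<kappa>\<close>, as a set, is \<open>{..<\<alpha>}\<close>. That \<open>\<kappa>\<close> is a regular
  uncountable cardinal is expressed by the library predicates applied to the following relation.\<close>

definition kappa :: "'k::wellorder itself \<Rightarrow> 'k rel" where
  "kappa \<kappa> = {(\<alpha>, \<beta>). \<alpha> \<le> \<beta>}"

definition ord_below :: "'k::wellorder \<Rightarrow> 'k rel" where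
  "ord_below \<alpha> = {(\<beta>, \<gamma>). \<beta> \<le> \<gamma> \<and> \<gamma> < \<alpha>}"

definition acc_kappa :: "'k::wellorder set" where
  "acc_kappa = {\<alpha>. (\<exists>\<beta>. \<beta> < \<alpha>) \<and> (\<forall>\<beta><\<alpha>. \<exists>\<gamma>. \<beta> < \<gamma> \<and> \<gamma> < \<alpha>)}"

definition club :: "'k::wellorder set \<Rightarrow> bool" where
  "club D \<longleftrightarrow> (\<forall>\<alpha>. \<exists>\<delta>\<in>D. \<alpha> < \<delta>) \<and>
     (\<forall>\<alpha>\<in>acc_kappa. (\<forall>\<beta><\<alpha>. \<exists>\<delta>\<in>D. \<beta> < \<delta> \<and> \<delta> < \<alpha>) \<longrightarrow> \<alpha> \<in> D)"


section \<open>Trees\<close>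

text \<open>A tree is given by its underlying set and its strict order.\<close>

definition pred_order :: "'b rel \<Rightarrow> 'b \<Rightarrow> 'b rel" where
  "pred_order lt x =
     {(y, z). (y, x) \<in> lt \<and> (z, x) \<in> lt \<and> (y = z \<or> (y, z) \<in> lt)}"

definition is_tree :: "'b set \<Rightarrow> 'b rel \<Rightarrow> bool" where
  "is_tree T lt \<longleftrightarrow> lt \<subseteq> T \<times> T \<and> irrefl lt \<and> trans lt \<and> (\<forall>x\<in>T. Well_order (pred_order lt x))"

text \<open>The nodes whose height is the order type of the well-order \<open>r\<close>. This covers both \<open>T\<^sub>\<alpha>\<close> for
  \<open>\<alpha> < \<kappa>\<close> and \<open>T\<^sub>\<kappa>\<close>, as \<open>\<kappa>\<close> is not itself an element of \<open>'k\<close>.\<close>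

definition level_type :: "'b set \<Rightarrow> 'b rel \<Rightarrow> 'k rel \<Rightarrow> 'b set" where
  "level_type T lt r = {x \<in> T. pred_order lt x =o r}"

definition level :: "'b set \<Rightarrow> 'b rel \<Rightarrow> 'k::wellorder \<Rightarrow> 'b set" where
  "level T lt \<alpha> = level_type T lt (ord_below \<alpha>)"

text \<open>For regular \<open>\<kappa>\<close>, a \<open>\<kappa>\<close>-tree has exactly \<open>\<kappa>\<close> nodes. Hence a type \<open>'b\<close> can carry one only if
  \<open>\<kappa> \<le>o |UNIV :: 'b set|\<close>, and any such type carries isomorphic copies of all of them.\<close>

definition kappa_tree :: "'k::wellorder itself \<Rightarrow> 'b set \<Rightarrow> 'b rel \<Rightarrow> bool" where
  "kappa_tree \<kappa> T lt \<longleftrightarrow> is_tree T lt \<and>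
     (\<forall>\<alpha>::'k. level T lt \<alpha> \<noteq> {} \<and> |level T lt \<alpha>| <o kappa \<kappa>) \<and>
     level_type T lt (kappa \<kappa>) = {}"

text \<open>\<open>A\<close> is the prescribed set of heights: \<open>{..<\<alpha>}\<close> gives the \<open>\<alpha>\<close>-branches and \<open>UNIV\<close> the
  \<open>\<kappa>\<close>-branches.\<close>

definition branch :: "'b set \<Rightarrow> 'b rel \<Rightarrow> 'k::wellorder set \<Rightarrow> 'b set \<Rightarrow> bool" where
  "branch T lt A B \<longleftrightarrow> B \<subseteq> T \<and>
     (\<forall>x\<in>B. \<forall>y\<in>B. x = y \<or> (x, y) \<in> lt \<or> (y, x) \<in> lt) \<and>
     {\<alpha>. B \<inter> level T lt \<alpha> \<noteq> {}} = A"

definition vanishing :: "'b set \<Rightarrow> 'b rel \<Rightarrow> 'b set \<Rightarrow> bool" where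
  "vanishing T lt B \<longleftrightarrow> \<not> (\<exists>t\<in>T. \<forall>x\<in>B. x = t \<or> (x, t) \<in> lt)"

definition V_minus :: "'b set \<Rightarrow> 'b rel \<Rightarrow> 'k::wellorder set" where
  "V_minus T lt = {\<alpha> \<in> acc_kappa. \<exists>B. branch T lt {..<\<alpha>} B \<and> vanishing T lt B}"

definition V_full :: "'b set \<Rightarrow> 'b rel \<Rightarrow> 'k::wellorder set" where
  "V_full T lt = {\<alpha> \<in> acc_kappa. \<forall>\<beta><\<alpha>. \<forall>x \<in> level T lt \<beta>.
     \<exists>B. branch T lt {..<\<alpha>} B \<and> vanishing T lt B \<and> x \<in> B}"

definition aronszajn :: "'k::wellorder itself \<Rightarrow> 'b set \<Rightarrow> 'b rel \<Rightarrow> bool" where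
  "aronszajn \<kappa> T lt \<longleftrightarrow> kappa_tree \<kappa> T lt \<and> \<not> (\<exists>B. branch T lt (UNIV :: 'k set) B)"

definition antichain :: "'b set \<Rightarrow> 'b rel \<Rightarrow> 'b set \<Rightarrow> bool" where
  "antichain T lt A \<longleftrightarrow> A \<subseteq> T \<and> (\<forall>x\<in>A. \<forall>y\<in>A. (x, y) \<notin> lt)"

definition special_aronszajn :: "'k::wellorder itself \<Rightarrow> 'b set \<Rightarrow> 'b rel \<Rightarrow> bool" where
  "special_aronszajn \<kappa> T lt \<longleftrightarrow> aronszajn \<kappa> T lt \<and>
     (\<exists>\<rho>. \<rho> ` T \<subseteq> T \<and>
        (\<forall>x\<in>T. (\<exists>y\<in>T. (y, x) \<in> lt) \<longrightarrow> (\<rho> x, x) \<in> lt) \<and>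
        (\<forall>y\<in>T. \<exists>\<A>. |\<A>| <o kappa \<kappa> \<and> (\<forall>A\<in>\<A>. antichain T lt A) \<and>
           {x \<in> T. \<rho> x = y} \<subseteq> \<Union>\<A>))"

definition automorphism :: "'b set \<Rightarrow> 'b rel \<Rightarrow> ('b \<Rightarrow> 'b) \<Rightarrow> bool" where
  "automorphism T lt \<pi> \<longleftrightarrow> bij_betw \<pi> T T \<and>
     (\<forall>x\<in>T. \<forall>y\<in>T. (\<pi> x, \<pi> y) \<in> lt \<longleftrightarrow> (x, y) \<in> lt)"

definition homogeneous :: "'k::wellorder itself \<Rightarrow> 'b set \<Rightarrow> 'b rel \<Rightarrow> bool" where
  "homogeneous \<kappa> T lt \<longleftrightarrow>
     (\<forall>\<alpha>::'k. \<forall>s \<in> level T lt \<alpha>. \<forall>t \<in> level T lt \<alpha>. \<exists>\<pi>. automorphism T lt \<pi> \<and> \<pi> s = t)"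


section \<open>The sets of hereditary cardinality less than \<open>\<kappa>\<close>\<close>

text \<open>The type \<open>'k vset\<close> of all sets of hereditary cardinality at most \<open>|'k|\<close>: well-founded trees
  (\<open>Code f\<close> codes the set of the sets coded by the members of \<open>ran f\<close>) modulo bisimilarity, which
  for well-founded trees may be taken as a least fixed point.\<close>

datatype 'k vcode = Code "'k \<Rightarrow> 'k vcode option"

inductive vsim :: "'k vcode \<Rightarrow> 'k vcode \<Rightarrow> bool" where
  vsimI: "\<lbrakk>\<forall>a\<in>ran f. \<exists>b\<in>ran g. vsim a b; \<forall>b\<in>ran g. \<exists>a\<in>ran f. vsim a b\<rbrakk>
    \<Longrightarrow> vsim (Code f) (Code g)"

lemma vsim_Code: "vsim (Code f) (Code g) \<longleftrightarrow>
    (\<forall>a\<in>ran f. \<exists>b\<in>ran g. vsim a b) \<and> (\<forall>b\<in>ran g. \<exists>a\<in>ran f. vsim a b)"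
  by (subst vsim.simps) auto

lemma vcode_induct:
  assumes "\<And>f. (\<And>a. a \<in> ran f \<Longrightarrow> P a) \<Longrightarrow> P (Code f)"
  shows "P c"
proof (induction c)
  case (Code f)
  show ?case
    by (rule assms) (force simp: ran_def intro: Code)
qed

lemma vsim_refl: "vsim c c"
  by (induction c rule: vcode_induct) (auto simp: vsim_Code)

lemma vsim_sym: "vsim c d \<Longrightarrow> vsim d c"
  by (induction rule: vsim.induct) (auto simp: vsim_Code)

lemma vsim_trans: "vsim c d \<Longrightarrow> vsim d e \<Longrightarrow> vsim c e"
proof (induction c arbitrary: d e rule: vcode_induct)
  case (1 f)
  obtain g h where [simp]: "d = Code g" "e = Code h"
    by (cases d, cases e) auto
  show ?case
    using 1 by (simp add: vsim_Code) meson
qed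

quotient_type 'k vset = "'k vcode" / vsim
  by (intro equivpI reflpI sympI transpI) (blast intro: vsim_refl vsim_sym vsim_trans)+

definition vmem :: "'k vset rel" where
  "vmem = {(abs_vset c, abs_vset (Code f)) | c f. c \<in> ran f}"

lemma abs_vset_eq_iff: "abs_vset c = abs_vset d \<longleftrightarrow> vsim c d"
  by (rule vset.abs_eq_iff)

lemma abs_vset_cases: obtains c where "x = abs_vset c"
  by (metis Quotient3_vset Quotient3_abs_rep)

lemma vmem_iff: "(x, abs_vset (Code f)) \<in> vmem \<longleftrightarrow> x \<in> abs_vset ` ran f"
proof
  assume "(x, abs_vset (Code f)) \<in> vmem"
  then obtain c g where "x = abs_vset c" "c \<in> ran g" "vsim (Code f) (Code g)"
    by (auto simp: vmem_def abs_vset_eq_iff)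
  then show "x \<in> abs_vset ` ran f"
    by (auto simp: vsim_Code) (metis abs_vset_eq_iff image_eqI)
qed (auto simp: vmem_def)

lemma vset_extensional: "(\<And>z. (z, x) \<in> vmem \<longleftrightarrow> (z, y) \<in> vmem) \<Longrightarrow> x = y"
proof -
  assume *: "\<And>z. (z, x) \<in> vmem \<longleftrightarrow> (z, y) \<in> vmem"
  obtain f g where "x = abs_vset (Code f)" "y = abs_vset (Code g)"
    by (metis abs_vset_cases vcode.exhaust)
  with * have "abs_vset ` ran f = abs_vset ` ran g" "x = abs_vset (Code f)" "y = abs_vset (Code g)"
    by (auto simp: vmem_iff set_eq_iff)
  then show "x = y"
    by (simp add: abs_vset_eq_iff vsim_Code set_eq_iff image_iff) (metis abs_vset_eq_iff vsim_sym)
qed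

lemma wf_vmem: "wf vmem"
proof (rule wfUNIVI)
  fix P :: "'a vset \<Rightarrow> bool" and x
  assume *: "\<forall>x. (\<forall>y. (y, x) \<in> vmem \<longrightarrow> P y) \<longrightarrow> P x"
  have "P (abs_vset c)" for c
    by (induction c rule: vcode_induct) (rule *[rule_format], auto simp: vmem_iff)
  then show "P x"
    by (metis abs_vset_cases)
qed

lemma vset_exists_iff:
  fixes A :: "'k vset set"
  shows "(\<exists>x. {y. (y, x) \<in> vmem} = A) \<longleftrightarrow> |A| \<le>o |UNIV :: 'k set|"
proof
  assume "\<exists>x. {y. (y, x) \<in> vmem} = A"
  then obtain x where x: "A = {y. (y, x) \<in> vmem}" by blast
  obtain f where "x = abs_vset (Code f)"
    by (metis abs_vset_cases vcode.exhaust)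
  with x have "A = abs_vset ` ran f"
    by (auto simp: vmem_iff)
  moreover have "ran f \<subseteq> (\<lambda>i. the (f i)) ` UNIV"
    by (auto simp: ran_def image_iff) (metis option.sel)
  ultimately have "A \<subseteq> (\<lambda>i. abs_vset (the (f i))) ` UNIV"
    by auto
  then show "|A| \<le>o |UNIV :: 'k set|"
    using card_of_mono1 card_of_image ordLeq_transitive by blast
next
  assume "|A| \<le>o |UNIV :: 'k set|"
  then obtain h :: "'k vset \<Rightarrow> 'k" where h: "inj_on h A"
    using card_of_ordLeq[of A "UNIV :: 'k set"] by blast
  define f where "f i = (if i \<in> h ` A then Some (rep_vset (inv_into A h i)) else None)" for i
  have "ran f = rep_vset ` A"
  proof (intro equalityI subsetI)
    fix c assume "c \<in> rep_vset ` A"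
    then obtain x where "x \<in> A" "c = rep_vset x" by blast
    then have "f (h x) = Some c"
      using h by (simp add: f_def)
    then show "c \<in> ran f" by (rule ranI)
  qed (auto simp: f_def ran_def h split: if_splits)
  then have "abs_vset ` ran f = A"
    by (simp add: image_image Quotient3_abs_rep[OF Quotient3_vset])
  then have "{y. (y, abs_vset (Code f)) \<in> vmem} = A"
    by (auto simp: vmem_iff)
  then show "\<exists>x. {y. (y, x) \<in> vmem} = A" by blast
qed

definition H_kappa :: "'k::wellorder vset set" where
  "H_kappa = {x. |{y. (y, x) \<in> vmem\<^sup>+}| <o kappa TYPE('k)}"


section \<open>Streamlined trees\<close>

text \<open>A function whose domain is an ordinal \<open>\<alpha> < \<kappa>\<close> is a partial map with domain \<open>{..<\<alpha>}\<close>.\<close>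

type_synonym 'k node = "'k \<Rightarrow> 'k vset option"

definition slevel :: "'k::wellorder node set \<Rightarrow> 'k \<Rightarrow> 'k node set" where
  "slevel T \<alpha> = {t \<in> T. dom t = {..<\<alpha>} \<and> ran t \<subseteq> H_kappa}"

definition streamlined :: "'k::wellorder node set \<Rightarrow> bool" where
  "streamlined T \<longleftrightarrow> T \<subseteq> (\<Union>\<alpha>. slevel T \<alpha>) \<and>
     (\<forall>t\<in>T. \<forall>\<alpha>. t |` {..<\<alpha>} \<in> T) \<and>
     (\<forall>\<alpha>. slevel T \<alpha> \<noteq> {} \<and> |slevel T \<alpha>| <o kappa TYPE('k))"

definition sorder :: "'k node set \<Rightarrow> 'k node rel" where
  "sorder T = {(s, t). s \<in> T \<and> t \<in> T \<and> s \<subseteq>\<^sub>m t \<and> s \<noteq> t}"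

definition srestrict :: "'k::wellorder node set \<Rightarrow> 'k set \<Rightarrow> 'k node set" where
  "srestrict T D = (\<Union>\<alpha>\<in>D. slevel T \<alpha>)"

text \<open>The function \<open>s * t\<close> is \<open>t ++ s\<close>, the right argument of \<open>++\<close> taking precedence.\<close>

definition uniformly_homogeneous :: "'k::wellorder node set \<Rightarrow> bool" where
  "uniformly_homogeneous T \<longleftrightarrow>
     (\<forall>\<alpha> \<beta>. \<alpha> < \<beta> \<longrightarrow> (\<forall>s \<in> slevel T \<alpha>. \<forall>t \<in> slevel T \<beta>. t ++ s \<in> T))"

end

theory Submission
  imports Defs
begin

text \<open>
  A special tree carries a colouring of its nodes at the levels in some club that is regressive and
  injective on chains, and conversely such a colouring makes a tree special Aronszajn.

  From (i) to (ii), the obstacle is that nodes of a special tree need not be determined by their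
  predecessors, and identifying nodes with the same predecessors can destroy specialness. Instead,
  choose a node \<open>x\<^sub>\<alpha>\<close> at each level \<open>\<alpha>\<close> and let \<open>C\<^sub>\<alpha>\<close> be the set of places below \<open>\<alpha>\<close> where the colour of
  the restriction of \<open>x\<^sub>\<alpha>\<close> is smaller than all later ones. These sets have few initial segments, and
  colours increase along them, so that a level in the club at which \<open>C\<^sub>\<alpha>\<close> accumulates sees only
  bounded colours of \<open>C\<^sub>\<alpha>\<close> below it. Todorcevic's walks along \<open>C\<close> then yield a tree of functions with a
  regressive colouring. Side copies of this tree that are cut off at the nodes of a prescribed
  colour produce the vanishing branches.

  From (ii) to (iii), one takes all finite concatenations of pieces of nodes of \<open>K\<close>: the injectivity
  condition recovers a node of \<open>K\<close> from any of its tails. From (iii) to (iv), one keeps only the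
  levels in the club.
\<close>

section \<open>Small sets\<close>

text \<open>Two counts carry the passage from (i) to (ii). A trace, that is the part of a record set
  below \<gamma>, depends only on the colours along the chosen node below \<gamma> and on the least
  colour from \<gamma> on, which is at most \<gamma>; so there are few traces. The walk down to
  \<gamma> is finite, and its traces determine the walks to everything below \<gamma>; so the tree
  of walks has small levels. The colour at a limit \<gamma> consists of the index n of an entry of
  the walks that grows into a trace M cofinal in \<gamma>, a place \<eta> from which it does so, and
  the supremum of the colours in M if that is below \<gamma>. Suppose a node at \<delta> > \<gamma>
  and its restriction to \<gamma> have equal colours. The common n and \<eta> make M an initial
  segment of the trace at \<delta>. The colour at \<gamma> is regressive and exceeds all of M, so
  the supremum is below \<gamma>; but the longer trace has further, strictly larger colours, so the
  suprema differ. Injectivity on chains enters before that: each colour occurs only finitely often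
  along a node, which makes the records cofinal.\<close>

locale regular_uncountable =
  fixes \<kappa> :: "'k::wellorder itself"
  assumes Card: "Card_order (kappa \<kappa>)" and regular: "regularCard (kappa \<kappa>)"
    and uncountable: "natLeq <o kappa \<kappa>"
begin

definition small :: "'a set \<Rightarrow> bool" where
  "small A \<longleftrightarrow> |A| <o kappa \<kappa>"

lemma Field_kappa: "Field (kappa \<kappa>) = (UNIV :: 'k set)"
  by (auto simp: kappa_def Field_def)

lemma kappa_iff: "(\<alpha>, \<beta>) \<in> kappa \<kappa> \<longleftrightarrow> \<alpha> \<le> \<beta>"
  by (simp add: kappa_def)

lemma infinite_kappa: "\<not> finite (Field (kappa \<kappa>))"
  using uncountable Card natLeq_Card_order
  by (metis Field_natLeq finite_iff_ordLess_natLeq card_of_Field_ordIso not_ordLess_ordIso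
      ordLess_transitive ordLess_ordIso_trans ordIso_symmetric)

lemma Cinfinite_kappa: "Cinfinite (kappa \<kappa>)"
  using infinite_kappa Card by (simp add: cinfinite_def)

lemma card_UNIV: "|UNIV :: 'k set| =o kappa \<kappa>"
  using card_of_Field_ordIso[OF Card] by (simp add: Field_kappa)

lemma underS_kappa: "underS (kappa \<kappa>) \<alpha> = {..<\<alpha>}"
  by (auto simp: underS_def kappa_def)

lemma small_lessThan: "small {..<\<alpha>::'k}"
  using card_of_underS[OF Card, of \<alpha>] by (simp add: small_def Field_kappa underS_kappa)

lemma small_image: "small A \<Longrightarrow> small (f ` A)"
  unfolding small_def using card_of_image ordLeq_ordLess_trans by blast

lemma small_subset: "small B \<Longrightarrow> A \<subseteq> B \<Longrightarrow> small A"
  unfolding small_def using card_of_mono1 ordLeq_ordLess_trans by blast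

lemma small_UN: "small I \<Longrightarrow> (\<And>i. i \<in> I \<Longrightarrow> small (F i)) \<Longrightarrow> small (\<Union>i\<in>I. F i)"
  unfolding small_def
  using card_of_UNION_ordLess_infinite_Field_regularCard[OF regular Cinfinite_kappa] by blast

lemma small_nat: "small (A :: nat set)"
proof -
  have "|UNIV :: nat set| =o natLeq"
    using card_of_Field_ordIso[OF natLeq_Card_order] by (simp add: Field_natLeq)
  then show ?thesis
    using uncountable small_def small_subset ordIso_ordLess_trans by blast
qed

lemma small_finite: "finite A \<Longrightarrow> small A"
proof -
  assume "finite A"
  then obtain f :: "'a \<Rightarrow> nat" where "inj_on f A"
    using finite_imp_inj_to_nat_seg by meson
  then have "A = inv_into A f ` f ` A"
    by (auto simp: image_image)
  then show ?thesis
    by (metis small_nat small_image)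
qed

lemma small_Un: "small A \<Longrightarrow> small B \<Longrightarrow> small (A \<union> B)"
proof -
  assume "small A" "small B"
  then have "small (\<Union>i\<in>UNIV. if i then A else B)"
    by (intro small_UN small_finite[of UNIV]) auto
  then show ?thesis
    by (rule small_subset) (auto split: if_splits)
qed

lemma small_Sigma: "small A \<Longrightarrow> (\<And>a. a \<in> A \<Longrightarrow> small (B a)) \<Longrightarrow> small (Sigma A B)"
proof -
  assume "small A" "\<And>a. a \<in> A \<Longrightarrow> small (B a)"
  then have "small (\<Union>a\<in>A. Pair a ` B a)"
    by (intro small_UN small_image)
  then show ?thesis
    by (rule small_subset) auto
qed

lemma small_insert_None: "small A \<Longrightarrow> small (insert None (Some ` A))"
  by (metis insert_is_Un small_Un small_finite small_image finite.emptyI finite.insertI)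

text \<open>Induction on the length handles lists of a fixed length; uncountability of \<kappa> is
  what makes the union over all lengths small. Walks and concatenations are both counted by
  lists.\<close>

lemma small_lists: "small A \<Longrightarrow> small (lists A)"
proof -
  assume A: "small A"
  have n: "small {xs. set xs \<subseteq> A \<and> length xs = n}" for n
  proof (induction n)
    case (Suc n)
    have "{xs. set xs \<subseteq> A \<and> length xs = Suc n}
        \<subseteq> (\<lambda>(x, xs). x # xs) ` (A \<times> {xs. set xs \<subseteq> A \<and> length xs = n})"
      by (force simp: length_Suc_conv)
    then show ?case
      using A Suc small_image small_Sigma small_subset by meson
  qed (auto intro: small_finite)
  have "lists A = (\<Union>n\<in>UNIV. {xs. set xs \<subseteq> A \<and> length xs = n})"
    by (auto simp: in_lists_conv_set)
  moreover have "small (\<Union>n\<in>UNIV. {xs. set xs \<subseteq> A \<and> length xs = n})"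
    by (rule small_UN[OF small_nat n])
  ultimately show ?thesis by simp
qed

lemma small_bounded:
  assumes "small (A :: 'k set)" obtains b where "\<And>a. a \<in> A \<Longrightarrow> a < b"
proof -
  have "\<not> cofinal A (kappa \<kappa>)"
    using assms regular unfolding small_def regularCard_def
    by (metis Field_kappa not_ordLess_ordIso top_greatest)
  then obtain c where c: "\<forall>a\<in>A. a \<le> c"
    unfolding cofinal_def by (auto simp: Field_kappa kappa_iff) (metis linear)
  obtain b where "c < b"
    using infinite_Card_order_limit[OF Card infinite_kappa, of c]
    by (auto simp: kappa_iff Field_kappa less_le)
  with c that show thesis
    by (meson order.strict_trans1)
qed

lemma ex_greater: "\<exists>\<beta>. (\<alpha>::'k) < \<beta>"
  by (rule small_bounded[of "{\<alpha>}"]) (auto intro: small_finite)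

lemma small_atMost: "small {..\<alpha>::'k}"
  by (metis ex_greater small_lessThan small_subset lessThan_subset_iff lessThan_iff subsetI
      atMost_iff order.strict_trans1)

definition atmost_kappa :: "'a set \<Rightarrow> bool" where
  "atmost_kappa A \<longleftrightarrow> |A| \<le>o kappa \<kappa>"

lemma atmost_kappa_UN:
  fixes F :: "'k \<Rightarrow> 'a set"
  assumes "\<And>\<alpha>. small (F \<alpha>)" shows "atmost_kappa (\<Union>\<alpha>. F \<alpha>)"
  unfolding atmost_kappa_def
  using UNION_Cinfinite_bound[OF _ _ Cinfinite_kappa, of UNIV F] card_UNIV assms
  by (meson small_def ordIso_imp_ordLeq ordLess_imp_ordLeq)

lemma atmost_kappa_inj:
  assumes "atmost_kappa A" obtains q :: "'a \<Rightarrow> 'k" where "inj_on q A"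
proof -
  have "|A| \<le>o |UNIV :: 'k set|"
    using assms card_UNIV ordIso_symmetric ordLeq_ordIso_trans unfolding atmost_kappa_def by blast
  then show thesis
    using that card_of_ordLeq[of A "UNIV :: 'k set"] by blast
qed

lemma ex_card_inj:
  assumes "atmost_kappa A" "kappa \<kappa> \<le>o |UNIV :: 'b set|"
  obtains q :: "'a \<Rightarrow> 'b" where "inj_on q A"
proof -
  have "|A| \<le>o |UNIV :: 'b set|"
    using assms ordLeq_transitive unfolding atmost_kappa_def by blast
  then show thesis
    using that card_of_ordLeq[of A "UNIV :: 'b set"] by blast
qed

section \<open>Clubs\<close>

text \<open>Sets of limit closure points form a base of the club filter: each is a club, each club
  contains one, and two of them intersect in the one for the pointwise maximum. Clubs can therefore
  be shrunk by choosing functions.\<close>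

definition closed_under :: "('k \<Rightarrow> 'k) \<Rightarrow> 'k set" where
  "closed_under h = {\<alpha> \<in> acc_kappa. \<forall>\<beta><\<alpha>. h \<beta> < \<alpha>}"

lemma closed_under_acc: "closed_under h \<subseteq> acc_kappa"
  by (auto simp: closed_under_def)

lemma acc_ex_between: "\<alpha> \<in> acc_kappa \<Longrightarrow> \<beta> < \<alpha> \<Longrightarrow> \<exists>\<gamma>. \<beta> < \<gamma> \<and> \<gamma> < (\<alpha>::'k)"
  by (auto simp: acc_kappa_def)

lemma club_closed_under: "club (closed_under h)"
  unfolding club_def
proof (intro conjI ballI allI impI)
  fix \<alpha> :: 'k
  \<comment> \<open>Dominating h on the whole segment up to \<beta>, and not only at \<beta>, makes
    the limit of the iterates closed: a point below the limit need not be an iterate.\<close>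
  have "\<exists>\<gamma>. \<beta> < \<gamma> \<and> (\<forall>\<zeta>\<le>\<beta>. h \<zeta> < \<gamma>)" for \<beta>
  proof -
    have "small (insert \<beta> (h ` {..\<beta>}))"
      by (metis insert_is_Un small_Un small_finite small_image small_atMost finite.emptyI finite.insertI)
    then show ?thesis
      by (rule small_bounded) blast
  qed
  then obtain s where s: "\<And>\<beta>. \<beta> < s \<beta>" "\<And>\<beta> \<zeta>. \<zeta> \<le> \<beta> \<Longrightarrow> h \<zeta> < s \<beta>"
    by metis
  define a where "a n = (s ^^ n) \<alpha>" for n
  have a0: "a 0 = \<alpha>" and aS: "a (Suc n) = s (a n)" for n
    by (auto simp: a_def)
  obtain b0 where b0: "\<And>n. a n < b0"
    using small_bounded[OF small_image[OF small_nat[of UNIV], of a]] by (metis rangeI)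
  \<comment> \<open>The supremum of the iterates, which exists below \<kappa> because a countable
    set is small.\<close>
  define b where "b = (LEAST b. \<forall>n. a n < b)"
  have b: "a n < b" for n
    unfolding b_def using LeastI[of "\<lambda>b. \<forall>n. a n < b" b0] b0 by simp
  have bb: "\<exists>n. \<beta> < a n" if "\<beta> < b" for \<beta>
  proof -
    have "\<not> (\<forall>n. a n < \<beta>)"
      using that not_less_Least unfolding b_def by blast
    then obtain n where "\<not> a n < \<beta>"
      by blast
    then have "\<beta> < a (Suc n)"
      using s(1)[of "a n"] by (simp add: aS not_less)
    then show ?thesis ..
  qed
  have "h \<beta> < b" if "\<beta> < b" for \<beta>
  proof -
    obtain n where "\<beta> < a n" using bb[OF \<open>\<beta> < b\<close>] by blast
    then have "h \<beta> < a (Suc n)" by (simp add: aS s(2))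
    then show ?thesis using b order.strict_trans by blast
  qed
  then have "b \<in> closed_under h"
    unfolding closed_under_def acc_kappa_def using b bb by simp meson
  with b[of 0] show "\<exists>\<delta>\<in>closed_under h. \<alpha> < \<delta>"
    by (auto simp: a0)
next
  fix \<alpha> :: 'k assume "\<alpha> \<in> acc_kappa" "\<forall>\<beta><\<alpha>. \<exists>\<delta>\<in>closed_under h. \<beta> < \<delta> \<and> \<delta> < \<alpha>"
  then show "\<alpha> \<in> closed_under h"
    unfolding closed_under_def by (simp, meson order.strict_trans)
qed

text \<open>Let h jump from \<alpha> to an element of D above \<alpha>; a limit closed under h is
  then a limit of elements of D.\<close>

lemma club_contains_closed_under:
  assumes "club D" obtains h where "closed_under h \<subseteq> D"
proof -
  obtain h where h: "\<And>\<alpha>. h \<alpha> \<in> D \<and> \<alpha> < h \<alpha>"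
    using assms unfolding club_def by metis
  have "closed_under h \<subseteq> D"
    using assms h unfolding club_def closed_under_def by blast
  then show thesis by (rule that)
qed

lemma closed_under_max:
  "closed_under (\<lambda>\<alpha>. max (h \<alpha>) (h' \<alpha>)) = closed_under h \<inter> closed_under h'"
  by (auto simp: closed_under_def)

lemma club_inter_closed_under:
  assumes "club D" obtains h' where "closed_under h' \<subseteq> D \<inter> closed_under h"
  using club_contains_closed_under[OF assms] closed_under_max by (metis inf_mono order_refl)

text \<open>The only instance of Fodor's lemma that is needed.\<close>

lemma no_regressive_injection:
  fixes f :: "'k \<Rightarrow> 'k"
  assumes "club D" "\<And>\<alpha>. \<alpha> \<in> D \<Longrightarrow> f \<alpha> < \<alpha>" "inj_on f D"
  shows False
proof -
  \<comment> \<open>For \<alpha> in D closed under the inverse of f, the value f \<alpha> < \<alpha>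
    would have to be sent back below \<alpha>, whereas it is sent to \<alpha>.\<close>
  obtain h' where h': "closed_under h' \<subseteq> D \<inter> closed_under (inv_into D f)"
    using assms(1) by (rule club_inter_closed_under)
  obtain \<alpha> where "\<alpha> \<in> closed_under h'"
    using club_closed_under[of h'] unfolding club_def by blast
  with h' have "\<alpha> \<in> D" "\<alpha> \<in> closed_under (inv_into D f)"
    by auto
  with assms show False
    unfolding closed_under_def by (metis (lifting) inv_into_f_f mem_Collect_eq order.irrefl)
qed

text \<open>Lets colours be tuples instead of ordinals. \<open>G \<beta>\<close> holds the colours
  available at stage \<beta>. At the closure points \<alpha> of a function that bounds q on each
  \<open>G \<beta>\<close>, every colour available before \<alpha> has its code below
  \<alpha>.\<close>

lemma regressive_recoding:
  fixes G :: "'k \<Rightarrow> 'a set"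
  assumes "club D" "\<And>\<beta>. small (G \<beta>)"
  obtains D' and q :: "'a \<Rightarrow> 'k" where "club D'" "D' \<subseteq> D" "D' \<subseteq> acc_kappa" "inj_on q (\<Union>\<beta>. G \<beta>)"
    "\<forall>\<alpha>\<in>D'. \<forall>\<beta><\<alpha>. \<forall>c\<in>G \<beta>. q c < \<alpha>"
proof -
  obtain q :: "'a \<Rightarrow> 'k" where q: "inj_on q (\<Union>\<beta>. G \<beta>)"
    using atmost_kappa_inj[OF atmost_kappa_UN] assms(2) by blast
  have "\<exists>b. \<forall>c\<in>G \<beta>. q c < b" for \<beta>
    by (rule small_bounded[OF small_image[OF assms(2)[of \<beta>], of q]]) blast
  then obtain h where h: "\<And>\<beta> c. c \<in> G \<beta> \<Longrightarrow> q c < h \<beta>"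
    by metis
  obtain h' where h': "closed_under h' \<subseteq> D \<inter> closed_under h"
    using assms(1) by (rule club_inter_closed_under)
  show thesis
  proof (rule that[OF club_closed_under[of h'] _ closed_under_acc q])
    show "closed_under h' \<subseteq> D"
      using h' by blast
  next
    show "\<forall>\<alpha>\<in>closed_under h'. \<forall>\<beta><\<alpha>. \<forall>c\<in>G \<beta>. q c < \<alpha>"
      using h h' unfolding closed_under_def by (metis (lifting) IntE mem_Collect_eq order.strict_trans subsetD)
  qed
qed

end

section \<open>Special trees and regressive colourings\<close>

text \<open>Trees are defined through order types of predecessor sets, which are awkward to compute
  with. Here the height is a function into \<open>'k\<close> that maps the predecessors of a node
  bijectively onto the ordinals below its height; \<open>height_tree_pred_order\<close> and
  \<open>kappa_tree_height\<close> translate between the two views.\<close>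

locale height_tree =
  fixes T :: "'b set" and lt :: "'b rel" and ht :: "'b \<Rightarrow> 'k::wellorder"
  assumes lt_subset: "lt \<subseteq> T \<times> T" and lt_trans: "trans lt"
    and ht_mono: "(x, y) \<in> lt \<Longrightarrow> ht x < ht y"
    and ex_below: "x \<in> T \<Longrightarrow> \<gamma> < ht x \<Longrightarrow> \<exists>y. (y, x) \<in> lt \<and> ht y = \<gamma>"
    and below_unique: "(y, x) \<in> lt \<Longrightarrow> (z, x) \<in> lt \<Longrightarrow> ht y = ht z \<Longrightarrow> y = z"
begin

definition proj :: "'b \<Rightarrow> 'k \<Rightarrow> 'b" where
  "proj x \<gamma> = (if \<gamma> = ht x then x else THE y. (y, x) \<in> lt \<and> ht y = \<gamma>)"

lemma proj_self [simp]: "proj x (ht x) = x"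
  by (simp add: proj_def)

lemma proj_eqI: "(y, x) \<in> lt \<Longrightarrow> proj x (ht y) = y"
  using ht_mono[of y x] below_unique by (auto simp: proj_def)

lemma proj_lt: "x \<in> T \<Longrightarrow> \<gamma> < ht x \<Longrightarrow> (proj x \<gamma>, x) \<in> lt \<and> ht (proj x \<gamma>) = \<gamma>"
  using ex_below proj_eqI by metis

lemma ht_proj: "x \<in> T \<Longrightarrow> \<gamma> \<le> ht x \<Longrightarrow> ht (proj x \<gamma>) = \<gamma>"
  using proj_lt by (metis order.order_iff_strict proj_self)

lemma proj_in: "x \<in> T \<Longrightarrow> \<gamma> \<le> ht x \<Longrightarrow> proj x \<gamma> \<in> T"
  using proj_lt lt_subset by (metis SigmaD1 order.order_iff_strict proj_self subsetD)

lemma proj_proj: "x \<in> T \<Longrightarrow> \<gamma> \<le> \<delta> \<Longrightarrow> \<delta> \<le> ht x \<Longrightarrow> proj (proj x \<delta>) \<gamma> = proj x \<gamma>"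
proof -
  assume *: "x \<in> T" "\<gamma> \<le> \<delta>" "\<delta> \<le> ht x"
  show ?thesis
  proof (cases "\<gamma> = \<delta> \<or> \<delta> = ht x")
    case True
    then show ?thesis using * by (metis ht_proj proj_self)
  next
    case False
    then have "(proj x \<delta>, x) \<in> lt" "(proj (proj x \<delta>) \<gamma>, proj x \<delta>) \<in> lt" "ht (proj (proj x \<delta>) \<gamma>) = \<gamma>"
      using * proj_lt proj_in by auto
    then show ?thesis
      using lt_trans proj_eqI by (metis transD)
  qed
qed

lemma lt_iff: "x \<in> T \<Longrightarrow> y \<in> T \<Longrightarrow> (x, y) \<in> lt \<longleftrightarrow> ht x < ht y \<and> proj y (ht x) = x"
  using proj_lt proj_eqI ht_mono by metis

text \<open>Comparability of predecessors is not among the axioms of the locale. It follows because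
  the predecessor of z at height \<open>ht y\<close> also lies below x, so that uniqueness at each
  height identifies it with y.\<close>

lemma below_comparable: "(y, x) \<in> lt \<Longrightarrow> (z, x) \<in> lt \<Longrightarrow> ht y < ht z \<Longrightarrow> (y, z) \<in> lt"
  using lt_subset proj_eqI proj_proj[of x "ht y" "ht z"] ht_mono[of z x]
  by (metis SigmaE2 lt_iff less_imp_le subsetD)

end

section \<open>Heights versus order types, and colourings versus regressive maps into the
  tree\<close>

context regular_uncountable
begin

lemma Well_order_kappa: "Well_order (kappa \<kappa>)"
  using Card card_order_on_well_order_on by blast

lemma ord_below_eq: "ord_below \<alpha> = Restr (kappa \<kappa>) (underS (kappa \<kappa>) \<alpha>)"
  by (auto simp: ord_below_def kappa_iff underS_kappa)

lemma Field_ord_below: "Field (ord_below (\<alpha>::'k)) = {..<\<alpha>}"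
  by (auto simp: ord_below_def Field_def)

lemma Well_order_ord_below: "Well_order (ord_below (\<alpha>::'k))"
  unfolding ord_below_eq by (rule Well_order_Restr[OF Well_order_kappa])

lemma ord_below_less: "\<alpha> < \<beta> \<Longrightarrow> ord_below (\<alpha>::'k) <o ord_below \<beta>"
  unfolding ord_below_eq
  using ofilter_subset_ordLess[OF Well_order_kappa, of "underS (kappa \<kappa>) \<alpha>" "underS (kappa \<kappa>) \<beta>"]
    wo_rel.underS_ofilter[of "kappa \<kappa>"] Well_order_kappa
  by (auto simp: wo_rel_def underS_kappa)

lemma ord_below_less_iff: "ord_below (\<alpha>::'k) <o ord_below \<beta> \<longleftrightarrow> \<alpha> < \<beta>"
  using ord_below_less not_ordLess_ordLeq ordLess_irreflexive by (metis linorder_neqE ordLess_imp_ordLeq)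

lemma ord_below_iso_iff: "ord_below (\<alpha>::'k) =o ord_below \<beta> \<longleftrightarrow> \<alpha> = \<beta>"
  using ord_below_less not_ordLess_ordIso Well_order_ord_below ordIso_reflexive ordIso_symmetric
  by (metis linorder_neqE)

lemma ord_below_less_kappa: "ord_below (\<alpha>::'k) <o kappa \<kappa>"
  unfolding ord_below_eq using underS_Restr_ordLess[OF Well_order_kappa] Field_kappa by auto

text \<open>The projection \<open>proj x\<close> is an order isomorphism from the ordinals below the
  height of x onto the predecessors of x.\<close>

lemma height_tree_pred_order:
  assumes "height_tree T lt (ht :: 'b \<Rightarrow> 'k)" "x \<in> T"
  shows "Well_order (pred_order lt x)" "pred_order lt x =o ord_below (ht x)"
proof -
  interpret height_tree T lt ht by fact
  have "pred_order lt x = dir_image (ord_below (ht x)) (proj x)" (is "?l = ?r")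
  proof (intro equalityI subsetI; clarify)
    fix y z assume "(y, z) \<in> ?l"
    then have *: "(y, x) \<in> lt" "(z, x) \<in> lt" "y = z \<or> (y, z) \<in> lt"
      by (auto simp: pred_order_def)
    then have "(ht y, ht z) \<in> ord_below (ht x)"
      using ht_mono by (auto simp: ord_below_def less_imp_le)
    then show "(y, z) \<in> ?r"
      using *(1,2)[THEN proj_eqI, symmetric] unfolding dir_image_def by blast
  next
    fix y z assume "(y, z) \<in> ?r"
    then obtain \<beta> \<gamma> where *: "y = proj x \<beta>" "z = proj x \<gamma>" "\<beta> \<le> \<gamma>" "\<gamma> < ht x"
      by (auto simp: dir_image_def ord_below_def)
    then have "(y, x) \<in> lt" "(z, x) \<in> lt" "ht y = \<beta>" "ht z = \<gamma>"
      using proj_lt assms(2) by auto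
    then show "(y, z) \<in> ?l"
      using *(3) below_comparable[of y x z] below_unique[of y x z] unfolding pred_order_def
      by (simp add: order.order_iff_strict) metis
  qed
  moreover have "inj_on (proj x) (Field (ord_below (ht x)))"
    unfolding Field_ord_below inj_on_def using proj_lt assms(2) by (metis lessThan_iff)
  ultimately show "Well_order (pred_order lt x)" "pred_order lt x =o ord_below (ht x)"
    using Well_order_ord_below Well_order_dir_image dir_image_ordIso ordIso_symmetric by metis+
qed

lemma level_height_tree:
  assumes "height_tree T lt (ht :: 'b \<Rightarrow> 'k)"
  shows "level T lt \<alpha> = {x \<in> T. ht x = \<alpha>}"
  unfolding level_def level_type_def
  using height_tree_pred_order[OF assms] ord_below_iso_iff
  by (metis (no_types, lifting) ordIso_symmetric ordIso_transitive)

lemma kappa_treeI: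
  assumes "height_tree T lt (ht :: 'b \<Rightarrow> 'k)"
    and "\<And>\<alpha>. {x \<in> T. ht x = \<alpha>} \<noteq> {}" "\<And>\<alpha>. small {x \<in> T. ht x = \<alpha>}"
  shows "kappa_tree \<kappa> T lt"
proof -
  interpret height_tree T lt ht by fact
  have "is_tree T lt"
    unfolding is_tree_def irrefl_def
    using lt_subset lt_trans ht_mono height_tree_pred_order[OF assms(1)] by blast
  moreover have "\<not> pred_order lt x =o kappa \<kappa>" if "x \<in> T" for x
    using height_tree_pred_order(2)[OF assms(1) that] ord_below_less_kappa
    by (meson not_ordLess_ordIso ordIso_symmetric ordIso_transitive)
  ultimately show ?thesis
    using assms(2,3) unfolding kappa_tree_def level_height_tree[OF assms(1)]
    by (auto simp: small_def level_type_def)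
qed

text \<open>Initial segments of the predecessors of x are the predecessor sets of smaller nodes. If
  the type of x were at least \<kappa>, then x or some node below it would have type exactly
  \<kappa>, against the emptiness of that level. So every type is that of an ordinal below \<kappa>,
  which serves as the height.\<close>

lemma kappa_tree_height:
  assumes "kappa_tree \<kappa> T lt" obtains ht :: "'b \<Rightarrow> 'k" where "height_tree T lt ht"
proof -
  have tree: "is_tree T lt" and none: "level_type T lt (kappa \<kappa>) = {}"
    using assms by (auto simp: kappa_tree_def)
  then have sub: "lt \<subseteq> T \<times> T" and tr: "trans lt" and irr: "irrefl lt"
    and wo: "\<And>x. x \<in> T \<Longrightarrow> Well_order (pred_order lt x)"
    by (auto simp: is_tree_def)
  have restr: "Restr (pred_order lt x) (underS (pred_order lt x) y) = pred_order lt y"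
    if "(y, x) \<in> lt" for x y
    using that tr irr unfolding pred_order_def underS_def irrefl_def trans_def by auto
  have fld: "Field (pred_order lt x) = {y. (y, x) \<in> lt}" for x
    by (auto simp: pred_order_def Field_def)
  have below: "pred_order lt y <o pred_order lt x" if "(y, x) \<in> lt" for x y
  proof -
    have "Well_order (pred_order lt x)" "Field (pred_order lt x) \<noteq> {}"
      using that sub wo fld[of x] by blast+
    from underS_Restr_ordLess[OF this, of y] show ?thesis
      by (simp add: restr[OF that])
  qed
  have ex: "\<exists>y. (y, x) \<in> lt \<and> r =o pred_order lt y" if "r <o pred_order lt x" "x \<in> T" for r :: "'k rel" and x
  proof -
    have "Well_order r"
      using that(1) by (auto simp: ordLess_def)
    then show ?thesis
      using that wo[OF that(2)] ordLess_iff_ordIso_Restr[of "pred_order lt x" r] restr fld by auto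
  qed
  have "\<exists>\<alpha>. pred_order lt x =o ord_below (\<alpha>::'k)" if x: "x \<in> T" for x
  proof -
    have "\<not> kappa \<kappa> \<le>o pred_order lt x"
    proof
      assume "kappa \<kappa> \<le>o pred_order lt x"
      then consider "kappa \<kappa> <o pred_order lt x" | "kappa \<kappa> =o pred_order lt x"
        using ordLeq_iff_ordLess_or_ordIso by blast
      then have "\<exists>y\<in>T. kappa \<kappa> =o pred_order lt y"
        using ex[of "kappa \<kappa>" x] x sub by cases auto
      then show False
        using none ordIso_symmetric unfolding level_type_def by blast
    qed
    then have "pred_order lt x <o kappa \<kappa>"
      using not_ordLeq_iff_ordLess[OF wo[OF x] Well_order_kappa] by blast
    then show ?thesis
      unfolding ord_below_eq ordLess_iff_ordIso_Restr[OF Well_order_kappa wo[OF x]] by blast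
  qed
  then obtain ht where ht: "\<And>x. x \<in> T \<Longrightarrow> pred_order lt x =o ord_below (ht x :: 'k)"
    by metis
  have mono: "ht x < ht y" if "(x, y) \<in> lt" for x y
  proof -
    have "x \<in> T" "y \<in> T"
      using that sub by auto
    then have "ord_below (ht x) <o ord_below (ht y)"
      using below[OF that] ht ordIso_ordLess_trans[OF ordIso_symmetric] ordLess_ordIso_trans by blast
    then show ?thesis
      by (simp add: ord_below_less_iff)
  qed
  have "height_tree T lt ht"
  proof
    show "\<exists>y. (y, x) \<in> lt \<and> ht y = \<gamma>" if "x \<in> T" "\<gamma> < ht x" for x \<gamma>
    proof -
      have "ord_below \<gamma> <o pred_order lt x"
        using ord_below_less[OF that(2)] ht[OF that(1)] ordIso_symmetric ordLess_ordIso_trans by blast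
      from ex[OF this \<open>x \<in> T\<close>] obtain y where y: "(y, x) \<in> lt" "ord_below \<gamma> =o pred_order lt y"
        by blast
      then have "ord_below \<gamma> =o ord_below (ht y)"
        using ht[of y] sub ordIso_transitive[of "ord_below \<gamma>" "pred_order lt y"] by blast
      with y show ?thesis
        by (metis ord_below_iso_iff)
    qed
    show "y = z" if "(y, x) \<in> lt" "(z, x) \<in> lt" "ht y = ht z" for x y z
    proof -
      have "total_on (Field (pred_order lt x)) (pred_order lt x)"
        using wo[of x] that(1) sub by (auto simp: well_order_on_def linear_order_on_def)
      then have "y = z \<or> (y, z) \<in> pred_order lt x \<or> (z, y) \<in> pred_order lt x"
        using that(1,2) unfolding fld total_on_def by blast
      then show ?thesis
        using that(3) mono unfolding pred_order_def by force
    qed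
  qed (use sub tr mono in auto)
  then show thesis by (rule that)
qed

lemma kappa_tree_levels:
  assumes "kappa_tree \<kappa> T lt" "height_tree T lt (ht :: 'b \<Rightarrow> 'k)"
  shows "{x \<in> T. ht x = \<alpha>} \<noteq> {}" "small {x \<in> T. ht x = \<alpha>}"
  using assms(1) level_height_tree[OF assms(2)] unfolding kappa_tree_def small_def by auto

text \<open>A colour f x < \<open>ht x\<close> designates the predecessor of x at height f x, and
  this is the value of \<rho> at levels in D. For a fixed value y such x form one antichain by
  injectivity. At other levels \<rho> drops to a height bounding the part of D below the level, so
  that the fibre of y meets only boundedly many of these levels, each of them an antichain. A
  \<kappa>-branch would turn f into a regressive injection on D.\<close>

lemma special_aronszajnI:
  fixes ht :: "'b \<Rightarrow> 'k" and f :: "'b \<Rightarrow> 'k"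
  assumes tree: "height_tree T lt ht"
    and lev: "\<And>\<alpha>. {x \<in> T. ht x = \<alpha>} \<noteq> {}" "\<And>\<alpha>. small {x \<in> T. ht x = \<alpha>}"
    and D: "club D"
    and reg: "\<And>x. x \<in> T \<Longrightarrow> ht x \<in> D \<Longrightarrow> f x < ht x"
    and inj: "\<And>x y. (x, y) \<in> lt \<Longrightarrow> ht x \<in> D \<Longrightarrow> ht y \<in> D \<Longrightarrow> f x \<noteq> f y"
  shows "special_aronszajn \<kappa> T lt"
proof -
  interpret height_tree T lt ht by fact
  note level = level_height_tree[OF tree]
  have "aronszajn \<kappa> T lt"
    unfolding aronszajn_def
  proof (intro conjI notI)
    show "kappa_tree \<kappa> T lt"
      by (rule kappa_treeI[OF tree lev])
    assume "\<exists>B. branch T lt (UNIV :: 'k set) B"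
    then obtain B where "branch T lt (UNIV :: 'k set) B" ..
    then have B: "\<And>x y. x \<in> B \<Longrightarrow> y \<in> B \<Longrightarrow> x = y \<or> (x, y) \<in> lt \<or> (y, x) \<in> lt"
      and "{\<alpha>. B \<inter> level T lt \<alpha> \<noteq> {}} = (UNIV :: 'k set)"
      by (simp_all add: branch_def)
    then have "B \<inter> level T lt \<alpha> \<noteq> {}" for \<alpha> :: 'k
      by (metis (mono_tags) UNIV_I mem_Collect_eq)
    then have "\<forall>\<alpha>. \<exists>x. x \<in> B \<inter> level T lt (\<alpha>::'k)"
      by blast
    then obtain b where b: "\<And>\<alpha>. b \<alpha> \<in> B \<and> b \<alpha> \<in> T \<and> ht (b \<alpha>) = \<alpha>"
      unfolding level by (metis (mono_tags, lifting) IntE mem_Collect_eq)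
    have "f (b \<alpha>) \<noteq> f (b \<beta>)" if "\<alpha> \<in> D" "\<beta> \<in> D" "\<alpha> \<noteq> \<beta>" for \<alpha> \<beta>
      using B[of "b \<alpha>" "b \<beta>"] b inj that by metis
    then show False
      using no_regressive_injection[OF D, of "\<lambda>\<alpha>. f (b \<alpha>)"] reg b unfolding inj_on_def by metis
  qed
  \<comment> \<open>The height to which \<rho> drops off D: 0 at 0, the predecessor at a successor,
    and at a limit outside D a bound of D below it, which exists because D is closed.\<close>
  moreover have "\<exists>\<zeta>\<le>\<alpha>. (\<forall>\<delta>\<in>D. \<delta> < \<alpha> \<longrightarrow> \<delta> \<le> \<zeta>) \<and> ((\<exists>\<beta>. \<beta> < \<alpha>) \<longrightarrow> \<zeta> < \<alpha>)" if "\<alpha> \<notin> D" for \<alpha>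
  proof -
    consider "\<forall>\<beta>. \<not> \<beta> < \<alpha>" | "\<alpha> \<in> acc_kappa" | \<beta> where "\<beta> < \<alpha>" "\<And>\<gamma>. \<gamma> < \<alpha> \<Longrightarrow> \<gamma> \<le> \<beta>"
      unfolding acc_kappa_def by (auto simp: not_less) (metis not_less)
    then show ?thesis
    proof cases
      case 2
      then have "\<not> (\<forall>\<beta><\<alpha>. \<exists>\<delta>\<in>D. \<beta> < \<delta> \<and> \<delta> < \<alpha>)"
        using D that by (auto simp: club_def)
      then obtain \<beta> where "\<beta> < \<alpha>" "\<forall>\<delta>\<in>D. \<not> (\<beta> < \<delta> \<and> \<delta> < \<alpha>)"
        by blast
      then show ?thesis
        by (intro exI[of _ \<beta>]) (auto simp: not_less)
    qed (auto intro: less_imp_le)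
  qed
  then obtain \<zeta> where \<zeta>: "\<And>\<alpha>. \<alpha> \<notin> D \<Longrightarrow> \<zeta> \<alpha> \<le> \<alpha>" "\<And>\<alpha> \<delta>. \<alpha> \<notin> D \<Longrightarrow> \<delta> \<in> D \<Longrightarrow> \<delta> < \<alpha> \<Longrightarrow> \<delta> \<le> \<zeta> \<alpha>"
    "\<And>\<alpha> \<beta>. \<alpha> \<notin> D \<Longrightarrow> \<beta> < \<alpha> \<Longrightarrow> \<zeta> \<alpha> < \<alpha>"
    by metis
  define \<rho> where "\<rho> x = (if ht x \<in> D then proj x (f x) else proj x (\<zeta> (ht x)))" for x
  have \<rho>: "\<rho> x \<in> T" "ht (\<rho> x) = (if ht x \<in> D then f x else \<zeta> (ht x))" if "x \<in> T" for x
    using that reg \<zeta>(1) proj_in ht_proj by (auto simp: \<rho>_def less_imp_le)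
  have "(\<rho> x, x) \<in> lt" if "y \<in> T" "(y, x) \<in> lt" for x y
    using that reg \<zeta>(3)[OF _ ht_mono[OF that(2)]] proj_lt lt_subset by (auto simp: \<rho>_def)
  moreover have "\<exists>\<A>. |\<A>| <o kappa \<kappa> \<and> (\<forall>A\<in>\<A>. antichain T lt A) \<and> {x \<in> T. \<rho> x = y} \<subseteq> \<Union>\<A>"
    if "y \<in> T" for y
  proof -
    \<comment> \<open>A node at a level outside D above \<delta> is sent to a height of at least
      \<delta>, hence not to y.\<close>
    obtain \<delta> where \<delta>: "\<delta> \<in> D" "ht y < \<delta>"
      using D unfolding club_def by blast
    let ?A = "{x \<in> T. ht x \<in> D \<and> f x = ht y}" and ?L = "\<lambda>\<alpha>. {x \<in> T. ht x = \<alpha>}"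
    have "small ({?A} \<union> ?L ` {..\<delta>})"
      by (intro small_Un small_image small_atMost small_finite) auto
    moreover have "antichain T lt ?A" "antichain T lt (?L \<alpha>)" for \<alpha>
      using inj ht_mono unfolding antichain_def by fastforce+
    moreover have "{x \<in> T. \<rho> x = y} \<subseteq> \<Union>({?A} \<union> ?L ` {..\<delta>})"
      using \<rho>(2) \<zeta>(2)[OF _ \<delta>(1)] \<delta>(2) by (force simp: not_less)
    ultimately show ?thesis
      unfolding small_def by blast
  qed
  moreover have "\<rho> ` T \<subseteq> T"
    using \<rho>(1) by blast
  ultimately show ?thesis
    unfolding special_aronszajn_def by (intro conjI exI[of _ \<rho>]) auto
qed

text \<open>The colour of x codes the pair of \<rho> x and an antichain from the given cover that
  contains x; comparable nodes cannot share an antichain. At limit heights x is not minimal, so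
  \<rho> x is below x, and there are few such pairs with \<rho> x at a given height; hence the codes
  can be made regressive.\<close>

lemma special_aronszajn_colouring:
  fixes ht :: "'b \<Rightarrow> 'k"
  assumes special: "special_aronszajn \<kappa> T lt" and tree: "height_tree T lt ht"
  obtains D and f :: "'b \<Rightarrow> 'k" where "club D" "D \<subseteq> acc_kappa" "\<And>x. x \<in> T \<Longrightarrow> ht x \<in> D \<Longrightarrow> f x < ht x"
    "\<And>x y. (x, y) \<in> lt \<Longrightarrow> ht x \<in> D \<Longrightarrow> ht y \<in> D \<Longrightarrow> f x \<noteq> f y"
proof -
  interpret height_tree T lt ht by fact
  have "kappa_tree \<kappa> T lt"
    using special by (simp add: special_aronszajn_def aronszajn_def)
  note lev = kappa_tree_levels[OF this tree]
  obtain \<rho> where \<rho>T: "\<rho> ` T \<subseteq> T" and \<rho>lt: "\<And>x y. y \<in> T \<Longrightarrow> (y, x) \<in> lt \<Longrightarrow> (\<rho> x, x) \<in> lt"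
    and "\<forall>y\<in>T. \<exists>\<A>. |\<A>| <o kappa \<kappa> \<and> (\<forall>A\<in>\<A>. antichain T lt A) \<and> {x \<in> T. \<rho> x = y} \<subseteq> \<Union>\<A>"
    using special lt_subset unfolding special_aronszajn_def by blast
  then obtain \<A> where \<A>: "\<And>y. y \<in> T \<Longrightarrow> small (\<A> y)" "\<And>y A. y \<in> T \<Longrightarrow> A \<in> \<A> y \<Longrightarrow> antichain T lt A"
    "\<And>y. y \<in> T \<Longrightarrow> {x \<in> T. \<rho> x = y} \<subseteq> \<Union>(\<A> y)"
    unfolding small_def[symmetric] bchoice_iff by blast
  have "\<exists>A\<in>\<A> (\<rho> x). x \<in> A" if "x \<in> T" for x
    using \<A>(3)[of "\<rho> x"] \<rho>T that by blast
  then obtain A where A: "\<And>x. x \<in> T \<Longrightarrow> A x \<in> \<A> (\<rho> x) \<and> x \<in> A x"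
    by metis
  define G where "G \<beta> = Sigma {y \<in> T. ht y = \<beta>} \<A>" for \<beta>
  have G: "small (G \<beta>)" for \<beta>
    unfolding G_def by (rule small_Sigma[OF lev(2)]) (use \<A>(1) in auto)
  obtain D q where D: "club D" "D \<subseteq> closed_under id" "D \<subseteq> acc_kappa" "inj_on q (\<Union>\<beta>. G \<beta>)"
    "\<forall>\<alpha>\<in>D. \<forall>\<beta><\<alpha>. \<forall>c\<in>G \<beta>. q c < \<alpha>"
    by (rule regressive_recoding[of "closed_under id" G, OF club_closed_under G])
  have c: "(\<rho> x, A x) \<in> G (ht (\<rho> x)) \<and> ht (\<rho> x) < ht x" if "x \<in> T" "ht x \<in> D" for x
  proof -
    obtain \<gamma> where "\<gamma> < ht x"
      using \<open>ht x \<in> D\<close> D(3) unfolding acc_kappa_def by blast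
    then obtain y where "(y, x) \<in> lt"
      using ex_below \<open>x \<in> T\<close> by blast
    then have "(\<rho> x, x) \<in> lt"
      using \<rho>lt lt_subset by blast
    then show ?thesis
      using A[OF that(1)] ht_mono \<rho>T that by (auto simp: G_def)
  qed
  show thesis
  proof (rule that[OF D(1,3)])
    show "q (\<rho> x, A x) < ht x" if "x \<in> T" "ht x \<in> D" for x
      using c[OF that] D(5) that by blast
    show "q (\<rho> x, A x) \<noteq> q (\<rho> y, A y)" if "(x, y) \<in> lt" "ht x \<in> D" "ht y \<in> D" for x y
    proof
      assume eq: "q (\<rho> x, A x) = q (\<rho> y, A y)"
      have T: "x \<in> T" "y \<in> T" using that lt_subset by auto
      have "(\<rho> x, A x) = (\<rho> y, A y)"
        using inj_onD[OF D(4) eq] c[OF T(1)] c[OF T(2)] that by blast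
      then have "x \<in> A x" "y \<in> A x" "antichain T lt (A x)"
        using A T \<A>(2) \<rho>T by auto
      with that(1) show False
        unfolding antichain_def by blast
    qed
  qed
qed

end

section \<open>Streamlined trees\<close>

declare restrict_restrict [simp del]

lemma dom_restrict_lessThan: "dom t = {..<\<alpha>} \<Longrightarrow> \<gamma> \<le> \<alpha> \<Longrightarrow> dom (t |` {..<\<gamma>::'k::wellorder}) = {..<\<gamma>}"
  by auto

lemma restrict_lessThan_id: "dom t = {..<\<alpha>} \<Longrightarrow> \<alpha> \<le> \<gamma> \<Longrightarrow> t |` {..<\<gamma>::'k::wellorder} = t"
  by (rule ext) (metis domIff lessThan_iff order.strict_trans2 restrict_in restrict_out)

lemma restrict_restrict_lessThan: "\<gamma> \<le> \<delta> \<Longrightarrow> t |` {..<\<delta>} |` {..<\<gamma>::'k::wellorder} = t |` {..<\<gamma>}"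
  by (auto simp: restrict_map_def fun_eq_iff)

lemma map_eq_of_restrictions:
  fixes t u :: "'k::wellorder \<rightharpoonup> 'v"
  assumes "\<alpha> \<in> acc_kappa" "dom t = {..<\<alpha>}" "dom u = {..<\<alpha>}"
    and "\<And>\<gamma>. \<beta> \<le> \<gamma> \<Longrightarrow> \<gamma> < \<alpha> \<Longrightarrow> t |` {..<\<gamma>} = u |` {..<\<gamma>}" "\<beta> < \<alpha>"
  shows "t = u"
proof
  fix \<epsilon>
  show "t \<epsilon> = u \<epsilon>"
  proof (cases "\<epsilon> < \<alpha>")
    case True
    then have "max \<beta> \<epsilon> < \<alpha>"
      using assms(5) by simp
    then obtain \<gamma> where "max \<beta> \<epsilon> < \<gamma>" "\<gamma> < \<alpha>"
      using assms(1) unfolding acc_kappa_def by blast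
    then have "(t |` {..<\<gamma>}) \<epsilon> = (u |` {..<\<gamma>}) \<epsilon>" "\<epsilon> < \<gamma>"
      using assms(4)[of \<gamma>] by (simp_all add: less_imp_le)
    then show ?thesis
      by (simp add: restrict_map_def)
  next
    case False
    then have "\<epsilon> \<notin> dom t" "\<epsilon> \<notin> dom u"
      using assms(2,3) by auto
    then show ?thesis
      by (auto simp: dom_def)
  qed
qed

definition hgt :: "('k::wellorder \<rightharpoonup> 'v) \<Rightarrow> 'k" where
  "hgt t = (THE \<alpha>. dom t = {..<\<alpha>})"

lemma hgt_eq: "dom t = {..<\<alpha>} \<Longrightarrow> hgt t = \<alpha>"
  unfolding hgt_def by (rule the_equality) auto

lemma streamlined_slevel: "streamlined T \<Longrightarrow> t \<in> T \<Longrightarrow> t \<in> slevel T (hgt t)"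
proof -
  assume "streamlined T" "t \<in> T"
  then obtain \<alpha> where "t \<in> slevel T \<alpha>"
    unfolding streamlined_def by blast
  moreover from this have "hgt t = \<alpha>"
    by (simp add: slevel_def hgt_eq)
  ultimately show ?thesis by simp
qed

lemma streamlined_dom: "streamlined T \<Longrightarrow> t \<in> T \<Longrightarrow> dom t = {..<hgt t}"
  using streamlined_slevel[of T t] by (simp add: slevel_def)

lemma slevel_eq: "streamlined T \<Longrightarrow> slevel T \<alpha> = {t \<in> T. hgt t = \<alpha>}"
  using streamlined_slevel[of T] hgt_eq unfolding slevel_def by (metis (mono_tags, lifting) mem_Collect_eq)

lemma streamlined_restrict: "streamlined T \<Longrightarrow> t \<in> T \<Longrightarrow> t |` {..<\<alpha>} \<in> T"
  by (simp add: streamlined_def)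

lemma streamlined_hgt_restrict: "streamlined T \<Longrightarrow> t \<in> T \<Longrightarrow> \<gamma> \<le> hgt t \<Longrightarrow> hgt (t |` {..<\<gamma>}) = \<gamma>"
  by (meson dom_restrict_lessThan hgt_eq streamlined_dom)

lemma sorder_iff:
  assumes "streamlined T" "s \<in> T" "t \<in> T"
  shows "(s, t) \<in> sorder T \<longleftrightarrow> hgt s < hgt t \<and> s = t |` {..<hgt s}"
proof
  note d = streamlined_dom[OF assms(1,2)] streamlined_dom[OF assms(1,3)]
  assume "(s, t) \<in> sorder T"
  then have sub: "s \<subseteq>\<^sub>m t" and ne: "s \<noteq> t"
    by (auto simp: sorder_def)
  have *: "s = t |` {..<hgt s}"
  proof
    fix \<epsilon> show "s \<epsilon> = (t |` {..<hgt s}) \<epsilon>"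
      using sub d(1) unfolding map_le_def restrict_map_def dom_def set_eq_iff
      by (cases "\<epsilon> < hgt s") auto
  qed
  have "dom s \<subseteq> dom t"
    using sub by (rule map_le_implies_dom_le)
  then have "hgt s \<le> hgt t"
    using d by (simp add: lessThan_subset_iff)
  moreover have "hgt s \<noteq> hgt t"
    using * ne restrict_lessThan_id[OF d(2)] by force
  ultimately show "hgt s < hgt t \<and> s = t |` {..<hgt s}"
    using * by simp
next
  assume "hgt s < hgt t \<and> s = t |` {..<hgt s}"
  then show "(s, t) \<in> sorder T"
    using assms unfolding sorder_def map_le_def
    by (auto simp: restrict_map_def split: if_splits) (metis domIff option.discI restrict_map_def)
qed

lemma height_tree_streamlined: "streamlined T \<Longrightarrow> height_tree T (sorder T) hgt"
proof
  assume T: "streamlined T"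
  show "sorder T \<subseteq> T \<times> T" by (auto simp: sorder_def)
  note iff = sorder_iff[OF T]
  have inT: "s \<in> T \<and> t \<in> T" if "(s, t) \<in> sorder T" for s t
    using that by (auto simp: sorder_def)
  show mono: "hgt x < hgt y" if "(x, y) \<in> sorder T" for x y
    using that inT iff by blast
  show "trans (sorder T)"
  proof (rule transI)
    fix x y z assume *: "(x, y) \<in> sorder T" "(y, z) \<in> sorder T"
    then have "x = z |` {..<hgt x}"
      using inT iff restrict_restrict_lessThan mono by (metis less_imp_le)
    with * show "(x, z) \<in> sorder T"
      using inT iff by (meson order.strict_trans)
  qed
  show "\<exists>y. (y, x) \<in> sorder T \<and> hgt y = \<gamma>" if "x \<in> T" "\<gamma> < hgt x" for x \<gamma>
    using iff[of "x |` {..<\<gamma>}" x] that streamlined_restrict[OF T] streamlined_hgt_restrict[OF T]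
    by (metis less_imp_le)
  show "y = z" if "(y, x) \<in> sorder T" "(z, x) \<in> sorder T" "hgt y = hgt z" for x y z
    using that inT iff by metis
qed

section \<open>Vanishing branches of streamlined trees as functions outside the tree\<close>

context regular_uncountable
begin

lemma kappa_TYPE: "kappa TYPE('k) = kappa \<kappa>"
  by (simp add: kappa_def)

lemma level_streamlined: "streamlined T \<Longrightarrow> level T (sorder T) (\<alpha>::'k) = slevel T \<alpha>"
  by (simp add: level_height_tree[OF height_tree_streamlined] slevel_eq)

lemma streamlined_levels:
  assumes "streamlined T"
  shows "{t \<in> T. hgt t = (\<alpha>::'k)} \<noteq> {}" "small {t \<in> T. hgt t = \<alpha>}"
  using assms unfolding slevel_eq[OF assms, symmetric] by (auto simp: streamlined_def small_def kappa_TYPE)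

text \<open>An upper bound in T of all proper restrictions of U would have height at least \<alpha>,
  because \<alpha> is a limit, and its restriction to \<alpha> would be U. Together with
  \<open>function_of_branch\<close> this replaces vanishing branches by functions outside T all of
  whose proper restrictions are in T.\<close>

lemma branch_of_function:
  fixes U :: "'k node"
  assumes T: "streamlined T" and \<alpha>: "\<alpha> \<in> acc_kappa" "dom U = {..<\<alpha>}"
    and U: "\<And>\<gamma>. \<gamma> < \<alpha> \<Longrightarrow> U |` {..<\<gamma>} \<in> T" "U \<notin> T"
  defines "B \<equiv> (\<lambda>\<gamma>. U |` {..<\<gamma>}) ` {..<\<alpha>}"
  shows "branch T (sorder T) {..<\<alpha>} B" "vanishing T (sorder T) B"
proof -
  have h: "hgt (U |` {..<\<gamma>}) = \<gamma>" if "\<gamma> < \<alpha>" for \<gamma>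
    using dom_restrict_lessThan[OF \<alpha>(2)] that by (simp add: hgt_eq)
  show "branch T (sorder T) {..<\<alpha>} B"
    unfolding branch_def level_streamlined[OF T] slevel_eq[OF T]
  proof (intro conjI ballI)
    show "B \<subseteq> T" using U by (auto simp: B_def)
    show "x = y \<or> (x, y) \<in> sorder T \<or> (y, x) \<in> sorder T" if "x \<in> B" "y \<in> B" for x y
    proof -
      obtain \<gamma> \<delta> where *: "x = U |` {..<\<gamma>}" "y = U |` {..<\<delta>}" "\<gamma> < \<alpha>" "\<delta> < \<alpha>"
        using \<open>x \<in> B\<close> \<open>y \<in> B\<close> by (auto simp: B_def)
      have "x \<in> T" "y \<in> T" using * U by auto
      then show ?thesis
        using * h sorder_iff[OF T] restrict_restrict_lessThan
        by (metis less_imp_le linorder_neqE)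
    qed
    show "{\<gamma>. B \<inter> {t \<in> T. hgt t = \<gamma>} \<noteq> {}} = {..<\<alpha>}"
    proof (intro equalityI subsetI)
      fix \<gamma> assume "\<gamma> \<in> {..<\<alpha>}"
      then have "U |` {..<\<gamma>} \<in> B \<inter> {t \<in> T. hgt t = \<gamma>}"
        using h U by (auto simp: B_def)
      then show "\<gamma> \<in> {\<gamma>. B \<inter> {t \<in> T. hgt t = \<gamma>} \<noteq> {}}" by blast
    qed (auto simp: B_def h)
  qed
  show "vanishing T (sorder T) B"
    unfolding vanishing_def
  proof
    assume "\<exists>t\<in>T. \<forall>x\<in>B. x = t \<or> (x, t) \<in> sorder T"
    then obtain t where t: "t \<in> T" "\<And>\<gamma>. \<gamma> < \<alpha> \<Longrightarrow> U |` {..<\<gamma>} = t \<or> (U |` {..<\<gamma>}, t) \<in> sorder T"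
      by (auto simp: B_def)
    have *: "\<gamma> \<le> hgt t \<and> U |` {..<\<gamma>} = t |` {..<\<gamma>}" if "\<gamma> < \<alpha>" for \<gamma>
      using t(2)[OF that] h[OF that] sorder_iff[OF T _ t(1)] U(1)[OF that]
        restrict_lessThan_id[OF streamlined_dom[OF T t(1)]] by (metis less_imp_le order_refl)
    have "\<alpha> \<le> hgt t"
      using * acc_ex_between[OF \<alpha>(1)] by (meson leD leI)
    then have "U = t |` {..<\<alpha>}"
      using map_eq_of_restrictions[OF \<alpha>] dom_restrict_lessThan[OF streamlined_dom[OF T t(1)]]
        restrict_restrict_lessThan * \<alpha>(1) unfolding acc_kappa_def by (smt (verit) less_imp_le mem_Collect_eq)
    then show False
      using U(2) streamlined_restrict[OF T t(1)] by simp
  qed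
qed

lemma function_of_branch:
  fixes T :: "'k node set"
  assumes T: "streamlined T" and \<alpha>: "\<alpha> \<in> acc_kappa"
    and B: "branch T (sorder T) {..<\<alpha>} B" "vanishing T (sorder T) B"
  obtains U where "dom U = {..<\<alpha>}" "\<And>\<gamma>. \<gamma> < \<alpha> \<Longrightarrow> U |` {..<\<gamma>} \<in> T" "U \<notin> T"
proof -
  have BT: "B \<subseteq> T" and cmp: "\<And>x y. x \<in> B \<Longrightarrow> y \<in> B \<Longrightarrow> x = y \<or> (x, y) \<in> sorder T \<or> (y, x) \<in> sorder T"
    and lev: "{\<gamma>. B \<inter> {t \<in> T. hgt t = \<gamma>} \<noteq> {}} = {..<\<alpha>}"
    using B(1) by (simp_all only: branch_def level_streamlined[OF T] slevel_eq[OF T])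
  have "\<exists>t\<in>B. hgt t = \<gamma>" if "\<gamma> < \<alpha>" for \<gamma>
    using lev that by blast
  then obtain b where b: "\<And>\<gamma>. \<gamma> < \<alpha> \<Longrightarrow> b \<gamma> \<in> B \<and> hgt (b \<gamma>) = \<gamma>"
    by metis
  have res: "b \<gamma> = b \<delta> |` {..<\<gamma>}" if "\<gamma> \<le> \<delta>" "\<delta> < \<alpha>" for \<gamma> \<delta>
  proof (cases "\<gamma> = \<delta>")
    case True
    then show ?thesis
      using restrict_lessThan_id[OF streamlined_dom[OF T]] b[OF that(2)] BT by (metis order_refl subsetD)
  next
    case False
    then have "\<gamma> < \<delta>" "\<gamma> < \<alpha>" using that by auto
    then show ?thesis
      using cmp[of "b \<gamma>" "b \<delta>"] b[of \<gamma>] b[of \<delta>] that(2) sorder_iff[OF T] BT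
      by (metis less_asym' less_irrefl subsetD)
  qed
  \<comment> \<open>Any \<gamma> strictly between \<epsilon> and \<alpha> gives the same value,
    since the nodes of the branch cohere; one exists because \<alpha> is a limit.\<close>
  define U where "U \<epsilon> = (if \<epsilon> < \<alpha> then b (SOME \<gamma>. \<epsilon> < \<gamma> \<and> \<gamma> < \<alpha>) \<epsilon> else None)" for \<epsilon>
  have U: "U \<epsilon> = b \<gamma> \<epsilon>" if "\<epsilon> < \<gamma>" "\<gamma> < \<alpha>" for \<epsilon> \<gamma>
  proof -
    define \<delta> where "\<delta> = (SOME \<delta>. \<epsilon> < \<delta> \<and> \<delta> < \<alpha>)"
    have \<delta>: "\<epsilon> < \<delta> \<and> \<delta> < \<alpha>"
      unfolding \<delta>_def by (rule someI[of _ \<gamma>]) (use that in auto)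
    have "U \<epsilon> = b \<delta> \<epsilon>"
      using that unfolding U_def \<delta>_def[symmetric] by (simp add: order.strict_trans)
    also have "\<dots> = b \<gamma> \<epsilon>"
      using res[of \<gamma> \<delta>] res[of \<delta> \<gamma>] \<delta> that by (cases "\<gamma> \<le> \<delta>") (auto simp: restrict_map_def dest: fun_cong)
    finally show ?thesis .
  qed
  have Ur: "U |` {..<\<gamma>} = b \<gamma>" if "\<gamma> < \<alpha>" for \<gamma>
  proof
    fix \<epsilon>
    have "dom (b \<gamma>) = {..<\<gamma>}"
      using streamlined_dom[OF T, of "b \<gamma>"] b[OF that] BT by auto
    then show "(U |` {..<\<gamma>}) \<epsilon> = b \<gamma> \<epsilon>"
      using U[OF _ that, of \<epsilon>] by (auto simp: restrict_map_def dom_def set_eq_iff)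
  qed
  have "dom U = {..<\<alpha>}"
  proof (intro equalityI subsetI)
    fix \<epsilon> assume "\<epsilon> \<in> {..<\<alpha>}"
    then obtain \<gamma> where \<gamma>: "\<epsilon> < \<gamma>" "\<gamma> < \<alpha>"
      using acc_ex_between[OF \<alpha>] by auto
    then have "\<epsilon> \<in> dom (b \<gamma>)"
      using streamlined_dom[OF T, of "b \<gamma>"] b[OF \<gamma>(2)] BT \<gamma>(1) by auto
    then show "\<epsilon> \<in> dom U"
      using U[OF \<gamma>] by (simp add: dom_def)
  qed (auto simp: U_def split: if_splits)
  moreover have "U |` {..<\<gamma>} \<in> T" if "\<gamma> < \<alpha>" for \<gamma>
    using Ur b BT that by auto
  moreover have "U \<notin> T"
  proof
    assume UT: "U \<in> T"
    have "x = U \<or> (x, U) \<in> sorder T" if "x \<in> B" for x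
    proof -
      have xa: "hgt x < \<alpha>" using lev that BT by blast
      then have "x = b (hgt x)"
        using cmp[of x "b (hgt x)"] b[OF xa] that sorder_iff[OF T] BT by (metis less_irrefl subsetD)
      then have "x = U |` {..<hgt x}" using Ur[OF xa] by simp
      then show ?thesis
        using xa sorder_iff[OF T, of x U] that BT UT hgt_eq[OF \<open>dom U = {..<\<alpha>}\<close>] by auto
    qed
    then show False
      using B(2) UT unfolding vanishing_def by blast
  qed
  ultimately show thesis by (rule that)
qed

end

section \<open>Ordinals as hereditarily small sets\<close>

text \<open>Von Neumann ordinals inside \<open>'k vset\<close>. The choice is justified by
  \<open>vset_exists_iff\<close>, as an ordinal below \<kappa> has no more elements than
  \<open>'k\<close>. They supply values for nodes, which must lie in \<open>H_kappa\<close>.\<close>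

definition vordinal :: "'k::wellorder \<Rightarrow> 'k vset" where
  "vordinal = wfrec {(\<beta>, \<alpha>). \<beta> < \<alpha>} (\<lambda>v \<alpha>. SOME x. {y. (y, x) \<in> vmem} = v ` {..<\<alpha>})"

lemma vordinal_mem: "(y, vordinal \<alpha>) \<in> vmem \<longleftrightarrow> y \<in> vordinal ` {..<\<alpha>::'k::wellorder}"
proof -
  have "vordinal \<alpha> = (SOME x. {y. (y, x) \<in> vmem} = cut vordinal {(\<beta>, \<alpha>). \<beta> < \<alpha>} \<alpha> ` {..<\<alpha>})"
    using def_wfrec[OF eq_reflection[OF vordinal_def] wf, of \<alpha>] .
  also have "cut vordinal {(\<beta>, \<alpha>). \<beta> < \<alpha>} \<alpha> ` {..<\<alpha>} = vordinal ` {..<\<alpha>}"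
    by (auto simp: cut_def image_def)
  finally have *: "vordinal \<alpha> = (SOME x. {y. (y, x) \<in> vmem} = vordinal ` {..<\<alpha>})" .
  have "|vordinal ` {..<\<alpha>}| \<le>o |UNIV :: 'k set|"
    using card_of_image card_of_mono1[of "{..<\<alpha>}" UNIV] ordLeq_transitive by blast
  then have "\<exists>x. {y. (y, x) \<in> vmem} = vordinal ` {..<\<alpha>}"
    by (simp add: vset_exists_iff)
  then have "{y. (y, vordinal \<alpha>) \<in> vmem} = vordinal ` {..<\<alpha>}"
    by (subst *) (rule someI_ex)
  then show ?thesis by blast
qed

lemma inj_vordinal: "inj (vordinal :: 'k::wellorder \<Rightarrow> 'k vset)"
proof -
  have "vordinal \<beta> \<noteq> vordinal \<alpha>" if "\<beta> < \<alpha>" for \<alpha> \<beta> :: 'k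
    using vordinal_mem[of "vordinal \<beta>" \<alpha>] that wf_not_refl[OF wf_vmem] by (metis image_eqI lessThan_iff)
  then show ?thesis
    by (metis injI linorder_neqE)
qed

context regular_uncountable
begin

lemma vordinal_H_kappa: "vordinal (\<alpha>::'k) \<in> H_kappa"
proof -
  have "y \<in> vordinal ` {..<\<alpha>}" if "(y, vordinal \<alpha>) \<in> vmem\<^sup>+" for y
    using that by (induction rule: converse_trancl_induct) (auto simp: vordinal_mem dest: order.strict_trans)
  then have "{y. (y, vordinal \<alpha>) \<in> vmem\<^sup>+} \<subseteq> vordinal ` {..<\<alpha>}"
    by blast
  then have "small {y. (y, vordinal \<alpha>) \<in> vmem\<^sup>+}"
    by (rule small_subset[OF small_image[OF small_lessThan]])
  then show ?thesis
    by (simp add: H_kappa_def small_def kappa_TYPE)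
qed

end

section \<open>Making branches vanish\<close>

text \<open>Condition (ii) of the theorem, named because the construction from (i) reaches it
  through several lemmas.\<close>

definition injective_tree_with_colouring :: "'k::wellorder itself \<Rightarrow> bool" where
  "injective_tree_with_colouring \<kappa> \<longleftrightarrow> (\<exists>(K :: 'k node set) (D :: 'k set) (f :: 'k node \<Rightarrow> 'k).
           streamlined K \<and> aronszajn \<kappa> K (sorder K) \<and>
           club D \<and> D \<subseteq> acc_kappa \<and>
           D \<subseteq> V_minus K (sorder K) \<and>
           (\<forall>\<alpha>\<in>D. \<forall>x \<in> slevel K \<alpha>. f x < \<alpha>) \<and>
           (\<forall>x \<in> srestrict K D. \<forall>y \<in> srestrict K D. (x, y) \<in> sorder K \<longrightarrow> f x \<noteq> f y) \<and>
           (\<forall>x\<in>K. \<forall>y\<in>K. \<forall>\<epsilon> \<in> dom x \<inter> dom y.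
              x \<epsilon> = y \<epsilon> \<longrightarrow> x |` {..<\<epsilon>} = y |` {..<\<epsilon>}))"

context regular_uncountable
begin

text \<open>The node \<open>s t \<beta> \<gamma>\<close> is a copy of \<open>t\<close> that has left the main copy of the tree at height \<open>\<beta>\<close>;
  this side copy is cut off at the nodes of colour \<open>\<beta>\<close>, which makes the branches below them vanish.
  Recording initial segments as values gives the injectivity condition.\<close>

lemma vanishing_branches_tree:
  fixes Y :: "'k \<Rightarrow> ('k \<rightharpoonup> 'v) set" and f :: "('k \<rightharpoonup> 'v) \<Rightarrow> 'k"
  assumes Ydom: "\<And>\<gamma> t. t \<in> Y \<gamma> \<Longrightarrow> dom t = {..<\<gamma>}"
    and Yres: "\<And>\<gamma> \<delta> t. t \<in> Y \<gamma> \<Longrightarrow> \<delta> \<le> \<gamma> \<Longrightarrow> t |` {..<\<delta>} \<in> Y \<delta>"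
    and Yne: "\<And>\<gamma>. Y \<gamma> \<noteq> {}" and Ysm: "\<And>\<gamma>. small (Y \<gamma>)"
    and D: "club D" "D \<subseteq> acc_kappa"
    and reg: "\<And>\<gamma> t. \<gamma> \<in> D \<Longrightarrow> t \<in> Y \<gamma> \<Longrightarrow> f t < \<gamma>"
    and inj: "\<And>\<gamma> \<delta> t. \<gamma> \<in> D \<Longrightarrow> \<delta> \<in> D \<Longrightarrow> \<gamma> < \<delta> \<Longrightarrow> t \<in> Y \<delta> \<Longrightarrow> f (t |` {..<\<gamma>}) \<noteq> f t"
  shows "injective_tree_with_colouring \<kappa>"
proof -
  define Z where "Z = (\<Union>\<gamma>. Y \<gamma> \<times> {..\<gamma>})"
  have "small (Y \<gamma> \<times> {..\<gamma>})" for \<gamma>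
    by (intro small_Sigma Ysm small_atMost)
  then have "atmost_kappa Z"
    unfolding Z_def by (rule atmost_kappa_UN)
  then obtain q :: "('k \<rightharpoonup> 'v) \<times> 'k \<Rightarrow> 'k" where q: "inj_on q Z"
    by (rule atmost_kappa_inj)
  \<comment> \<open>The entry \<open>min \<beta> \<epsilon>\<close> reveals \<beta> only at
    positions \<epsilon> beyond \<beta>; up to there a side copy agrees with the main copy, which at
    height \<gamma> is the case \<beta> = \<gamma>.\<close>
  define s where "s t \<beta> \<gamma> = (\<lambda>\<epsilon>. if \<epsilon> < \<gamma> then Some (vordinal (q (t |` {..<\<epsilon>}, min \<beta> \<epsilon>))) else None)"
    for t :: "'k \<rightharpoonup> 'v" and \<beta> \<gamma> :: 'k
  have sdom: "dom (s t \<beta> \<gamma>) = {..<\<gamma>}" for t \<beta> \<gamma>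
    by (auto simp: s_def dom_def)
  have sran: "ran (s t \<beta> \<gamma>) \<subseteq> H_kappa" for t \<beta> \<gamma>
    using vordinal_H_kappa by (auto simp: s_def ran_def)
  have sres: "s t \<beta> \<gamma> |` {..<\<delta>} = s (t |` {..<\<delta>}) (min \<beta> \<delta>) \<delta>" if "\<delta> \<le> \<gamma>" for t \<beta> \<gamma> \<delta>
  proof
    fix \<epsilon>
    show "(s t \<beta> \<gamma> |` {..<\<delta>}) \<epsilon> = s (t |` {..<\<delta>}) (min \<beta> \<delta>) \<delta> \<epsilon>"
    proof (cases "\<epsilon> < \<delta>")
      case True
      then have "t |` {..<\<delta>} |` {..<\<epsilon>} = t |` {..<\<epsilon>}" "min (min \<beta> \<delta>) \<epsilon> = min \<beta> \<epsilon>" "\<epsilon> < \<gamma>"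
        using that restrict_restrict_lessThan[of \<epsilon> \<delta> t] by (auto simp: min_def)
      with True show ?thesis
        by (simp add: s_def)
    qed (simp add: s_def)
  qed
  have key: "t |` {..<\<epsilon>} = t' |` {..<\<epsilon>} \<and> min \<beta> \<epsilon> = min \<beta>' \<epsilon>"
    if "t \<in> Y \<gamma>" "t' \<in> Y \<gamma>'" "\<epsilon> < \<gamma>" "\<epsilon> < \<gamma>'" "s t \<beta> \<gamma> \<epsilon> = s t' \<beta>' \<gamma>' \<epsilon>" for t t' \<beta> \<beta>' \<gamma> \<gamma>' \<epsilon>
  proof -
    have "q (t |` {..<\<epsilon>}, min \<beta> \<epsilon>) = q (t' |` {..<\<epsilon>}, min \<beta>' \<epsilon>)"
      using that(3-5) injD[OF inj_vordinal] by (simp add: s_def)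
    moreover have "(t |` {..<\<epsilon>}, min \<beta> \<epsilon>) \<in> Z" "(t' |` {..<\<epsilon>}, min \<beta>' \<epsilon>) \<in> Z"
      unfolding Z_def using Yres[OF that(1), of \<epsilon>] Yres[OF that(2), of \<epsilon>] that(3,4)
      by (auto intro!: exI[of _ \<epsilon>] simp: less_imp_le)
    ultimately show ?thesis
      using inj_onD[OF q] by blast
  qed
  have seq: "t = t'" if "t \<in> Y \<alpha>" "t' \<in> Y \<alpha>" "\<alpha> \<in> acc_kappa" "s t \<beta> \<alpha> = s t' \<beta>' \<alpha>" for t t' \<beta> \<beta>' \<alpha>
  proof -
    obtain \<beta>0 where "\<beta>0 < \<alpha>"
      using \<open>\<alpha> \<in> acc_kappa\<close> unfolding acc_kappa_def by blast
    then show ?thesis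
      using map_eq_of_restrictions[OF that(3) Ydom[OF that(1)] Ydom[OF that(2)], of \<beta>0] key[OF that(1,2)] that(4)
      by metis
  qed
  \<comment> \<open>Vacuous for \<beta> = \<gamma>: the main copy is kept whole, so no level becomes
    empty.\<close>
  define ok where "ok t \<beta> \<gamma> \<longleftrightarrow> (\<forall>\<delta>\<in>D. \<beta> < \<delta> \<and> \<delta> \<le> \<gamma> \<longrightarrow> f (t |` {..<\<delta>}) \<noteq> \<beta>)" for t \<beta> \<gamma>
  define L where "L \<gamma> = {s t \<beta> \<gamma> | t \<beta>. t \<in> Y \<gamma> \<and> \<beta> \<le> \<gamma> \<and> ok t \<beta> \<gamma>}" for \<gamma>
  have LI: "s t \<beta> \<gamma> \<in> L \<gamma>" if "t \<in> Y \<gamma>" "\<beta> \<le> \<gamma>" "ok t \<beta> \<gamma>" for t \<beta> \<gamma>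
    using that unfolding L_def by blast
  define K where "K = (\<Union>\<gamma>. L \<gamma>)"
  have Ldom: "dom u = {..<\<gamma>}" if "u \<in> L \<gamma>" for u \<gamma>
    using that sdom unfolding L_def by blast
  have Lres: "u |` {..<\<delta>} \<in> L \<delta>" if "u \<in> L \<gamma>" "\<delta> \<le> \<gamma>" for u \<gamma> \<delta>
  proof -
    obtain t \<beta> where t: "u = s t \<beta> \<gamma>" "t \<in> Y \<gamma>" "\<beta> \<le> \<gamma>" "ok t \<beta> \<gamma>"
      using \<open>u \<in> L \<gamma>\<close> by (auto simp: L_def)
    have "ok (t |` {..<\<delta>}) (min \<beta> \<delta>) \<delta>"
      using t(4) that(2) unfolding ok_def
      by (auto simp: min_def restrict_restrict_lessThan)
    then show ?thesis
      using t(1) LI[OF Yres[OF t(2) that(2)]] sres[OF that(2)] by simp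
  qed
  have Lsl: "slevel K \<gamma> = L \<gamma>" for \<gamma>
  proof (intro equalityI subsetI)
    fix u assume "u \<in> slevel K \<gamma>"
    then obtain \<delta> where "u \<in> L \<delta>" "dom u = {..<\<gamma>}"
      by (auto simp: slevel_def K_def)
    then show "u \<in> L \<gamma>"
      using Ldom[of u \<delta>] by simp
  next
    fix u assume "u \<in> L \<gamma>"
    then show "u \<in> slevel K \<gamma>"
      using Ldom[of u \<gamma>] sran unfolding slevel_def K_def L_def by blast
  qed
  have Kst: "streamlined K"
    unfolding streamlined_def Lsl kappa_TYPE small_def[symmetric]
  proof (intro conjI allI ballI)
    show "K \<subseteq> (\<Union>\<gamma>. L \<gamma>)" by (simp add: K_def)
    show "u |` {..<\<alpha>} \<in> K" if "u \<in> K" for u \<alpha>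
    proof -
      obtain \<gamma> where \<gamma>: "u \<in> L \<gamma>" using \<open>u \<in> K\<close> by (auto simp: K_def)
      show ?thesis
      proof (cases "\<alpha> \<le> \<gamma>")
        case True
        then show ?thesis using Lres[OF \<gamma>] by (auto simp: K_def)
      next
        case False
        then show ?thesis using restrict_lessThan_id[OF Ldom[OF \<gamma>], of \<alpha>] that by simp
      qed
    qed
    show "L \<gamma> \<noteq> {}" for \<gamma>
    proof -
      obtain t where "t \<in> Y \<gamma>" using Yne by blast
      then have "s t \<gamma> \<gamma> \<in> L \<gamma>" by (intro LI) (auto simp: ok_def)
      then show ?thesis by blast
    qed
    have "L \<gamma> \<subseteq> (\<lambda>(t, \<beta>). s t \<beta> \<gamma>) ` (Y \<gamma> \<times> {..\<gamma>})" for \<gamma>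
      by (auto simp: L_def)
    moreover have "small ((\<lambda>(t, \<beta>). s t \<beta> \<gamma>) ` (Y \<gamma> \<times> {..\<gamma>}))" for \<gamma>
      by (intro small_image small_Sigma Ysm small_atMost)
    ultimately show "small (L \<gamma>)" for \<gamma>
      using small_subset by blast
  qed
  have LK: "u \<in> L (hgt u)" if "u \<in> K" for u
    using streamlined_slevel[OF Kst that] Lsl by simp
  \<comment> \<open>Recovers t from its copies at limit heights, where \<open>seq\<close> makes it
    unique; a copy inherits the colour of t.\<close>
  define dec where "dec u = (SOME t. t \<in> Y (hgt u) \<and> (\<exists>\<beta>. u = s t \<beta> (hgt u)))" for u
  have dec: "dec (s t \<beta> \<alpha>) = t" if "t \<in> Y \<alpha>" "\<alpha> \<in> acc_kappa" for t \<beta> \<alpha>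
  proof -
    have h: "hgt (s t \<beta> \<alpha>) = \<alpha>" by (rule hgt_eq[OF sdom])
    have "dec (s t \<beta> \<alpha>) \<in> Y \<alpha> \<and> (\<exists>\<beta>'. s t \<beta> \<alpha> = s (dec (s t \<beta> \<alpha>)) \<beta>' \<alpha>)"
      unfolding dec_def h by (rule someI[of _ t]) (use that in auto)
    then show ?thesis
      using seq[OF that(1) _ that(2)] by metis
  qed
  have Freg: "f (dec u) < \<alpha>" if "u \<in> L \<alpha>" "\<alpha> \<in> D" for u \<alpha>
    using that D(2) reg dec unfolding L_def by force
  have Finj: "f (dec u) \<noteq> f (dec v)" if "(u, v) \<in> sorder K" "hgt u \<in> D" "hgt v \<in> D" for u v
  proof -
    have uv: "u \<in> K" "v \<in> K" using that(1) by (auto simp: sorder_def)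
    then have "hgt u < hgt v" "u = v |` {..<hgt u}"
      using that(1) sorder_iff[OF Kst] by blast+
    obtain t \<beta> where t: "v = s t \<beta> (hgt v)" "t \<in> Y (hgt v)"
      using LK[OF uv(2)] unfolding L_def by blast
    have tu: "t |` {..<hgt u} \<in> Y (hgt u)"
      using Yres[OF t(2)] \<open>hgt u < hgt v\<close> by simp
    have "u = s (t |` {..<hgt u}) (min \<beta> (hgt u)) (hgt u)"
      using sres[of "hgt u" "hgt v" t \<beta>] t(1) \<open>hgt u < hgt v\<close> \<open>u = v |` {..<hgt u}\<close> by simp
    then have "dec u = t |` {..<hgt u}"
      using dec[OF tu] that(2) D(2) by (metis subsetD)
    moreover have "dec v = t"
      using dec[OF t(2)] that(3) D(2) t(1) by (metis subsetD)
    ultimately show ?thesis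
      using inj[OF that(2,3) \<open>hgt u < hgt v\<close> t(2)] by simp
  qed
  have ar: "aronszajn \<kappa> K (sorder K)"
  proof -
    have "special_aronszajn \<kappa> K (sorder K)"
    proof (rule special_aronszajnI[OF height_tree_streamlined[OF Kst] streamlined_levels[OF Kst] D(1)])
      show "f (dec x) < hgt x" if "x \<in> K" "hgt x \<in> D" for x
        using Freg LK that by blast
    qed (use Finj in blast)
    then show ?thesis
      by (simp add: special_aronszajn_def)
  qed
  have van: "D \<subseteq> V_minus K (sorder K)"
  proof
    fix \<alpha> assume \<alpha>: "\<alpha> \<in> D"
    then have acc: "\<alpha> \<in> acc_kappa" using D(2) by blast
    obtain t where t: "t \<in> Y \<alpha>" using Yne by blast
    \<comment> \<open>The copy that departs at its own colour. Its proper restrictions survive,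
      since by injectivity no earlier restriction of t has the colour f t, but it is itself cut off
      at \<alpha>. Another presentation of it as a copy is impossible, because t and, as f t <
      \<alpha>, also the place of departure can be read off from it.\<close>
    let ?U = "s t (f t) \<alpha>"
    have ft: "f t < \<alpha>" using reg[OF \<alpha> t] .
    have "?U |` {..<\<gamma>} \<in> K" if "\<gamma> < \<alpha>" for \<gamma>
    proof -
      have "ok (t |` {..<\<gamma>}) (min (f t) \<gamma>) \<gamma>"
        unfolding ok_def
      proof (intro ballI impI)
        fix \<delta> assume \<delta>: "\<delta> \<in> D" "min (f t) \<gamma> < \<delta> \<and> \<delta> \<le> \<gamma>"
        then have "min (f t) \<gamma> = f t" "t |` {..<\<gamma>} |` {..<\<delta>} = t |` {..<\<delta>}"
          by (auto simp: min_def restrict_restrict_lessThan split: if_splits)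
        then show "f (t |` {..<\<gamma>} |` {..<\<delta>}) \<noteq> min (f t) \<gamma>"
          using inj[OF \<delta>(1) \<alpha> order.strict_trans1[OF _ that] t] \<delta>(2) by auto
      qed
      then have "s (t |` {..<\<gamma>}) (min (f t) \<gamma>) \<gamma> \<in> L \<gamma>"
        using LI[OF Yres[OF t]] that by simp
      then show ?thesis
        using sres[of \<gamma> \<alpha>] that by (auto simp: K_def)
    qed
    moreover have "?U \<notin> K"
    proof
      assume "?U \<in> K"
      then have "?U \<in> L \<alpha>"
        using LK[of ?U] hgt_eq[OF sdom, of t "f t" \<alpha>] by simp
      then obtain t' \<beta>' where t': "?U = s t' \<beta>' \<alpha>" "t' \<in> Y \<alpha>" "\<beta>' \<le> \<alpha>" "ok t' \<beta>' \<alpha>"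
        by (auto simp: L_def)
      then have "t' = t"
        using seq[OF t _ acc] by metis
      obtain \<epsilon> where \<epsilon>: "f t < \<epsilon>" "\<epsilon> < \<alpha>"
        using acc_ex_between[OF acc ft] by blast
      have "min (f t) \<epsilon> = min \<beta>' \<epsilon>"
        using key[OF t t'(2) \<epsilon>(2) \<epsilon>(2)] t'(1) by simp
      then have "\<beta>' = f t"
        using \<epsilon>(1) by (auto simp: min_def split: if_splits)
      then have "f (t |` {..<\<alpha>}) \<noteq> f t"
        using t'(4) \<alpha> ft \<open>t' = t\<close> unfolding ok_def by blast
      then show False
        using restrict_lessThan_id[OF Ydom[OF t] order_refl] by simp
    qed
    ultimately have "branch K (sorder K) {..<\<alpha>} ((\<lambda>\<gamma>. ?U |` {..<\<gamma>}) ` {..<\<alpha>})"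
      "vanishing K (sorder K) ((\<lambda>\<gamma>. ?U |` {..<\<gamma>}) ` {..<\<alpha>})"
      using branch_of_function[OF Kst acc sdom[of t "f t" \<alpha>]] by blast+
    with acc show "\<alpha> \<in> V_minus K (sorder K)"
      unfolding V_minus_def by blast
  qed
  have "x |` {..<\<epsilon>} = y |` {..<\<epsilon>}"
    if xy: "x \<in> K" "y \<in> K" "\<epsilon> \<in> dom x \<inter> dom y" "x \<epsilon> = y \<epsilon>" for x y \<epsilon>
  proof -
    obtain t \<beta> t' \<beta>' where *: "x = s t \<beta> (hgt x)" "t \<in> Y (hgt x)" "y = s t' \<beta>' (hgt y)" "t' \<in> Y (hgt y)"
      using LK[OF xy(1)] LK[OF xy(2)] unfolding L_def by blast
    have \<epsilon>: "\<epsilon> < hgt x" "\<epsilon> < hgt y"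
      using xy(3) streamlined_dom[OF Kst xy(1)] streamlined_dom[OF Kst xy(2)] by auto
    then have "t |` {..<\<epsilon>} = t' |` {..<\<epsilon>} \<and> min \<beta> \<epsilon> = min \<beta>' \<epsilon>"
      using key[OF *(2,4)] *(1,3) xy(4) by metis
    then show ?thesis
      using sres[of \<epsilon> "hgt x" t \<beta>] sres[of \<epsilon> "hgt y" t' \<beta>'] *(1,3) \<epsilon> by (metis less_imp_le)
  qed
  moreover have "\<forall>x\<in>srestrict K D. \<forall>y\<in>srestrict K D. (x, y) \<in> sorder K \<longrightarrow> f (dec x) \<noteq> f (dec y)"
    using Finj by (auto simp: srestrict_def slevel_eq[OF Kst])
  moreover have "\<forall>\<alpha>\<in>D. \<forall>x\<in>slevel K \<alpha>. f (dec x) < \<alpha>"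
    using Freg by (simp add: Lsl)
  ultimately show ?thesis
    unfolding injective_tree_with_colouring_def
    using Kst ar D van by (intro exI[of _ K] exI[of _ D] exI[of _ "\<lambda>u. f (dec u)"]) blast
qed

end

section \<open>Walks along records\<close>

text \<open>The domain is the set C of the overview. The colours are stored along with the places
  because their supremum enters the colouring of the tree of walks.\<close>

definition records :: "('k::wellorder \<Rightarrow> 'k \<Rightarrow> 'k) \<Rightarrow> 'k \<Rightarrow> 'k \<rightharpoonup> 'k" where
  "records g \<alpha> \<xi> = (if \<xi> < \<alpha> \<and> (\<forall>\<eta>. \<xi> < \<eta> \<and> \<eta> < \<alpha> \<longrightarrow> g \<alpha> \<xi> < g \<alpha> \<eta>) then Some (g \<alpha> \<xi>) else None)"

definition next_record :: "('k::wellorder \<Rightarrow> 'k \<Rightarrow> 'k) \<Rightarrow> 'k \<Rightarrow> 'k \<Rightarrow> 'k" where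
  "next_record g \<alpha> \<zeta> = (LEAST \<xi>. \<zeta> \<le> \<xi> \<and> records g \<alpha> \<xi> \<noteq> None)"

text \<open>The walk from \<open>\<alpha>\<close> down to \<open>\<zeta>\<close> along the sets of records, as in Todorcevic's \<open>\<rho>\<^sub>0\<close> but
  remembering the initial segments of records themselves instead of their order types.\<close>

function walk :: "('k::wellorder \<Rightarrow> 'k \<Rightarrow> 'k) \<Rightarrow> 'k \<Rightarrow> 'k \<Rightarrow> ('k \<rightharpoonup> 'k) list" where
  "walk g \<alpha> \<zeta> = (if \<zeta> < \<alpha> \<and> next_record g \<alpha> \<zeta> < \<alpha>
     then (records g \<alpha> |` {..<\<zeta>}) # walk g (next_record g \<alpha> \<zeta>) \<zeta> else [])"
  by auto
termination
  by (relation "inv_image {(x, y). x < y} (\<lambda>(g, \<alpha>, \<zeta>). \<alpha>)") (auto intro: wf wf_inv_image)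

declare walk.simps [simp del]

text \<open>Recomputes the walk from \<alpha> to \<zeta> < \<gamma> out of the traces below \<gamma>
  met on the walk from \<alpha> to \<gamma>. While a trace has no record in the interval from
  \<zeta> to \<gamma>, both walks take the same step; the first trace that has one names the next
  ordinal, which is below \<gamma>, and from there on the ordinary walk is used. The empty list is
  never reached for the lists of \<open>walk_traces\<close>: their last trace is that of \<gamma>
  itself, whose records are cofinal in \<gamma>.\<close>

fun walk_of_traces :: "('k::wellorder \<Rightarrow> 'k \<Rightarrow> 'k) \<Rightarrow> ('k \<rightharpoonup> 'k) list \<Rightarrow> 'k \<Rightarrow> ('k \<rightharpoonup> 'k) list" where
  "walk_of_traces g [] \<zeta> = []"
| "walk_of_traces g (c # cs) \<zeta> = (c |` {..<\<zeta>}) #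
     (if \<exists>\<xi>\<ge>\<zeta>. c \<xi> \<noteq> None then walk g (LEAST \<xi>. \<zeta> \<le> \<xi> \<and> c \<xi> \<noteq> None) \<zeta> else walk_of_traces g cs \<zeta>)"

lemma records_increasing:
  "records g \<alpha> \<xi> = Some v \<Longrightarrow> \<xi> < \<eta> \<Longrightarrow> \<eta> < \<alpha> \<Longrightarrow> v < g \<alpha> \<eta>"
  by (auto simp: records_def split: if_splits)

lemma records_value: "records g \<alpha> \<xi> = Some v \<Longrightarrow> \<xi> < \<alpha> \<and> v = g \<alpha> \<xi>"
  by (auto simp: records_def split: if_splits)

context
  fixes g :: "'k::wellorder \<Rightarrow> 'k \<Rightarrow> 'k"
  assumes finite_fibres: "\<And>\<alpha> m. finite {\<delta>. \<delta> < \<alpha> \<and> g \<alpha> \<delta> = m}"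
begin

text \<open>The least value taken between \<zeta> and \<alpha> is taken only finitely often, and the
  last place where it is taken is a record.\<close>

lemma records_cofinal:
  assumes "\<zeta> < \<alpha>" shows "\<exists>\<xi>. \<zeta> \<le> \<xi> \<and> \<xi> < \<alpha> \<and> records g \<alpha> \<xi> \<noteq> None"
proof -
  define m where "m = (LEAST v. \<exists>\<eta>. \<zeta> \<le> \<eta> \<and> \<eta> < \<alpha> \<and> g \<alpha> \<eta> = v)"
  define S where "S = {\<eta>. \<zeta> \<le> \<eta> \<and> \<eta> < \<alpha> \<and> g \<alpha> \<eta> = m}"
  have "\<exists>\<eta>. \<zeta> \<le> \<eta> \<and> \<eta> < \<alpha> \<and> g \<alpha> \<eta> = m"
    unfolding m_def by (rule LeastI[of _ "g \<alpha> \<zeta>"]) (use assms in auto)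
  then have ne: "S \<noteq> {}"
    by (auto simp: S_def)
  have "finite S"
    using finite_fibres[of \<alpha> m] by (rule finite_subset[rotated]) (auto simp: S_def)
  then have mx: "Max S \<in> S" "\<And>\<eta>. \<eta> \<in> S \<Longrightarrow> \<eta> \<le> Max S"
    using ne by auto
  have "g \<alpha> (Max S) < g \<alpha> \<eta>" if "Max S < \<eta>" "\<eta> < \<alpha>" for \<eta>
  proof -
    have "\<zeta> \<le> \<eta>"
      using mx(1) that(1) by (auto simp: S_def)
    then have "m \<le> g \<alpha> \<eta>"
      unfolding m_def using that(2) by (intro Least_le) auto
    moreover have "m \<noteq> g \<alpha> \<eta>"
      using mx(2)[of \<eta>] that \<open>\<zeta> \<le> \<eta>\<close> by (auto simp: S_def)
    ultimately show ?thesis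
      using mx(1) by (auto simp: S_def)
  qed
  then show ?thesis
    using mx(1) by (intro exI[of _ "Max S"]) (auto simp: S_def records_def)
qed

lemma next_record:
  assumes "\<zeta> < \<alpha>"
  shows "\<zeta> \<le> next_record g \<alpha> \<zeta>" "next_record g \<alpha> \<zeta> < \<alpha>" "records g \<alpha> (next_record g \<alpha> \<zeta>) \<noteq> None"
proof -
  obtain \<xi> where "\<zeta> \<le> \<xi> \<and> records g \<alpha> \<xi> \<noteq> None"
    using records_cofinal[OF assms] by blast
  then have *: "\<zeta> \<le> next_record g \<alpha> \<zeta> \<and> records g \<alpha> (next_record g \<alpha> \<zeta>) \<noteq> None"
    unfolding next_record_def by (rule LeastI)
  then show "\<zeta> \<le> next_record g \<alpha> \<zeta>" "records g \<alpha> (next_record g \<alpha> \<zeta>) \<noteq> None"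
    by auto
  then show "next_record g \<alpha> \<zeta> < \<alpha>"
    using records_value by fastforce
qed

lemma next_record_le: "\<zeta> \<le> \<xi> \<Longrightarrow> records g \<alpha> \<xi> \<noteq> None \<Longrightarrow> next_record g \<alpha> \<zeta> \<le> \<xi>"
  unfolding next_record_def by (rule Least_le) simp

lemma next_record_eq:
  assumes "\<zeta> \<le> \<gamma>" "\<gamma> < \<alpha>" "\<And>\<xi>. \<zeta> \<le> \<xi> \<Longrightarrow> \<xi> < \<gamma> \<Longrightarrow> records g \<alpha> \<xi> = None"
  shows "next_record g \<alpha> \<zeta> = next_record g \<alpha> \<gamma>"
proof (rule antisym)
  note \<gamma> = next_record[OF assms(2)] and \<zeta> = next_record[OF order.strict_trans1[OF assms(1,2)]]
  show "next_record g \<alpha> \<zeta> \<le> next_record g \<alpha> \<gamma>"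
    using \<gamma> assms(1) by (intro next_record_le) auto
  have "\<gamma> \<le> next_record g \<alpha> \<zeta>"
    using \<zeta> assms(3) by (meson leI)
  then show "next_record g \<alpha> \<gamma> \<le> next_record g \<alpha> \<zeta>"
    using \<zeta> by (intro next_record_le) auto
qed

text \<open>The guard on the next record in \<open>walk\<close> makes the recursion terminate for
  arbitrary g. Under finite fibres records are cofinal, so it holds whenever \<zeta> <
  \<alpha>.\<close>

lemma walk_Cons: "\<zeta> < \<alpha> \<Longrightarrow> walk g \<alpha> \<zeta> = (records g \<alpha> |` {..<\<zeta>}) # walk g (next_record g \<alpha> \<zeta>) \<zeta>"
  by (subst walk.simps) (simp add: next_record)

text \<open>This bounds the levels of the tree of walks: whatever \<alpha> is, all walks from
  \<alpha> to points below \<gamma> are fixed by finitely many traces below \<gamma>.\<close>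

lemma walk_traces:
  "\<gamma> \<le> \<alpha> \<Longrightarrow> \<exists>cs\<in>lists ((\<lambda>\<alpha>. records g \<alpha> |` {..<\<gamma>}) ` {\<gamma>..}). \<forall>\<zeta><\<gamma>. walk g \<alpha> \<zeta> = walk_of_traces g cs \<zeta>"
proof (induction \<alpha> rule: less_induct)
  case (less \<alpha>)
  let ?c = "records g \<alpha> |` {..<\<gamma>}" and ?C = "(\<lambda>\<alpha>. records g \<alpha> |` {..<\<gamma>}) ` {\<gamma>..}"
  have c: "?c \<in> ?C" using less.prems by auto
  obtain cs where cs: "cs \<in> lists ?C"
    "\<gamma> < \<alpha> \<Longrightarrow> \<forall>\<zeta><\<gamma>. walk g (next_record g \<alpha> \<gamma>) \<zeta> = walk_of_traces g cs \<zeta>"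
  proof (cases "\<gamma> < \<alpha>")
    case True
    then show thesis
      using less.IH[OF next_record(2)[OF True] next_record(1)[OF True]] that by blast
  next
    case False
    then show thesis
      using that[of "[]"] by simp
  qed
  have "walk g \<alpha> \<zeta> = walk_of_traces g (?c # cs) \<zeta>" if "\<zeta> < \<gamma>" for \<zeta>
  proof -
    have \<zeta>: "\<zeta> < \<alpha>" using that less.prems by simp
    have r: "?c |` {..<\<zeta>} = records g \<alpha> |` {..<\<zeta>}"
      using that by (simp add: restrict_restrict_lessThan)
    show ?thesis
    proof (cases "\<exists>\<xi>\<ge>\<zeta>. ?c \<xi> \<noteq> None")
      case True
      then obtain \<xi> where \<xi>: "\<zeta> \<le> \<xi>" "\<xi> < \<gamma>" "records g \<alpha> \<xi> \<noteq> None"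
        by (auto simp: restrict_map_def split: if_splits)
      have "next_record g \<alpha> \<zeta> < \<gamma>"
        using next_record_le[OF \<xi>(1,3)] \<xi>(2) by simp
      then have "(LEAST \<xi>. \<zeta> \<le> \<xi> \<and> ?c \<xi> \<noteq> None) = next_record g \<alpha> \<zeta>"
        using next_record[OF \<zeta>] next_record_le
        by (intro Least_equality) (auto simp: restrict_map_def split: if_splits)
      with True r show ?thesis
        by (simp add: walk_Cons[OF \<zeta>])
    next
      case False
      then have none: "records g \<alpha> \<xi> = None" if "\<zeta> \<le> \<xi>" "\<xi> < \<gamma>" for \<xi>
        using that by (auto simp: restrict_map_def split: if_splits)
      then have "\<gamma> < \<alpha>"
        using next_record[OF \<zeta>] less.prems by (metis order.order_iff_strict)
      then have "next_record g \<alpha> \<zeta> = next_record g \<alpha> \<gamma>"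
        using that none by (intro next_record_eq) auto
      with False r show ?thesis
        using cs(2)[OF \<open>\<gamma> < \<alpha>\<close>] that by (auto simp add: walk_Cons[OF \<zeta>])
    qed
  qed
  then show ?case
    using c cs(1) by (intro bexI[of _ "?c # cs"]) auto
qed

text \<open>For \<open>\<zeta>\<close> close to \<open>\<gamma>\<close>, the walk to \<open>\<zeta>\<close> passes through the first ordinal on the walk to \<open>\<gamma>\<close>
  whose records are cofinal in \<open>\<gamma>\<close>.\<close>

lemma walk_stabilises:
  assumes "\<gamma> \<le> \<alpha>" "\<eta>0 < \<gamma>"
  shows "\<exists>n \<eta> \<alpha>'. \<eta> < \<gamma> \<and> \<gamma> \<le> \<alpha>' \<and> (\<forall>\<xi><\<gamma>. \<exists>\<xi>'\<ge>\<xi>. \<xi>' < \<gamma> \<and> records g \<alpha>' \<xi>' \<noteq> None) \<and>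
    (\<forall>\<zeta>. \<eta> \<le> \<zeta> \<and> \<zeta> < \<gamma> \<longrightarrow> n < length (walk g \<alpha> \<zeta>) \<and> walk g \<alpha> \<zeta> ! n = records g \<alpha>' |` {..<\<zeta>})"
  using assms(1)
proof (induction \<alpha> rule: less_induct)
  case (less \<alpha>)
  show ?case
  proof (cases "\<forall>\<xi><\<gamma>. \<exists>\<xi>'\<ge>\<xi>. \<xi>' < \<gamma> \<and> records g \<alpha> \<xi>' \<noteq> None")
    case True
    moreover have "0 < length (walk g \<alpha> \<zeta>) \<and> walk g \<alpha> \<zeta> ! 0 = records g \<alpha> |` {..<\<zeta>}" if "\<zeta> < \<gamma>" for \<zeta>
      using that less.prems by (simp add: walk_Cons)
    ultimately show ?thesis
      using less.prems assms(2) by blast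
  next
    case False
    \<comment> \<open>From \<eta>1 on \<alpha> has no records below \<gamma>, so walks to points in
      between take the same first step as the walk to \<gamma>. As the records of \<alpha> are
      cofinal in \<alpha>, this forces \<gamma> < \<alpha>.\<close>
    then obtain \<eta>1 where \<eta>1: "\<eta>1 < \<gamma>" "\<And>\<xi>. \<eta>1 \<le> \<xi> \<Longrightarrow> \<xi> < \<gamma> \<Longrightarrow> records g \<alpha> \<xi> = None"
      by blast
    then have lt: "\<gamma> < \<alpha>"
      using records_cofinal[of \<eta>1 \<gamma>] less.prems by (metis order.order_iff_strict)
    obtain n \<eta> \<alpha>' where IH: "\<eta> < \<gamma>" "\<gamma> \<le> \<alpha>'" "\<forall>\<xi><\<gamma>. \<exists>\<xi>'\<ge>\<xi>. \<xi>' < \<gamma> \<and> records g \<alpha>' \<xi>' \<noteq> None"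
      "\<And>\<zeta>. \<eta> \<le> \<zeta> \<and> \<zeta> < \<gamma> \<Longrightarrow> n < length (walk g (next_record g \<alpha> \<gamma>) \<zeta>) \<and>
         walk g (next_record g \<alpha> \<gamma>) \<zeta> ! n = records g \<alpha>' |` {..<\<zeta>}"
      using less.IH[OF next_record(2)[OF lt] next_record(1)[OF lt]] by blast
    have "Suc n < length (walk g \<alpha> \<zeta>) \<and> walk g \<alpha> \<zeta> ! Suc n = records g \<alpha>' |` {..<\<zeta>}"
      if "max \<eta> \<eta>1 \<le> \<zeta> \<and> \<zeta> < \<gamma>" for \<zeta>
    proof -
      have "next_record g \<alpha> \<zeta> = next_record g \<alpha> \<gamma>"
        using that lt \<eta>1(2) by (intro next_record_eq) (auto intro: order.trans)
      then show ?thesis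
        using walk_Cons[of \<zeta> \<alpha>, OF order.strict_trans[OF _ lt]] IH(4)[of \<zeta>] that by simp
    qed
    moreover have "max \<eta> \<eta>1 < \<gamma>"
      using IH(1) \<eta>1(1) by simp
    ultimately show ?thesis
      using IH(2,3) by blast
  qed
qed

end

section \<open>Counting traces and colouring the tree of walks\<close>

context regular_uncountable
begin

text \<open>Whether a place below \<gamma> is a record of \<alpha> depends only on g \<alpha> below
  \<gamma> and on the least value m of g \<alpha> from \<gamma> on. This m is at most \<gamma>,
  being at most g \<alpha> \<gamma>, and it is \<open>None\<close> if \<alpha> = \<gamma>. The
  function \<Phi> rebuilds the trace from these data.\<close>

lemma small_record_traces:
  fixes g :: "'k \<Rightarrow> 'k \<Rightarrow> 'k"
  assumes le: "\<And>\<alpha> \<delta>. \<delta> < \<alpha> \<Longrightarrow> g \<alpha> \<delta> \<le> \<delta>"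
    and sm: "small ((\<lambda>\<alpha> \<delta>. if \<delta> < \<gamma> then Some (g \<alpha> \<delta>) else None) ` {\<gamma>..})"
  shows "small ((\<lambda>\<alpha>. records g \<alpha> |` {..<\<gamma>}) ` {\<gamma>..})"
proof -
  define \<Phi> where "\<Phi> = (\<lambda>(r :: 'k \<rightharpoonup> 'k, m). \<lambda>\<xi>. case r \<xi> of None \<Rightarrow> None | Some v \<Rightarrow>
    if (\<forall>\<eta> w. \<xi> < \<eta> \<and> r \<eta> = Some w \<longrightarrow> v < w) \<and> (\<forall>n. m = Some n \<longrightarrow> v < n) then Some v else None)"
  let ?r = "\<lambda>\<alpha> \<delta>. if \<delta> < \<gamma> then Some (g \<alpha> \<delta>) else None"
  have "records g \<alpha> |` {..<\<gamma>} \<in> \<Phi> ` (?r ` {\<gamma>..} \<times> insert None (Some ` {..\<gamma>}))" if "\<gamma> \<le> \<alpha>" for \<alpha>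
  proof -
    obtain m where m: "m \<in> insert None (Some ` {..\<gamma>})"
      "\<And>v. (\<forall>n. m = Some n \<longrightarrow> v < n) \<longleftrightarrow> (\<forall>\<eta>. \<gamma> \<le> \<eta> \<and> \<eta> < \<alpha> \<longrightarrow> v < g \<alpha> \<eta>)"
    proof (cases "\<gamma> < \<alpha>")
      case True
      define n where "n = (LEAST v. \<exists>\<eta>. \<gamma> \<le> \<eta> \<and> \<eta> < \<alpha> \<and> g \<alpha> \<eta> = v)"
      have "\<exists>\<eta>. \<gamma> \<le> \<eta> \<and> \<eta> < \<alpha> \<and> g \<alpha> \<eta> = n"
        unfolding n_def by (rule LeastI[of _ "g \<alpha> \<gamma>"]) (use True in auto)
      moreover have "n \<le> g \<alpha> \<eta>" if "\<gamma> \<le> \<eta>" "\<eta> < \<alpha>" for \<eta>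
        unfolding n_def by (rule Least_le) (use that in auto)
      moreover from this[of \<gamma>] have "n \<le> \<gamma>"
        using True le[OF True] by auto
      ultimately show thesis
        by (intro that[of "Some n"]) (auto intro: order.strict_trans2)
    next
      case False
      then show thesis
        by (intro that[of None]) auto
    qed
    have "records g \<alpha> |` {..<\<gamma>} = \<Phi> (?r \<alpha>, m)"
    proof
      fix \<xi>
      show "(records g \<alpha> |` {..<\<gamma>}) \<xi> = \<Phi> (?r \<alpha>, m) \<xi>"
      proof (cases "\<xi> < \<gamma>")
        case True
        have "(\<forall>\<eta>. \<xi> < \<eta> \<and> \<eta> < \<alpha> \<longrightarrow> g \<alpha> \<xi> < g \<alpha> \<eta>) \<longleftrightarrow>
          (\<forall>\<eta>. \<xi> < \<eta> \<and> \<eta> < \<gamma> \<longrightarrow> g \<alpha> \<xi> < g \<alpha> \<eta>) \<and> (\<forall>\<eta>. \<gamma> \<le> \<eta> \<and> \<eta> < \<alpha> \<longrightarrow> g \<alpha> \<xi> < g \<alpha> \<eta>)"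
          using True that by (meson leI order.strict_trans2)
        then show ?thesis
          using True that by (simp add: \<Phi>_def records_def m(2)) (metis (no_types, lifting) option.distinct(1) option.inject order.strict_trans2)
      qed (simp add: \<Phi>_def)
    qed
    then show ?thesis
      using m(1) that by blast
  qed
  then have "(\<lambda>\<alpha>. records g \<alpha> |` {..<\<gamma>}) ` {\<gamma>..} \<subseteq> \<Phi> ` (?r ` {\<gamma>..} \<times> insert None (Some ` {..\<gamma>}))"
    by auto
  then show ?thesis
    by (rule small_subset[rotated]) (intro small_image small_Sigma sm small_insert_None small_atMost)
qed

lemma injective_tree_of_regressive_functions:
  fixes g :: "'k \<Rightarrow> 'k \<Rightarrow> 'k"
  assumes D: "club D" "D \<subseteq> acc_kappa"
    and fin: "\<And>\<alpha> m. finite {\<delta>. \<delta> < \<alpha> \<and> g \<alpha> \<delta> = m}"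
    and le: "\<And>\<alpha> \<delta>. \<delta> < \<alpha> \<Longrightarrow> g \<alpha> \<delta> \<le> \<delta>"
    and reg: "\<And>\<alpha> \<delta>. \<delta> < \<alpha> \<Longrightarrow> \<delta> \<in> D \<Longrightarrow> g \<alpha> \<delta> < \<delta>"
    and sm: "\<And>\<gamma>. small ((\<lambda>\<alpha> \<delta>. if \<delta> < \<gamma> then Some (g \<alpha> \<delta>) else None) ` {\<gamma>..})"
  shows "injective_tree_with_colouring \<kappa>"
proof -
  define W where "W \<gamma> \<alpha> = (\<lambda>\<zeta>. if \<zeta> < \<gamma> then Some (walk g \<alpha> \<zeta>) else None)" for \<gamma> \<alpha>
  define Y where "Y \<gamma> = W \<gamma> ` {\<gamma>..}" for \<gamma>
  have Wdom: "dom (W \<gamma> \<alpha>) = {..<\<gamma>}" for \<gamma> \<alpha>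
    by (auto simp: W_def dom_def)
  have Ydom: "dom t = {..<\<gamma>}" if "t \<in> Y \<gamma>" for t \<gamma>
    using that Wdom unfolding Y_def by blast
  have Wres: "W \<gamma> \<alpha> |` {..<\<delta>} = W \<delta> \<alpha>" if "\<delta> \<le> \<gamma>" for \<alpha> \<gamma> \<delta>
    using that by (auto simp: W_def restrict_map_def fun_eq_iff)
  have Yres: "t |` {..<\<delta>} \<in> Y \<delta>" if "t \<in> Y \<gamma>" "\<delta> \<le> \<gamma>" for t \<gamma> \<delta>
    using that Wres[OF that(2)] unfolding Y_def by auto
  have Yne: "Y \<gamma> \<noteq> {}" for \<gamma>
    by (auto simp: Y_def)
  have Ysm: "small (Y \<gamma>)" for \<gamma>
  proof -
    let ?L = "lists ((\<lambda>\<alpha>. records g \<alpha> |` {..<\<gamma>}) ` {\<gamma>..})"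
    let ?E = "\<lambda>cs \<zeta>. if \<zeta> < \<gamma> then Some (walk_of_traces g cs \<zeta>) else None"
    have "Y \<gamma> \<subseteq> ?E ` ?L"
    proof
      fix t assume "t \<in> Y \<gamma>"
      then obtain \<alpha> where \<alpha>: "\<gamma> \<le> \<alpha>" "t = W \<gamma> \<alpha>"
        by (auto simp: Y_def)
      then obtain cs where "cs \<in> ?L" "\<forall>\<zeta><\<gamma>. walk g \<alpha> \<zeta> = walk_of_traces g cs \<zeta>"
        using walk_traces[OF fin] by blast
      moreover from this have "t = ?E cs"
        using \<alpha> by (auto simp: W_def)
      ultimately show "t \<in> ?E ` ?L" by blast
    qed
    moreover have "small (?E ` ?L)"
      by (intro small_image small_lists small_record_traces le sm)
    ultimately show ?thesis
      by (rule small_subset[rotated])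
  qed
  \<comment> \<open>M is the trace into which the n-th entries of the walks grow as they approach
    \<gamma>; from \<eta> on each such entry is an initial segment of M.\<close>
  define Q where "Q \<gamma> t n \<eta> M \<longleftrightarrow> \<eta> < \<gamma> \<and> (\<exists>\<alpha>'\<ge>\<gamma>. M = records g \<alpha>' |` {..<\<gamma>}) \<and>
      (\<forall>\<xi><\<gamma>. \<exists>\<xi>'\<ge>\<xi>. \<xi>' < \<gamma> \<and> M \<xi>' \<noteq> None) \<and>
      (\<forall>\<zeta>. \<eta> \<le> \<zeta> \<and> \<zeta> < \<gamma> \<longrightarrow> (\<exists>l. t \<zeta> = Some l \<and> n < length l \<and> l ! n = M |` {..<\<zeta>}))"
    for \<gamma> n \<eta> M and t :: "'k \<rightharpoonup> ('k \<rightharpoonup> 'k) list"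
  have exQ: "\<exists>n \<eta> M. Q \<gamma> t n \<eta> M" if "t \<in> Y \<gamma>" "\<gamma> \<in> acc_kappa" for t \<gamma>
  proof -
    obtain \<alpha> \<eta>0 where \<alpha>: "\<gamma> \<le> \<alpha>" "t = W \<gamma> \<alpha>" "\<eta>0 < \<gamma>"
      using \<open>t \<in> Y \<gamma>\<close> \<open>\<gamma> \<in> acc_kappa\<close> by (auto simp: Y_def acc_kappa_def)
    obtain n \<eta> \<alpha>' where *: "\<eta> < \<gamma>" "\<gamma> \<le> \<alpha>'" "\<forall>\<xi><\<gamma>. \<exists>\<xi>'\<ge>\<xi>. \<xi>' < \<gamma> \<and> records g \<alpha>' \<xi>' \<noteq> None"
      "\<And>\<zeta>. \<eta> \<le> \<zeta> \<and> \<zeta> < \<gamma> \<Longrightarrow> n < length (walk g \<alpha> \<zeta>) \<and> walk g \<alpha> \<zeta> ! n = records g \<alpha>' |` {..<\<zeta>}"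
      using walk_stabilises[OF fin \<alpha>(1,3)] by blast
    have "\<forall>\<xi><\<gamma>. \<exists>\<xi>'\<ge>\<xi>. \<xi>' < \<gamma> \<and> (records g \<alpha>' |` {..<\<gamma>}) \<xi>' \<noteq> None"
      using *(3) by (metis lessThan_iff restrict_in)
    moreover have "\<exists>l. t \<zeta> = Some l \<and> n < length l \<and> l ! n = records g \<alpha>' |` {..<\<gamma>} |` {..<\<zeta>}"
      if "\<eta> \<le> \<zeta> \<and> \<zeta> < \<gamma>" for \<zeta>
      using *(4)[OF that] that \<alpha>(2) by (auto simp: W_def restrict_restrict_lessThan)
    ultimately have "Q \<gamma> t n \<eta> (records g \<alpha>' |` {..<\<gamma>})"
      unfolding Q_def using *(1,2) by blast
    then show ?thesis by blast
  qed
  define bound where "bound M s \<longleftrightarrow> (\<forall>v\<in>ran M. v \<le> s)" for M :: "'k \<rightharpoonup> 'k" and s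
  \<comment> \<open>The supremum of the colours in M, recorded only if it lies below \<gamma>, since
    the colour has to be regressive.\<close>
  define sg where "sg \<gamma> M = (if \<exists>s<\<gamma>. bound M s then Some (LEAST s. bound M s) else None)" for \<gamma> M
  define C where "C t = (SOME c. \<exists>n \<eta> M. Q (hgt t) t n \<eta> M \<and> c = (n, \<eta>, sg (hgt t) M))" for t
  have C: "\<exists>n \<eta> M. Q \<gamma> t n \<eta> M \<and> C t = (n, \<eta>, sg \<gamma> M)" if "t \<in> Y \<gamma>" "\<gamma> \<in> acc_kappa" for t \<gamma>
  proof -
    have h: "hgt t = \<gamma>" by (rule hgt_eq[OF Ydom[OF that(1)]])
    have "\<exists>c n \<eta> M. Q (hgt t) t n \<eta> M \<and> c = (n, \<eta>, sg (hgt t) M)"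
      using exQ[OF that] h by simp
    then have "\<exists>n \<eta> M. Q (hgt t) t n \<eta> M \<and> C t = (n, \<eta>, sg (hgt t) M)"
      unfolding C_def by (rule someI_ex)
    then show ?thesis by (simp add: h)
  qed
  have sg: "bound M s" "s < \<gamma>" "\<And>s'. bound M s' \<Longrightarrow> s \<le> s'" if "sg \<gamma> M = Some s" for \<gamma> M s
  proof -
    obtain s0 where s0: "s0 < \<gamma>" "bound M s0" and s: "s = (LEAST s. bound M s)"
      using \<open>sg \<gamma> M = Some s\<close> unfolding sg_def by (auto split: if_splits)
    show "bound M s" unfolding s by (rule LeastI[of "bound M", OF s0(2)])
    show le: "s \<le> s'" if "bound M s'" for s'
      unfolding s by (rule Least_le[of "bound M", OF that])
    show "s < \<gamma>" using le[OF s0(2)] s0(1) by simp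
  qed
  define G where "G \<beta> = (UNIV :: nat set) \<times> {..\<beta>} \<times> insert None (Some ` {..\<beta>})" for \<beta> :: 'k
  have G: "small (G \<beta>)" for \<beta>
    unfolding G_def by (intro small_Sigma small_nat small_atMost small_insert_None)
  obtain D' q where D': "club D'" "D' \<subseteq> D" "D' \<subseteq> acc_kappa" "inj_on q (\<Union>\<beta>. G \<beta>)"
    "\<forall>\<alpha>\<in>D'. \<forall>\<beta><\<alpha>. \<forall>c\<in>G \<beta>. q c < \<alpha>"
    by (rule regressive_recoding[of D G, OF D(1) G])
  have CG: "\<exists>\<beta><\<gamma>. C t \<in> G \<beta>" if "t \<in> Y \<gamma>" "\<gamma> \<in> D'" for t \<gamma>
  proof -
    have "\<gamma> \<in> acc_kappa" using that(2) D'(3) by blast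
    from C[OF that(1) this] obtain n \<eta> M where *: "Q \<gamma> t n \<eta> M" "C t = (n, \<eta>, sg \<gamma> M)"
      by blast
    have "\<eta> < \<gamma>" using *(1) by (simp add: Q_def)
    show ?thesis
    proof (cases "sg \<gamma> M")
      case None
      then show ?thesis using * \<open>\<eta> < \<gamma>\<close> by (auto simp: G_def)
    next
      case (Some s)
      then have "max \<eta> s < \<gamma>" using sg(2) \<open>\<eta> < \<gamma>\<close> by simp
      moreover have "C t \<in> G (max \<eta> s)" using * Some by (auto simp: G_def)
      ultimately show ?thesis by blast
    qed
  qed
  have distinct: "C (t |` {..<\<gamma>}) \<noteq> C t" if "\<gamma> \<in> D'" "\<delta> \<in> D'" "\<gamma> < \<delta>" "t \<in> Y \<delta>" for \<gamma> \<delta> t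
  proof
    assume eq: "C (t |` {..<\<gamma>}) = C t"
    have t': "t |` {..<\<gamma>} \<in> Y \<gamma>" using Yres[OF that(4)] that(3) by simp
    have acc: "\<gamma> \<in> acc_kappa" "\<delta> \<in> acc_kappa" using that D'(3) by auto
    obtain n \<eta> M M' where Q: "Q \<gamma> (t |` {..<\<gamma>}) n \<eta> M" "Q \<delta> t n \<eta> M'" "sg \<gamma> M = sg \<delta> M'"
      using C[OF t' acc(1)] C[OF \<open>t \<in> Y \<delta>\<close> acc(2)] eq by auto
    have "\<eta> < \<gamma>" using Q(1) by (simp add: Q_def)
    obtain \<alpha> \<alpha>' where M: "M = records g \<alpha> |` {..<\<gamma>}" and M': "M' = records g \<alpha>' |` {..<\<delta>}" "\<delta> \<le> \<alpha>'"
      using Q(1,2) unfolding Q_def by blast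
    \<comment> \<open>With equal n and \<eta>, both traces are read off from the same entries of the
      same walks.\<close>
    have Mr: "M |` {..<\<zeta>} = M' |` {..<\<zeta>}" if "\<eta> \<le> \<zeta>" "\<zeta> < \<gamma>" for \<zeta>
    proof -
      have "(t |` {..<\<gamma>}) \<zeta> = t \<zeta>" "\<zeta> < \<delta>" using that \<open>\<gamma> < \<delta>\<close> by auto
      then show ?thesis
        using Q(1,2) that unfolding Q_def by (metis option.inject)
    qed
    have Mv: "M \<xi> = M' \<xi>" if "\<xi> < \<gamma>" for \<xi>
    proof -
      obtain \<zeta> where "max \<xi> \<eta> < \<zeta>" "\<zeta> < \<gamma>"
        using acc_ex_between[OF acc(1), of "max \<xi> \<eta>"] \<open>\<eta> < \<gamma>\<close> \<open>\<xi> < \<gamma>\<close> by auto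
      then have "(M |` {..<\<zeta>}) \<xi> = (M' |` {..<\<zeta>}) \<xi>" "\<xi> < \<zeta>"
        using Mr[of \<zeta>] by (simp_all add: less_imp_le)
      then show ?thesis by (simp add: restrict_map_def)
    qed
    have val: "\<exists>\<xi><\<gamma>. records g \<alpha>' \<xi> = Some v" if "v \<in> ran M" for v
    proof -
      obtain \<xi> where "M \<xi> = Some v" using \<open>v \<in> ran M\<close> by (auto simp: ran_def)
      moreover from this have "\<xi> < \<gamma>" using M by (auto simp: restrict_map_def split: if_splits)
      ultimately show ?thesis using Mv[of \<xi>] M' by (auto simp: restrict_map_def split: if_splits)
    qed
    have "\<gamma> < \<alpha>'" using that(3) M'(2) by simp
    \<comment> \<open>Every record of \<alpha>' below \<gamma> has a colour smaller than the one at
      \<gamma>, which is itself below \<gamma> because \<gamma> lies in D.\<close>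
    have "bound M (g \<alpha>' \<gamma>)"
      unfolding bound_def using val records_increasing \<open>\<gamma> < \<alpha>'\<close> by (metis less_imp_le)
    moreover have "g \<alpha>' \<gamma> < \<gamma>"
      using reg[OF \<open>\<gamma> < \<alpha>'\<close>] that(1) D'(2) by blast
    ultimately have "sg \<gamma> M = Some (LEAST s. bound M s)"
      unfolding sg_def by auto
    then obtain s where s: "sg \<gamma> M = Some s" "sg \<delta> M' = Some s"
      using Q(3) by auto
    \<comment> \<open>Two records between \<gamma> and \<delta> are used: the colour v of the first
      bounds M, so s \<le> v, while the second gives v < v' \<le> s. The first alone would leave s =
      v possible.\<close>
    obtain \<xi> where \<xi>: "\<gamma> \<le> \<xi>" "\<xi> < \<delta>" "M' \<xi> \<noteq> None"
      using Q(2) \<open>\<gamma> < \<delta>\<close> unfolding Q_def by blast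
    obtain \<xi>0 where "\<xi> < \<xi>0" "\<xi>0 < \<delta>"
      using acc_ex_between[OF acc(2) \<xi>(2)] by blast
    then obtain \<xi>' where \<xi>': "\<xi> < \<xi>'" "\<xi>' < \<delta>" "M' \<xi>' \<noteq> None"
      using Q(2) unfolding Q_def by (meson order.strict_trans2)
    obtain v v' where v: "M' \<xi> = Some v" "M' \<xi>' = Some v'"
      using \<xi>(3) \<xi>'(3) by auto
    then have r: "records g \<alpha>' \<xi> = Some v" "records g \<alpha>' \<xi>' = Some v'"
      using M' by (auto simp: restrict_map_def split: if_splits)
    have "v < v'"
      using records_increasing[OF r(1) \<xi>'(1)] records_value[OF r(2)] by simp
    moreover have "v' \<le> s"
      using sg(1)[OF s(2)] v(2) unfolding bound_def by (meson ranI)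
    moreover have "bound M v"
      unfolding bound_def
    proof
      fix w assume "w \<in> ran M"
      then obtain \<xi>1 where "\<xi>1 < \<gamma>" "records g \<alpha>' \<xi>1 = Some w"
        using val by blast
      then show "w \<le> v"
        using records_increasing[of g \<alpha>' \<xi>1 w \<xi>] records_value[OF r(1)] \<xi>(1)
        by (metis less_imp_le order.strict_trans2)
    qed
    then have "s \<le> v" by (rule sg(3)[OF s(1)])
    ultimately show False by simp
  qed
  show ?thesis
  proof (rule vanishing_branches_tree[of Y D' "\<lambda>t. q (C t)", OF Ydom Yres Yne Ysm D'(1,3)])
    show "q (C t) < \<gamma>" if "\<gamma> \<in> D'" "t \<in> Y \<gamma>" for \<gamma> t
      using CG[OF that(2,1)] D'(5) that(1) by blast
    show "q (C (t |` {..<\<gamma>})) \<noteq> q (C t)" if "\<gamma> \<in> D'" "\<delta> \<in> D'" "\<gamma> < \<delta>" "t \<in> Y \<delta>" for \<gamma> \<delta> t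
    proof
      assume eq: "q (C (t |` {..<\<gamma>})) = q (C t)"
      have "t |` {..<\<gamma>} \<in> Y \<gamma>" using Yres[OF that(4)] that(3) by simp
      then have "C (t |` {..<\<gamma>}) \<in> (\<Union>\<beta>. G \<beta>)" "C t \<in> (\<Union>\<beta>. G \<beta>)"
        using CG[OF _ that(1)] CG[OF that(4,2)] by blast+
      then show False
        using inj_onD[OF D'(4) eq] distinct[OF that] by blast
    qed
  qed
qed

lemma injective_tree_of_special:
  assumes "special_aronszajn \<kappa> T lt"
  shows "injective_tree_with_colouring \<kappa>"
proof -
  have kt: "kappa_tree \<kappa> T lt"
    using assms by (simp add: special_aronszajn_def aronszajn_def)
  obtain ht :: "'a \<Rightarrow> 'k" where tree: "height_tree T lt ht"
    using kappa_tree_height[OF kt] .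
  interpret height_tree T lt ht by fact
  note lev = kappa_tree_levels[OF kt tree]
  obtain D and f :: "'a \<Rightarrow> 'k" where D: "club D" "D \<subseteq> acc_kappa"
    and reg: "\<And>x. x \<in> T \<Longrightarrow> ht x \<in> D \<Longrightarrow> f x < ht x"
    and inj: "\<And>x y. (x, y) \<in> lt \<Longrightarrow> ht x \<in> D \<Longrightarrow> ht y \<in> D \<Longrightarrow> f x \<noteq> f y"
    by (rule special_aronszajn_colouring[OF assms tree]) blast
  have "\<exists>x. x \<in> T \<and> ht x = \<alpha>" for \<alpha>
    using lev(1) by blast
  then obtain x where x: "\<And>\<alpha>. x \<alpha> \<in> T" "\<And>\<alpha>. ht (x \<alpha>) = \<alpha>"
    by metis
  \<comment> \<open>Off D the value \<delta> keeps g at most \<delta> and takes each value at most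
    once. On D the colours along a node are distinct. So every fibre has at most two
    elements.\<close>
  define g where "g \<alpha> \<delta> = (if \<delta> \<in> D then f (proj (x \<alpha>) \<delta>) else \<delta>)" for \<alpha> \<delta>
  have pr: "proj (x \<alpha>) \<delta> \<in> T" "ht (proj (x \<alpha>) \<delta>) = \<delta>" if "\<delta> \<le> \<alpha>" for \<alpha> \<delta>
    using proj_in ht_proj x that by auto
  show ?thesis
  proof (rule injective_tree_of_regressive_functions[OF D, of g])
    show "g \<alpha> \<delta> < \<delta>" if "\<delta> < \<alpha>" "\<delta> \<in> D" for \<alpha> \<delta>
      using reg[of "proj (x \<alpha>) \<delta>"] pr[of \<delta> \<alpha>] that by (simp add: g_def)
    then show "g \<alpha> \<delta> \<le> \<delta>" if "\<delta> < \<alpha>" for \<alpha> \<delta>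
      using that by (cases "\<delta> \<in> D") (auto simp: g_def less_imp_le)
    show "finite {\<delta>. \<delta> < \<alpha> \<and> g \<alpha> \<delta> = m}" for \<alpha> m
    proof -
      have "\<not> \<delta> < \<delta>'" if "\<delta> \<in> D" "\<delta>' \<in> D" "\<delta>' < \<alpha>" "g \<alpha> \<delta> = g \<alpha> \<delta>'" for \<delta> \<delta>'
      proof
        assume "\<delta> < \<delta>'"
        then have "(proj (x \<alpha>) \<delta>, proj (x \<alpha>) \<delta>') \<in> lt"
          using below_comparable[of "proj (x \<alpha>) \<delta>" "x \<alpha>" "proj (x \<alpha>) \<delta>'"] proj_lt[OF x(1)] x(2) that(3) by auto
        then show False
          using inj[of "proj (x \<alpha>) \<delta>" "proj (x \<alpha>) \<delta>'"] pr[of \<delta> \<alpha>] pr[of \<delta>' \<alpha>] that \<open>\<delta> < \<delta>'\<close>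
          by (simp add: g_def)
      qed
      then have "\<delta> = \<delta>'" if "\<delta> \<in> D" "\<delta>' \<in> D" "\<delta> < \<alpha>" "\<delta>' < \<alpha>" "g \<alpha> \<delta> = g \<alpha> \<delta>'" for \<delta> \<delta>'
        using that by (metis linorder_neqE)
      then have "\<exists>d. {\<delta> \<in> D. \<delta> < \<alpha> \<and> g \<alpha> \<delta> = m} \<subseteq> {d}"
        by (smt (verit, best) insertI1 mem_Collect_eq subsetI)
      then obtain d where "{\<delta> \<in> D. \<delta> < \<alpha> \<and> g \<alpha> \<delta> = m} \<subseteq> {d}" ..
      then have "{\<delta>. \<delta> < \<alpha> \<and> g \<alpha> \<delta> = m} \<subseteq> {d, m}"
        by (auto simp: g_def)
      then show ?thesis
        by (rule finite_subset) simp
    qed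
    show "small ((\<lambda>\<alpha> \<delta>. if \<delta> < \<gamma> then Some (g \<alpha> \<delta>) else None) ` {\<gamma>..})" for \<gamma>
    proof -
      \<comment> \<open>Below \<gamma> the function g \<alpha> is read off from the restriction of
        the chosen node to level \<gamma>, so smallness of that level suffices.\<close>
      let ?F = "\<lambda>z \<delta>. if \<delta> < \<gamma> then Some (if \<delta> \<in> D then f (proj z \<delta>) else \<delta>) else None"
      have "(\<lambda>\<delta>. if \<delta> < \<gamma> then Some (g \<alpha> \<delta>) else None) = ?F (proj (x \<alpha>) \<gamma>)" if "\<gamma> \<le> \<alpha>" for \<alpha>
        using proj_proj[OF x(1), of _ \<gamma> \<alpha>] x(2) that by (auto simp: g_def fun_eq_iff less_imp_le)
      then have "(\<lambda>\<alpha> \<delta>. if \<delta> < \<gamma> then Some (g \<alpha> \<delta>) else None) ` {\<gamma>..} \<subseteq> ?F ` {z \<in> T. ht z = \<gamma>}"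
        using pr by blast
      then show ?thesis
        by (rule small_subset[OF small_image[OF lev(2)]])
    qed
  qed
qed

end

section \<open>Finite concatenations\<close>

inductive_set concatenations :: "('k \<rightharpoonup> 'v) set \<Rightarrow> ('k \<rightharpoonup> 'v) set" for K where
  base: "x \<in> K \<Longrightarrow> x \<in> concatenations K"
| step: "s \<in> concatenations K \<Longrightarrow> x \<in> K \<Longrightarrow> dom s \<subseteq> dom x \<Longrightarrow> x ++ s \<in> concatenations K"

lemma restrict_map_add_distrib: "(x ++ s) |` A = (x |` A) ++ (s |` A)"
  by (auto simp: fun_eq_iff restrict_map_def map_add_def)

lemma map_add_absorb: "dom x \<subseteq> dom s \<Longrightarrow> x ++ s = s"
  by (rule ext) (metis domIff map_add_dom_app_simps(1) map_add_dom_app_simps(3) subsetD)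

lemma concatenations_foldr:
  "t \<in> concatenations K \<Longrightarrow> \<exists>xs\<in>lists {x \<in> K. dom x \<subseteq> dom t}. t = foldr (++) xs Map.empty"
proof (induction rule: concatenations.induct)
  case (base x)
  then show ?case by (intro bexI[of _ "[x]"]) auto
next
  case (step s x)
  then obtain xs where xs: "xs \<in> lists {x \<in> K. dom x \<subseteq> dom s}" "s = foldr (++) xs Map.empty"
    by blast
  then have "x # xs \<in> lists {y \<in> K. dom y \<subseteq> dom (x ++ s)}"
    using step.hyps(2) by (auto simp: in_lists_conv_set)
  then show ?case
    using xs(2) by (intro bexI[of _ "x # xs"]) auto
qed

context
  fixes K :: "'k::wellorder node set"
  assumes K: "streamlined K"
begin

lemma concatenations_slevel:
  "t \<in> concatenations K \<Longrightarrow> \<exists>\<alpha>. dom t = {..<\<alpha>} \<and> ran t \<subseteq> H_kappa"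
proof (induction rule: concatenations.induct)
  case (base x)
  then show ?case using streamlined_slevel[OF K] by (force simp: slevel_def)
next
  case (step s x)
  have "dom x = {..<hgt x}" "ran x \<subseteq> H_kappa"
    using streamlined_slevel[OF K step.hyps(2)] by (auto simp only: slevel_def mem_Collect_eq)
  moreover have "dom (x ++ s) = dom x" using step.hyps(3) by auto
  moreover have "ran (x ++ s) \<subseteq> ran x \<union> ran s" by (auto simp: ran_def map_add_Some_iff)
  ultimately show ?case using step.IH by (intro exI[of _ "hgt x"]) auto
qed

lemma concatenations_dom: "t \<in> concatenations K \<Longrightarrow> dom t = {..<hgt t}"
  using concatenations_slevel hgt_eq by metis

lemma concatenations_restrict: "t \<in> concatenations K \<Longrightarrow> t |` {..<\<gamma>} \<in> concatenations K"
proof (induction rule: concatenations.induct)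
  case (base x)
  then show ?case using streamlined_restrict[OF K] concatenations.base by blast
next
  case (step s x)
  show ?case
    unfolding restrict_map_add_distrib
    using step by (intro concatenations.step streamlined_restrict[OF K]) auto
qed

text \<open>Induction on the function that is overwritten. If s is no longer than the earlier part,
  it is put inside that part; otherwise it hides the earlier part and only the last node of K
  remains beneath it.\<close>

lemma concatenations_map_add:
  "t \<in> concatenations K \<Longrightarrow> s \<in> concatenations K \<Longrightarrow> dom s \<subseteq> dom t \<Longrightarrow> t ++ s \<in> concatenations K"
proof (induction rule: concatenations.induct)
  case (base x)
  then show ?case by (intro concatenations.step)
next
  case (step s' x)
  have dx: "dom (x ++ s') = dom x" using step.hyps(3) by auto
  show ?case
  proof (cases "dom s \<subseteq> dom s'")
    case True
    then have "s' ++ s \<in> concatenations K" using step by blast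
    moreover have "dom (s' ++ s) \<subseteq> dom x" using True step.hyps(3) by auto
    ultimately show ?thesis
      using concatenations.step[of "s' ++ s" K x] step.hyps(2) by simp
  next
    case False
    then have "dom s' \<subseteq> dom s"
      using concatenations_dom[OF step.prems(1)] concatenations_dom[OF step.hyps(1)]
      by (metis lessThan_subset_iff linear)
    then have "x ++ s' ++ s = x ++ s"
      using map_add_absorb[of s' s] map_add_assoc[of x s' s] by simp
    then show ?thesis
      using concatenations.step[OF step.prems(1) step.hyps(2)] step.prems(2) dx by simp
  qed
qed

text \<open>The last proper piece is the tail of a node of K of full height. That node supplies the
  colour of a concatenation, and it witnesses that a function is no concatenation when its tail does
  not come from K.\<close>

lemma concatenations_tail:
  assumes "t \<in> concatenations K" "dom t = {..<\<alpha>}" "\<beta> < \<alpha>"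
  shows "\<exists>a<\<alpha>. \<exists>x\<in>K. dom x = {..<\<alpha>} \<and> (\<forall>\<epsilon>. a \<le> \<epsilon> \<and> \<epsilon> < \<alpha> \<longrightarrow> t \<epsilon> = x \<epsilon>)"
  using assms
proof (induction rule: concatenations.induct)
  case (base x)
  then show ?case by blast
next
  case (step s x)
  have dx: "dom x = {..<\<alpha>}" using step.hyps(3) step.prems(1) by (simp add: Un_absorb1)
  have ds: "dom s = {..<hgt s}" using concatenations_dom[OF step.hyps(1)] .
  then have "hgt s \<le> \<alpha>" using step.hyps(3) dx by (simp add: lessThan_subset_iff)
  show ?case
  proof (cases "hgt s = \<alpha>")
    case True
    then have "x ++ s = s" using dx ds by (intro map_add_absorb) simp
    then show ?thesis using step.IH ds True step.prems(2) by simp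
  next
    case False
    then have "hgt s < \<alpha>" using \<open>hgt s \<le> \<alpha>\<close> by simp
    moreover have "(x ++ s) \<epsilon> = x \<epsilon>" if "hgt s \<le> \<epsilon>" for \<epsilon>
      using that ds by (intro map_add_dom_app_simps(3)) auto
    ultimately show ?thesis using step.hyps(2) dx by blast
  qed
qed

end

section \<open>Colouring and vanishing branches of the tree of concatenations\<close>

context regular_uncountable
begin

text \<open>At a limit height in a suitable club, the colour of a concatenation t codes the place
  \<open>a t\<close> from which it follows a node \<open>X t\<close> of K, together with the colour
  of that node in K. If t is below u and both have the same colour, then \<open>X t\<close> is below
  \<open>X u\<close>, against the injectivity of f on chains.\<close>

lemma uniformly_homogeneous_of_injective_tree:
  assumes "injective_tree_with_colouring \<kappa>"
  shows "\<exists>T :: 'k node set. streamlined T \<and> uniformly_homogeneous T \<and> special_aronszajn \<kappa> T (sorder T) \<and>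
    (\<exists>D :: 'k set. club D \<and> D \<subseteq> V_full T (sorder T))"
proof -
  obtain K :: "'k node set" and D :: "'k set" and f :: "'k node \<Rightarrow> 'k" where K: "streamlined K"
    and D: "club D" "D \<subseteq> acc_kappa" and van: "D \<subseteq> V_minus K (sorder K)"
    and reg: "\<forall>\<alpha>\<in>D. \<forall>x \<in> slevel K \<alpha>. f x < \<alpha>"
    and inj: "\<forall>x \<in> srestrict K D. \<forall>y \<in> srestrict K D. (x, y) \<in> sorder K \<longrightarrow> f x \<noteq> f y"
    and one: "\<forall>x\<in>K. \<forall>y\<in>K. \<forall>\<epsilon> \<in> dom x \<inter> dom y. x \<epsilon> = y \<epsilon> \<longrightarrow> x |` {..<\<epsilon>} = y |` {..<\<epsilon>}"
    using assms unfolding injective_tree_with_colouring_def by (elim exE conjE) (rule that)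
  define P where "P = concatenations K"
  have Pdom: "dom t = {..<hgt t}" if "t \<in> P" for t
    using concatenations_dom[OF K] that by (simp add: P_def)
  have Psl: "slevel P \<alpha> = {t \<in> P. hgt t = \<alpha>}" for \<alpha>
    using concatenations_slevel[OF K] hgt_eq unfolding slevel_def P_def
    by (metis (mono_tags, lifting) mem_Collect_eq)
  have Pst: "streamlined P"
    unfolding streamlined_def Psl kappa_TYPE small_def[symmetric]
  proof (intro conjI allI ballI)
    show "P \<subseteq> (\<Union>\<alpha>. {t \<in> P. hgt t = \<alpha>})" by auto
    show "t |` {..<\<alpha>} \<in> P" if "t \<in> P" for t \<alpha>
      using concatenations_restrict[OF K] that by (simp add: P_def)
    show "{t \<in> P. hgt t = \<alpha>} \<noteq> {}" for \<alpha>
      using streamlined_levels(1)[OF K, of \<alpha>] concatenations.base unfolding P_def by blast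
    show "small {t \<in> P. hgt t = \<alpha>}" for \<alpha>
    proof -
      let ?A = "\<Union>\<beta>\<in>{..\<alpha>}. {x \<in> K. hgt x = \<beta>}"
      have "{t \<in> P. hgt t = \<alpha>} \<subseteq> (\<lambda>xs. foldr (++) xs Map.empty) ` lists ?A"
      proof
        fix t assume "t \<in> {t \<in> P. hgt t = \<alpha>}"
        then have t: "t \<in> P" "dom t = {..<\<alpha>}" using Pdom by auto
        then obtain xs where xs: "xs \<in> lists {x \<in> K. dom x \<subseteq> dom t}" "t = foldr (++) xs Map.empty"
          using concatenations_foldr unfolding P_def by blast
        have "{x \<in> K. dom x \<subseteq> dom t} \<subseteq> ?A"
          using streamlined_dom[OF K] t(2) by (auto simp only: lessThan_subset_iff)
        then have "xs \<in> lists ?A" using subsetD[OF lists_mono xs(1)] by simp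
        then show "t \<in> (\<lambda>xs. foldr (++) xs Map.empty) ` lists ?A" using xs(2) by blast
      qed
      then show ?thesis
        by (rule small_subset[OF small_image[OF small_lists[OF small_UN[OF small_atMost streamlined_levels(2)[OF K]]]]])
    qed
  qed
  have "uniformly_homogeneous P"
    unfolding uniformly_homogeneous_def Psl
  proof (intro allI impI ballI)
    fix \<alpha> \<beta> s t assume "\<alpha> < \<beta>" "s \<in> {t \<in> P. hgt t = \<alpha>}" "t \<in> {t \<in> P. hgt t = \<beta>}"
    then have "s \<in> P" "t \<in> P" "dom s \<subseteq> dom t"
      using Pdom[of s] Pdom[of t] by auto
    then show "t ++ s \<in> P"
      using concatenations_map_add[OF K] by (simp add: P_def)
  qed
  moreover have "special_aronszajn \<kappa> P (sorder P)"
  proof -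
    have "\<exists>a x. a < hgt t \<and> x \<in> K \<and> hgt x = hgt t \<and> (\<forall>\<epsilon>. a \<le> \<epsilon> \<and> \<epsilon> < hgt t \<longrightarrow> t \<epsilon> = x \<epsilon>)"
      if "t \<in> P" "hgt t \<in> acc_kappa" for t
    proof -
      obtain \<beta> where "\<beta> < hgt t" using \<open>hgt t \<in> acc_kappa\<close> unfolding acc_kappa_def by blast
      then show ?thesis
        using concatenations_tail[OF K _ Pdom[OF that(1)]] that(1) hgt_eq unfolding P_def by metis
    qed
    then obtain a X where aX: "\<And>t. t \<in> P \<Longrightarrow> hgt t \<in> acc_kappa \<Longrightarrow> a t < hgt t \<and> X t \<in> K \<and> hgt (X t) = hgt t \<and>
        (\<forall>\<epsilon>. a t \<le> \<epsilon> \<and> \<epsilon> < hgt t \<longrightarrow> t \<epsilon> = X t \<epsilon>)"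
      by metis
    define G where "G \<beta> = {..\<beta>} \<times> {..\<beta>}" for \<beta> :: 'k
    have G: "small (G \<beta>)" for \<beta>
      unfolding G_def by (intro small_Sigma small_atMost)
    obtain D' q where D': "club D'" "D' \<subseteq> D" "D' \<subseteq> acc_kappa" "inj_on q (\<Union>\<beta>. G \<beta>)"
      "\<forall>\<alpha>\<in>D'. \<forall>\<beta><\<alpha>. \<forall>c\<in>G \<beta>. q c < \<alpha>"
      by (rule regressive_recoding[of D G, OF D(1) G])
    have CG: "\<exists>\<beta><hgt t. (a t, f (X t)) \<in> G \<beta>" if "t \<in> P" "hgt t \<in> D'" for t
    proof -
      have *: "a t < hgt t" "X t \<in> K" "hgt (X t) = hgt t"
        using aX that D'(3) by blast+
      then have "f (X t) < hgt t"
        using reg D'(2) that(2) by (auto simp: slevel_eq[OF K])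
      then have "max (a t) (f (X t)) < hgt t" using * by simp
      moreover have "(a t, f (X t)) \<in> G (max (a t) (f (X t)))" by (simp add: G_def)
      ultimately show ?thesis by blast
    qed
    show ?thesis
    proof (rule special_aronszajnI[OF height_tree_streamlined[OF Pst] streamlined_levels[OF Pst] D'(1)])
      show "q (a t, f (X t)) < hgt t" if "t \<in> P" "hgt t \<in> D'" for t
        using CG[OF that] D'(5) that(2) by blast
      show "q (a t, f (X t)) \<noteq> q (a u, f (X u))" if "(t, u) \<in> sorder P" "hgt t \<in> D'" "hgt u \<in> D'" for t u
      proof
        assume eq: "q (a t, f (X t)) = q (a u, f (X u))"
        have tu: "t \<in> P" "u \<in> P" using that(1) by (auto simp: sorder_def)
        then have lt: "hgt t < hgt u" "t = u |` {..<hgt t}"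
          using that(1) sorder_iff[OF Pst] by blast+
        have "(a t, f (X t)) \<in> (\<Union>\<beta>. G \<beta>)" "(a u, f (X u)) \<in> (\<Union>\<beta>. G \<beta>)"
          using CG[OF tu(1) that(2)] CG[OF tu(2) that(3)] by blast+
        then have c: "a t = a u" "f (X t) = f (X u)"
          using inj_onD[OF D'(4) eq] by auto
        have acc: "hgt t \<in> acc_kappa" "hgt u \<in> acc_kappa"
          using that D'(3) by auto
        have at: "a t < hgt t" and Xt: "X t \<in> K" "hgt (X t) = hgt t"
          and tail: "\<And>\<epsilon>. a t \<le> \<epsilon> \<Longrightarrow> \<epsilon> < hgt t \<Longrightarrow> t \<epsilon> = X t \<epsilon>"
          using aX[OF tu(1) acc(1)] by auto
        have Xu: "X u \<in> K" "hgt (X u) = hgt u"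
          and tailu: "\<And>\<epsilon>. a u \<le> \<epsilon> \<Longrightarrow> \<epsilon> < hgt u \<Longrightarrow> u \<epsilon> = X u \<epsilon>"
          using aX[OF tu(2) acc(2)] by auto
        have dt: "dom (X t) = {..<hgt t}" and du: "dom (X u) = {..<hgt u}"
          using streamlined_dom[OF K] Xt Xu by metis+
        \<comment> \<open>From the common place \<open>a t = a u\<close> on, both nodes of K follow
          u up to the height of t; equal values there make them agree on everything before.\<close>
        have "X t |` {..<\<epsilon>} = (X u |` {..<hgt t}) |` {..<\<epsilon>}" if "a t \<le> \<epsilon>" "\<epsilon> < hgt t" for \<epsilon>
        proof -
          have "t \<epsilon> = u \<epsilon>" using lt(2) that(2) by (metis lessThan_iff restrict_in)
          then have "X t \<epsilon> = X u \<epsilon>" using tail[OF that] tailu[of \<epsilon>] that lt(1) c(1) by simp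
          moreover have "\<epsilon> \<in> dom (X t) \<inter> dom (X u)"
            unfolding dt du using that(2) lt(1) by simp
          ultimately have "X t |` {..<\<epsilon>} = X u |` {..<\<epsilon>}"
            using one Xt(1) Xu(1) by blast
          then show ?thesis using restrict_restrict_lessThan[of \<epsilon> "hgt t" "X u"] that(2) by simp
        qed
        then have "X t = X u |` {..<hgt t}"
          using map_eq_of_restrictions[OF acc(1) dt dom_restrict_lessThan[OF du]] lt(1) at by (metis less_imp_le)
        then have "(X t, X u) \<in> sorder K"
          using sorder_iff[OF K Xt(1) Xu(1)] Xt Xu lt(1) by simp
        then show False
          using inj c(2) Xt Xu that D'(2) unfolding srestrict_def slevel_eq[OF K] by blast
      qed
    qed
  qed
  moreover have "D \<subseteq> V_full P (sorder P)"
  proof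
    fix \<alpha> assume "\<alpha> \<in> D"
    then have acc: "\<alpha> \<in> acc_kappa" and "\<alpha> \<in> V_minus K (sorder K)"
      using D(2) van by auto
    then obtain B where "branch K (sorder K) {..<\<alpha>} B" "vanishing K (sorder K) B"
      unfolding V_minus_def by blast
    then obtain U where U: "dom U = {..<\<alpha>}" "\<And>\<gamma>. \<gamma> < \<alpha> \<Longrightarrow> U |` {..<\<gamma>} \<in> K" "U \<notin> K"
      by (rule function_of_branch[OF K acc]) blast
    have "\<exists>B. branch P (sorder P) {..<\<alpha>} B \<and> vanishing P (sorder P) B \<and> s \<in> B"
      if "\<beta> < \<alpha>" "s \<in> level P (sorder P) \<beta>" for \<beta> s
    proof -
      have s: "s \<in> P" "dom s = {..<\<beta>}"
        using that(2) Pdom unfolding level_streamlined[OF Pst] Psl by auto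
      \<comment> \<open>U vanishes in K, and s replaces its beginning. Were the result a
        concatenation, a node of K would share a tail with U and therefore be U.\<close>
      let ?U = "U ++ s"
      have dU: "dom ?U = {..<\<alpha>}" using U(1) s(2) that(1) by auto
      have "?U |` {..<\<gamma>} \<in> P" if "\<gamma> < \<alpha>" for \<gamma>
        unfolding restrict_map_add_distrib P_def
      proof (rule concatenations.step)
        show "s |` {..<\<gamma>} \<in> concatenations K"
          using concatenations_restrict[OF K] s(1) by (simp add: P_def)
        show "dom (s |` {..<\<gamma>}) \<subseteq> dom (U |` {..<\<gamma>})"
          using s(2) U(1) \<open>\<beta> < \<alpha>\<close> by auto
      qed (rule U(2)[OF that])
      moreover have "?U \<notin> P"
      proof
        assume "?U \<in> P"
        then obtain a x where x: "a < \<alpha>" "x \<in> K" "dom x = {..<\<alpha>}" "\<And>\<epsilon>. a \<le> \<epsilon> \<Longrightarrow> \<epsilon> < \<alpha> \<Longrightarrow> ?U \<epsilon> = x \<epsilon>"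
          using concatenations_tail[OF K _ dU \<open>\<beta> < \<alpha>\<close>] unfolding P_def by blast
        have "U |` {..<\<epsilon>} = x |` {..<\<epsilon>}" if "max a \<beta> \<le> \<epsilon>" "\<epsilon> < \<alpha>" for \<epsilon>
        proof -
          \<comment> \<open>U is not in K, so the injectivity condition is applied to a proper
            restriction of U that still has \<epsilon> in its domain.\<close>
          obtain \<epsilon>' where \<epsilon>': "\<epsilon> < \<epsilon>'" "\<epsilon>' < \<alpha>"
            using acc_ex_between[OF acc \<open>\<epsilon> < \<alpha>\<close>] by blast
          have "\<epsilon> \<notin> dom s" using s(2) that by auto
          then have "?U \<epsilon> = U \<epsilon>" by (rule map_add_dom_app_simps(3))
          then have "(U |` {..<\<epsilon>'}) \<epsilon> = x \<epsilon>"
            using x(4)[of \<epsilon>] that \<epsilon>' by simp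
          moreover have "\<epsilon> \<in> dom (U |` {..<\<epsilon>'}) \<inter> dom x"
            using U(1) x(3) \<epsilon>' that by auto
          ultimately have "U |` {..<\<epsilon>'} |` {..<\<epsilon>} = x |` {..<\<epsilon>}"
            using one U(2)[OF \<epsilon>'(2)] x(2) by blast
          then show ?thesis
            using restrict_restrict_lessThan[of \<epsilon> \<epsilon>' U] \<epsilon>'(1) by simp
        qed
        then have "U = x"
          using map_eq_of_restrictions[OF acc U(1) x(3), of "max a \<beta>"] x(1) \<open>\<beta> < \<alpha>\<close> by simp
        then show False using U(3) x(2) by simp
      qed
      ultimately have "branch P (sorder P) {..<\<alpha>} ((\<lambda>\<gamma>. ?U |` {..<\<gamma>}) ` {..<\<alpha>})"
        "vanishing P (sorder P) ((\<lambda>\<gamma>. ?U |` {..<\<gamma>}) ` {..<\<alpha>})"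
        using branch_of_function[OF Pst acc dU] by blast+
      moreover have "s \<in> (\<lambda>\<gamma>. ?U |` {..<\<gamma>}) ` {..<\<alpha>}"
      proof -
        have "dom (U |` {..<\<beta>}) \<subseteq> dom s" using s(2) by auto
        then have "?U |` {..<\<beta>} = s"
          using restrict_lessThan_id[OF s(2) order_refl] by (simp only: restrict_map_add_distrib map_add_absorb)
        then show ?thesis using that(1) by force
      qed
      ultimately show ?thesis by blast
    qed
    with acc show "\<alpha> \<in> V_full P (sorder P)"
      unfolding V_full_def by blast
  qed
  ultimately show ?thesis
    using Pst D(1) by blast
qed

end

section \<open>Homogeneous trees\<close>

text \<open>Exchanges \<open>s\<close> and \<open>t\<close>, acting on \<open>u\<close> only up to the first place where \<open>u\<close> leaves \<open>s\<close>.\<close>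

definition exchange :: "('k::wellorder \<rightharpoonup> 'v) \<Rightarrow> ('k \<rightharpoonup> 'v) \<Rightarrow> ('k \<rightharpoonup> 'v) \<Rightarrow> ('k \<rightharpoonup> 'v)" where
  "exchange s t u \<epsilon> = (if \<epsilon> \<in> dom s \<and> (\<forall>\<zeta><\<epsilon>. u \<zeta> = s \<zeta>)
     then (if u \<epsilon> = s \<epsilon> then t \<epsilon> else if u \<epsilon> = t \<epsilon> then s \<epsilon> else u \<epsilon>) else u \<epsilon>)"

section \<open>The exchange of two nodes of equal height and its inverse\<close>

context
  fixes s t :: "'k::wellorder \<rightharpoonup> 'v" and \<delta> :: 'k
  assumes ds: "dom s = {..<\<delta>}" and dt: "dom t = {..<\<delta>}"
begin

lemma exchange_None: "exchange s t u \<epsilon> = None \<longleftrightarrow> u \<epsilon> = None"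
proof (cases "\<epsilon> < \<delta>")
  case True
  then have "\<epsilon> \<in> dom s" "\<epsilon> \<in> dom t" using ds dt by auto
  then show ?thesis by (auto simp: exchange_def)
next
  case False
  then have "\<epsilon> \<notin> dom s" using ds by auto
  then show ?thesis by (auto simp: exchange_def)
qed

lemma dom_exchange: "dom (exchange s t u) = dom u"
  by (simp add: dom_def exchange_None)

lemma exchange_restrict: "exchange s t (u |` {..<\<gamma>}) = exchange s t u |` {..<\<gamma>}"
proof
  fix \<epsilon>
  show "exchange s t (u |` {..<\<gamma>}) \<epsilon> = (exchange s t u |` {..<\<gamma>}) \<epsilon>"
  proof (cases "\<epsilon> < \<gamma>")
    case True
    then have "(\<forall>\<zeta><\<epsilon>. (u |` {..<\<gamma>}) \<zeta> = s \<zeta>) \<longleftrightarrow> (\<forall>\<zeta><\<epsilon>. u \<zeta> = s \<zeta>)"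
      by (auto simp: restrict_map_def)
    with True show ?thesis
      by (auto simp: exchange_def)
  next
    case False
    then show ?thesis
      using exchange_None[of "u |` {..<\<gamma>}" \<epsilon>] by simp
  qed
qed

text \<open>The test in \<open>exchange s t\<close> whether u still follows s becomes, for the
  image, the test in \<open>exchange t s\<close> whether it follows t. This is why the two maps are
  inverse to each other.\<close>

lemma exchange_agree:
  assumes "\<epsilon> < \<delta>"
  shows "(\<forall>\<zeta><\<epsilon>. exchange s t u \<zeta> = t \<zeta>) \<longleftrightarrow> (\<forall>\<zeta><\<epsilon>. u \<zeta> = s \<zeta>)"
proof
  have d: "\<zeta> \<in> dom s" if "\<zeta> < \<epsilon>" for \<zeta>
    using ds that assms by auto
  show "\<forall>\<zeta><\<epsilon>. exchange s t u \<zeta> = t \<zeta>" if "\<forall>\<zeta><\<epsilon>. u \<zeta> = s \<zeta>"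
    using that d by (auto simp: exchange_def)
  assume *: "\<forall>\<zeta><\<epsilon>. exchange s t u \<zeta> = t \<zeta>"
  have "\<zeta> < \<epsilon> \<longrightarrow> u \<zeta> = s \<zeta>" for \<zeta>
  proof (induction \<zeta> rule: less_induct)
    case (less \<zeta>)
    show ?case
    proof
      assume "\<zeta> < \<epsilon>"
      then have "\<forall>\<xi><\<zeta>. u \<xi> = s \<xi>"
        using less by (meson order.strict_trans)
      then show "u \<zeta> = s \<zeta>"
        using *[rule_format, OF \<open>\<zeta> < \<epsilon>\<close>] d[OF \<open>\<zeta> < \<epsilon>\<close>] by (auto simp: exchange_def split: if_splits)
    qed
  qed
  then show "\<forall>\<zeta><\<epsilon>. u \<zeta> = s \<zeta>" by blast
qed

lemma exchange_exchange: "exchange t s (exchange s t u) = u"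
proof
  fix \<epsilon>
  show "exchange t s (exchange s t u) \<epsilon> = u \<epsilon>"
  proof (cases "\<epsilon> < \<delta> \<and> (\<forall>\<zeta><\<epsilon>. u \<zeta> = s \<zeta>)")
    case True
    then have "\<epsilon> \<in> dom s" "\<epsilon> \<in> dom t" "\<forall>\<zeta><\<epsilon>. exchange s t u \<zeta> = t \<zeta>"
      using ds dt exchange_agree[of \<epsilon> u] by auto
    with True show ?thesis
      unfolding exchange_def[of t s] by (auto simp: exchange_def[of s t])
  next
    case False
    then have "\<not> (\<epsilon> \<in> dom t \<and> (\<forall>\<zeta><\<epsilon>. exchange s t u \<zeta> = t \<zeta>))"
      using dt exchange_agree[of \<epsilon> u] by auto
    then have "exchange t s (exchange s t u) \<epsilon> = exchange s t u \<epsilon>"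
      by (subst exchange_def) (rule if_not_P)
    also have "\<not> (\<epsilon> \<in> dom s \<and> (\<forall>\<zeta><\<epsilon>. u \<zeta> = s \<zeta>))"
      using False ds by auto
    then have "exchange s t u \<epsilon> = u \<epsilon>"
      by (subst exchange_def) (rule if_not_P)
    finally show ?thesis .
  qed
qed

lemma exchange_self: "exchange s t s = t"
proof
  fix \<epsilon> show "exchange s t s \<epsilon> = t \<epsilon>"
  proof (cases "\<epsilon> < \<delta>")
    case True
    then have "\<epsilon> \<in> dom s" using ds by auto
    then show ?thesis by (simp add: exchange_def)
  next
    case False
    then have "\<epsilon> \<notin> dom s" "\<epsilon> \<notin> dom t" using ds dt by auto
    then show ?thesis by (simp add: exchange_def domIff)
  qed
qed

end

text \<open>If u leaves s at \<gamma>, the image is t up to \<gamma>, then one value taken from s or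
  u, then u; two applications of uniform homogeneity put these pieces together. If u and s agree on
  their common domain, the image is a restriction of t or \<open>u ++ t\<close>.\<close>

lemma exchange_in:
  fixes T :: "'k::wellorder node set"
  assumes T: "streamlined T" "uniformly_homogeneous T"
    and s: "s \<in> slevel T \<delta>" and t: "t \<in> slevel T \<delta>" and u: "u \<in> T"
  shows "exchange s t u \<in> T"
proof -
  have ds: "dom s = {..<\<delta>}" and dt: "dom t = {..<\<delta>}" and st: "s \<in> T" "t \<in> T"
    using s t by (auto simp only: slevel_def mem_Collect_eq)
  have du: "dom u = {..<hgt u}" by (rule streamlined_dom[OF T(1) u])
  have uh: "y ++ x \<in> T" if "x \<in> T" "y \<in> T" "hgt x < hgt y" for x y
    using T(2) that unfolding uniformly_homogeneous_def slevel_eq[OF T(1)] by blast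
  note hr = streamlined_hgt_restrict[OF T(1)] and inr = streamlined_restrict[OF T(1)]
  have None_iff: "x \<epsilon> = None \<longleftrightarrow> \<not> \<epsilon> < \<alpha>" if "dom x = {..<\<alpha>}" for x :: "'k node" and \<epsilon> \<alpha>
    using that by (metis domIff lessThan_iff)
  show ?thesis
  proof (cases "\<forall>\<epsilon>. \<epsilon> < hgt u \<and> \<epsilon> < \<delta> \<longrightarrow> u \<epsilon> = s \<epsilon>")
    case agree: True
    show ?thesis
    proof (cases "hgt u \<le> \<delta>")
      case True
      have "exchange s t u = t |` {..<hgt u}"
      proof
        fix \<epsilon> show "exchange s t u \<epsilon> = (t |` {..<hgt u}) \<epsilon>"
        proof (cases "\<epsilon> < hgt u")
          case lt: True
          then have "\<epsilon> < \<delta>" using True by simp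
          then have "\<forall>\<zeta>\<le>\<epsilon>. u \<zeta> = s \<zeta>"
            using agree lt by (meson order.strict_trans1)
          then show ?thesis
            using lt \<open>\<epsilon> < \<delta>\<close> None_iff[OF ds, of \<epsilon>] by (simp add: exchange_def domIff)
        next
          case False
          then show ?thesis
            using exchange_None[OF ds dt] None_iff[OF du] by simp
        qed
      qed
      then show ?thesis using inr[OF st(2)] by simp
    next
      case False
      have "exchange s t u = u ++ t"
      proof
        fix \<epsilon> show "exchange s t u \<epsilon> = (u ++ t) \<epsilon>"
        proof (cases "\<epsilon> < \<delta>")
          case True
          then have "\<forall>\<zeta>\<le>\<epsilon>. u \<zeta> = s \<zeta>"
            using agree False by (meson leI order.strict_trans order.strict_trans1)
          then show ?thesis
            using True None_iff[OF ds, of \<epsilon>] None_iff[OF dt, of \<epsilon>]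
            by (auto simp: exchange_def domIff map_add_def split: option.split)
        next
          case False
          then show ?thesis
            using None_iff[OF ds, of \<epsilon>] None_iff[OF dt, of \<epsilon>]
            by (auto simp: exchange_def domIff map_add_def)
        qed
      qed
      then show ?thesis
        using uh[OF st(2) u] False hgt_eq[OF dt] by simp
    qed
  next
    case False
    define \<gamma> where "\<gamma> = (LEAST \<epsilon>. \<epsilon> < hgt u \<and> \<epsilon> < \<delta> \<and> u \<epsilon> \<noteq> s \<epsilon>)"
    obtain \<epsilon>0 where "\<epsilon>0 < hgt u \<and> \<epsilon>0 < \<delta> \<and> u \<epsilon>0 \<noteq> s \<epsilon>0"
      using False by blast
    then have \<gamma>: "\<gamma> < hgt u" "\<gamma> < \<delta>" "u \<gamma> \<noteq> s \<gamma>"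
      unfolding \<gamma>_def using LeastI[of "\<lambda>\<epsilon>. \<epsilon> < hgt u \<and> \<epsilon> < \<delta> \<and> u \<epsilon> \<noteq> s \<epsilon>" \<epsilon>0] by blast+
    have agree: "u \<zeta> = s \<zeta>" if "\<zeta> < \<gamma>" for \<zeta>
      using not_less_Least[of \<zeta> "\<lambda>\<epsilon>. \<epsilon> < hgt u \<and> \<epsilon> < \<delta> \<and> u \<epsilon> \<noteq> s \<epsilon>"] that \<gamma>
      unfolding \<gamma>_def[symmetric] by (meson order.strict_trans)
    \<comment> \<open>The successor of \<gamma>: restricting to it keeps the position \<gamma>
      itself as the last one.\<close>
    define \<gamma>' where "\<gamma>' = (LEAST x. \<gamma> < x)"
    have \<gamma>': "\<gamma> < \<gamma>'" "\<And>x. \<gamma> < x \<Longrightarrow> \<gamma>' \<le> x"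
      unfolding \<gamma>'_def using \<gamma>(1) by (auto intro: LeastI Least_le)
    then have below: "\<epsilon> < \<gamma>' \<longleftrightarrow> \<epsilon> \<le> \<gamma>" for \<epsilon>
      by (meson leD leI order.strict_trans1)
    have le: "\<gamma>' \<le> hgt u" "\<gamma>' \<le> \<delta>" using \<gamma>' \<gamma> by auto
    let ?v = "exchange s t u"
    \<comment> \<open>At \<gamma> the function u does not have the value of s. If it has the value
      of t, the image has the value of s; any other value is kept.\<close>
    let ?z = "if u \<gamma> = t \<gamma> then s else u"
    have z: "?z \<in> T" "\<gamma>' \<le> hgt ?z"
      using u st le hgt_eq[OF ds] by auto
    have tg: "t |` {..<\<gamma>} \<in> T" "hgt (t |` {..<\<gamma>}) = \<gamma>"
      using inr[OF st(2)] hr[OF st(2), of \<gamma>] \<gamma>(2) hgt_eq[OF dt] by (auto simp: less_imp_le)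
    have "?v |` {..<\<gamma>'} = (?z |` {..<\<gamma>'}) ++ (t |` {..<\<gamma>})"
    proof
      fix \<epsilon>
      consider "\<epsilon> < \<gamma>" | "\<epsilon> = \<gamma>" | "\<gamma> < \<epsilon>" by (metis linorder_neqE)
      then show "(?v |` {..<\<gamma>'}) \<epsilon> = ((?z |` {..<\<gamma>'}) ++ (t |` {..<\<gamma>})) \<epsilon>"
      proof cases
        case 1
        then have "\<epsilon> < \<delta>" "\<epsilon> < \<gamma>'" "\<forall>\<zeta>\<le>\<epsilon>. u \<zeta> = s \<zeta>"
          using \<gamma>(2) \<gamma>'(1) agree by (auto dest: order.strict_trans order.strict_trans1)
        then show ?thesis
          using 1 None_iff[OF ds, of \<epsilon>] None_iff[OF dt, of \<epsilon>]
          by (auto simp: exchange_def domIff map_add_def split: option.split)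
      next
        case 2
        then show ?thesis
          using \<gamma> \<gamma>'(1) agree None_iff[OF ds, of \<gamma>]
          by (auto simp: exchange_def domIff map_add_def)
      next
        case 3
        then have "\<not> \<epsilon> < \<gamma>'" using \<gamma>'(2) by (simp add: leD)
        with 3 show ?thesis by (simp add: map_add_def)
      qed
    qed
    moreover have "(?z |` {..<\<gamma>'}) ++ (t |` {..<\<gamma>}) \<in> T"
      using uh[OF tg(1) inr[OF z(1)]] hr[OF z] tg(2) \<gamma>'(1) by simp
    ultimately have vg: "?v |` {..<\<gamma>'} \<in> T" by simp
    have dv: "dom ?v = {..<hgt u}" using dom_exchange[OF ds dt] du by simp
    have hv: "hgt (?v |` {..<\<gamma>'}) = \<gamma>'"
      using dom_restrict_lessThan[OF dv le(1)] by (rule hgt_eq)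
    show ?thesis
    \<comment> \<open>Uniform homogeneity speaks only of functions of different heights, so the case
      in which nothing of u is left has to be separated.\<close>
    proof (cases "\<gamma>' = hgt u")
      case True
      then show ?thesis using vg restrict_lessThan_id[OF dv] by simp
    next
      case False
      have "?v = u ++ (?v |` {..<\<gamma>'})"
      proof
        fix \<epsilon>
        show "?v \<epsilon> = (u ++ (?v |` {..<\<gamma>'})) \<epsilon>"
        proof (cases "\<epsilon> < \<gamma>'")
          case True
          then have "?v \<epsilon> \<noteq> None" using None_iff[OF dv] le(1) by auto
          with True show ?thesis by (auto simp: map_add_def)
        next
          case False
          then have "\<gamma> < \<epsilon>" using below by auto
          then have "?v \<epsilon> = u \<epsilon>" using \<gamma>(3) by (auto simp: exchange_def)
          with False show ?thesis by (simp add: map_add_def)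
        qed
      qed
      moreover have "u ++ (?v |` {..<\<gamma>'}) \<in> T"
        using uh[OF vg u] hv False le(1) by simp
      ultimately show ?thesis by simp
    qed
  qed
qed

lemma exchange_automorphism:
  fixes T :: "'k::wellorder node set"
  assumes T: "streamlined T" "uniformly_homogeneous T"
    and s: "s \<in> slevel T \<delta>" and t: "t \<in> slevel T \<delta>"
  shows "\<And>u. u \<in> T \<Longrightarrow> exchange s t u \<in> T" "\<And>u. hgt (exchange s t u) = hgt u"
    "\<And>u. exchange t s (exchange s t u) = u" "exchange s t s = t"
    "\<And>u v. (u, v) \<in> sorder T \<Longrightarrow> (exchange s t u, exchange s t v) \<in> sorder T"
proof -
  have ds: "dom s = {..<\<delta>}" and dt: "dom t = {..<\<delta>}"
    using s t by (auto simp only: slevel_def mem_Collect_eq)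
  show i: "exchange s t u \<in> T" if "u \<in> T" for u
    by (rule exchange_in[OF T s t that])
  show h: "hgt (exchange s t u) = hgt u" for u
    by (simp add: hgt_def dom_exchange[OF ds dt])
  show "exchange t s (exchange s t u) = u" for u
    by (rule exchange_exchange[OF ds dt])
  show "exchange s t s = t"
    by (rule exchange_self[OF ds dt])
  show "(exchange s t u, exchange s t v) \<in> sorder T" if "(u, v) \<in> sorder T" for u v
  proof -
    have uv: "u \<in> T" "v \<in> T" using that by (auto simp: sorder_def)
    then have *: "hgt u < hgt v" "u = v |` {..<hgt u}"
      using that sorder_iff[OF T(1)] by blast+
    have "exchange s t u = exchange s t v |` {..<hgt u}"
      using exchange_restrict[OF ds dt, of v "hgt u"] *(2) by simp
    with *(1) show ?thesis
      unfolding sorder_iff[OF T(1) i[OF uv(1)] i[OF uv(2)]] h by blast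
  qed
qed

section \<open>Thinning out a tree to a club of levels, and copying trees to other types\<close>

context regular_uncountable
begin

text \<open>Recursion takes the least element of D above all earlier values. The third property is
  continuity at limits; the fourth turns the closure points of d, which form a club, into fixed
  points.\<close>

lemma club_enumeration:
  assumes "club (D :: 'k set)"
  obtains d :: "'k \<Rightarrow> 'k" where "range d = D" "\<And>\<alpha> \<beta>. \<alpha> < \<beta> \<Longrightarrow> d \<alpha> < d \<beta>"
    "\<And>\<alpha> \<beta>. \<alpha> \<in> acc_kappa \<Longrightarrow> \<beta> < d \<alpha> \<Longrightarrow> \<exists>\<gamma><\<alpha>. \<beta> < d \<gamma>"
    "\<And>\<alpha>. \<alpha> \<in> closed_under d \<Longrightarrow> d \<alpha> = \<alpha>"
proof -
  define d where "d = wfrec {(\<beta>, \<alpha>::'k). \<beta> < \<alpha>} (\<lambda>d \<alpha>. LEAST \<delta>. \<delta> \<in> D \<and> (\<forall>\<beta><\<alpha>. d \<beta> < \<delta>))"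
  have d0: "d \<alpha> = (LEAST \<delta>. \<delta> \<in> D \<and> (\<forall>\<beta><\<alpha>. cut d {(\<beta>, \<alpha>). \<beta> < \<alpha>} \<alpha> \<beta> < \<delta>))" for \<alpha>
    using def_wfrec[OF eq_reflection[OF d_def] wf, of \<alpha>] .
  have cut: "(\<forall>\<beta><\<alpha>. cut d {(\<beta>, \<alpha>). \<beta> < \<alpha>} \<alpha> \<beta> < \<delta>) \<longleftrightarrow> (\<forall>\<beta><\<alpha>. d \<beta> < \<delta>)" for \<alpha> \<delta>
    by (auto simp: cut_def)
  have d: "d \<alpha> = (LEAST \<delta>. \<delta> \<in> D \<and> (\<forall>\<beta><\<alpha>. d \<beta> < \<delta>))" for \<alpha>
    using d0[of \<alpha>] unfolding cut .
  have "\<exists>\<delta>. \<delta> \<in> D \<and> (\<forall>\<beta><\<alpha>. d \<beta> < \<delta>)" for \<alpha>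
  proof -
    obtain b where "\<And>x. x \<in> d ` {..<\<alpha>} \<Longrightarrow> x < b"
      using small_bounded[OF small_image[OF small_lessThan]] by blast
    moreover obtain \<delta> where "\<delta> \<in> D" "b < \<delta>"
      using assms unfolding club_def by blast
    ultimately show ?thesis
      by (metis imageI lessThan_iff order.strict_trans)
  qed
  then have d1: "d \<alpha> \<in> D \<and> (\<forall>\<beta><\<alpha>. d \<beta> < d \<alpha>)" for \<alpha>
    using LeastI_ex[of "\<lambda>\<delta>. \<delta> \<in> D \<and> (\<forall>\<beta><\<alpha>. d \<beta> < \<delta>)"] unfolding d[of \<alpha>, symmetric] by blast
  have d2: "d \<alpha> \<le> \<delta>" if "\<delta> \<in> D" "\<And>\<beta>. \<beta> < \<alpha> \<Longrightarrow> d \<beta> < \<delta>" for \<alpha> \<delta>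
    unfolding d[of \<alpha>] using that by (intro Least_le) blast
  have ge: "\<alpha> \<le> d \<alpha>" for \<alpha>
  proof (induction \<alpha> rule: less_induct)
    case (less \<alpha>)
    show ?case
    proof (rule ccontr)
      assume "\<not> \<alpha> \<le> d \<alpha>"
      then have "d \<alpha> < \<alpha>" by simp
      then have "d \<alpha> \<le> d (d \<alpha>)" "d (d \<alpha>) < d \<alpha>" using less d1 by auto
      then show False by simp
    qed
  qed
  have rng: "range d = D"
  proof (intro equalityI subsetI)
    fix \<delta> assume \<delta>: "\<delta> \<in> D"
    define \<alpha> where "\<alpha> = (LEAST \<alpha>. \<delta> \<le> d \<alpha>)"
    have "\<delta> \<le> d \<alpha>" unfolding \<alpha>_def by (rule LeastI[of _ \<delta>]) (rule ge)
    moreover have "d \<beta> < \<delta>" if "\<beta> < \<alpha>" for \<beta>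
      using not_less_Least[of \<beta> "\<lambda>\<alpha>. \<delta> \<le> d \<alpha>"] that unfolding \<alpha>_def by simp
    then have "d \<alpha> \<le> \<delta>" by (rule d2[OF \<delta>])
    ultimately show "\<delta> \<in> range d" by (metis antisym rangeI)
  qed (use d1 in blast)
  show thesis
  proof (rule that[OF rng])
    show "d \<alpha> < d \<beta>" if "\<alpha> < \<beta>" for \<alpha> \<beta>
      using d1 that by blast
    show "\<exists>\<gamma><\<alpha>. \<beta> < d \<gamma>" if "\<alpha> \<in> acc_kappa" "\<beta> < d \<alpha>" for \<alpha> \<beta>
    proof (rule ccontr)
      assume no: "\<not> (\<exists>\<gamma><\<alpha>. \<beta> < d \<gamma>)"
      \<comment> \<open>The supremum of the earlier values. It is a limit of elements of D, hence in
        D, and so it is at least d \<alpha>; but the assumed gap puts it at most at \<beta> < d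
        \<alpha>.\<close>
      define \<sigma> where "\<sigma> = (LEAST \<sigma>. \<forall>\<gamma><\<alpha>. d \<gamma> \<le> \<sigma>)"
      have ub: "\<forall>\<gamma><\<alpha>. d \<gamma> \<le> \<sigma>"
        unfolding \<sigma>_def by (rule LeastI[of _ \<beta>]) (use no in \<open>meson leI\<close>)
      have "\<sigma> \<le> \<beta>"
        unfolding \<sigma>_def by (rule Least_le) (use no in \<open>meson leI\<close>)
      have strict: "d \<gamma> < \<sigma>" if "\<gamma> < \<alpha>" for \<gamma>
        using acc_ex_between[OF \<open>\<alpha> \<in> acc_kappa\<close> that] ub d1 by (meson order.strict_trans2)
      have lim: "\<exists>\<gamma><\<alpha>. \<zeta> < d \<gamma>" if "\<zeta> < \<sigma>" for \<zeta>
        using not_less_Least[of \<zeta> "\<lambda>\<sigma>. \<forall>\<gamma><\<alpha>. d \<gamma> \<le> \<sigma>"] that unfolding \<sigma>_def by (auto simp: not_le)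
      obtain \<gamma>0 where "\<gamma>0 < \<alpha>" using \<open>\<alpha> \<in> acc_kappa\<close> unfolding acc_kappa_def by blast
      have "\<sigma> \<in> acc_kappa"
        unfolding acc_kappa_def using strict lim \<open>\<gamma>0 < \<alpha>\<close> by blast
      then have "\<sigma> \<in> D"
        using assms lim strict d1 unfolding club_def by meson
      then have "d \<alpha> \<le> \<sigma>" using strict by (rule d2)
      then show False using \<open>\<sigma> \<le> \<beta>\<close> \<open>\<beta> < d \<alpha>\<close> by simp
    qed
    show "d \<alpha> = \<alpha>" if "\<alpha> \<in> closed_under d" for \<alpha>
    proof (rule antisym)
      have \<alpha>: "\<alpha> \<in> acc_kappa" "\<And>\<beta>. \<beta> < \<alpha> \<Longrightarrow> d \<beta> < \<alpha>"
        using that by (auto simp: closed_under_def)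
      have "\<exists>\<delta>\<in>D. \<beta> < \<delta> \<and> \<delta> < \<alpha>" if "\<beta> < \<alpha>" for \<beta>
      proof -
        obtain \<gamma> where "\<beta> < \<gamma>" "\<gamma> < \<alpha>" using acc_ex_between[OF \<alpha>(1) \<open>\<beta> < \<alpha>\<close>] by blast
        then show ?thesis using ge[of \<gamma>] d1 \<alpha>(2) by (meson order.strict_trans2)
      qed
      then have "\<alpha> \<in> D" using assms \<alpha>(1) unfolding club_def by blast
      then show "d \<alpha> \<le> \<alpha>" using \<alpha>(2) by (rule d2)
    qed (rule ge)
  qed
qed

text \<open>The levels in D are renumbered by the enumeration d. Where d fixes \<alpha>, heights in
  both trees agree, so a colouring of T serves the thinned tree on a club. The exchanges preserve
  heights and hence the set of remaining nodes. A limit \<alpha> stands for the level d \<alpha> in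
  D, where every earlier node lies on a vanishing branch.\<close>

lemma homogeneous_of_uniformly_homogeneous:
  fixes T :: "'k node set" and D :: "'k set"
  assumes T: "streamlined T" "uniformly_homogeneous T" and sp: "special_aronszajn \<kappa> T (sorder T)"
    and D: "club D" "D \<subseteq> V_full T (sorder T)"
  shows "\<exists>(T' :: 'k node set) lt. special_aronszajn \<kappa> T' lt \<and> homogeneous \<kappa> T' lt \<and>
    (acc_kappa :: 'k set) \<subseteq> V_full T' lt"
proof -
  obtain d :: "'k \<Rightarrow> 'k" where rng: "range d = D" and mono: "\<And>\<alpha> \<beta>. \<alpha> < \<beta> \<Longrightarrow> d \<alpha> < d \<beta>"
    and lim: "\<And>\<alpha> \<beta>. \<alpha> \<in> acc_kappa \<Longrightarrow> \<beta> < d \<alpha> \<Longrightarrow> \<exists>\<gamma><\<alpha>. \<beta> < d \<gamma>"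
    and fixed: "\<And>\<alpha>. \<alpha> \<in> closed_under d \<Longrightarrow> d \<alpha> = \<alpha>"
    by (rule club_enumeration[OF D(1)]) blast
  have inj: "inj d" by (metis injI linorder_neqE mono order.irrefl)
  have less_iff: "d \<alpha> < d \<beta> \<longleftrightarrow> \<alpha> < \<beta>" for \<alpha> \<beta>
    by (metis linorder_neqE mono order.asym order.irrefl)
  define R where "R = {t \<in> T. hgt t \<in> D}"
  define lt where "lt = sorder T \<inter> R \<times> R"
  define ht where "ht t = inv d (hgt t)" for t :: "'k node"
  have dht: "d (ht t) = hgt t" if "t \<in> R" for t
    using that rng by (auto simp: R_def ht_def f_inv_into_f)
  have RT: "t \<in> T" if "t \<in> R" for t using that by (simp add: R_def)
  note iff = sorder_iff[OF T(1)]
  interpret T: height_tree T "sorder T" hgt by (rule height_tree_streamlined[OF T(1)])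
  have tree: "height_tree R lt ht"
  proof
    show "lt \<subseteq> R \<times> R" by (auto simp: lt_def)
    show "trans lt"
      using T.lt_trans unfolding lt_def trans_def by blast
    show "ht x < ht y" if "(x, y) \<in> lt" for x y
      using that T.ht_mono[of x y] dht[of x] dht[of y] less_iff[of "ht x" "ht y"] by (auto simp: lt_def)
    show "\<exists>y. (y, x) \<in> lt \<and> ht y = \<gamma>" if "x \<in> R" "\<gamma> < ht x" for x \<gamma>
    proof -
      have "d \<gamma> < hgt x" using mono[OF that(2)] dht[OF that(1)] by simp
      then obtain y where y: "(y, x) \<in> sorder T" "hgt y = d \<gamma>"
        using T.ex_below RT[OF \<open>x \<in> R\<close>] by blast
      then have "y \<in> R" using rng by (auto simp: R_def sorder_def)
      moreover from this have "ht y = \<gamma>" using dht[of y] y(2) inj by (auto dest: injD)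
      ultimately show ?thesis using y(1) that(1) by (auto simp: lt_def)
    qed
    show "y = z" if "(y, x) \<in> lt" "(z, x) \<in> lt" "ht y = ht z" for x y z
      using that T.below_unique[of y x z] dht[of y] dht[of z] by (auto simp: lt_def)
  qed
  have levR: "{x \<in> R. ht x = \<alpha>} = {x \<in> T. hgt x = d \<alpha>}" for \<alpha>
    using dht rng inj unfolding R_def by (auto dest: injD) (simp add: ht_def inv_f_f)
  have level: "level R lt \<alpha> = {x \<in> T. hgt x = d \<alpha>}" for \<alpha>
    unfolding level_height_tree[OF tree] by (rule levR)
  have "special_aronszajn \<kappa> R lt"
  proof -
    obtain D1 and f :: "'k node \<Rightarrow> 'k" where D1: "club D1" "D1 \<subseteq> acc_kappa"
      and reg: "\<And>x. x \<in> T \<Longrightarrow> hgt x \<in> D1 \<Longrightarrow> f x < hgt x"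
      and fi: "\<And>x y. (x, y) \<in> sorder T \<Longrightarrow> hgt x \<in> D1 \<Longrightarrow> hgt y \<in> D1 \<Longrightarrow> f x \<noteq> f y"
      by (rule special_aronszajn_colouring[OF sp height_tree_streamlined[OF T(1)]]) blast
    obtain h where h: "closed_under h \<subseteq> D1 \<inter> closed_under d"
      by (rule club_inter_closed_under[OF D1(1)])
    have eq: "hgt x = ht x \<and> hgt x \<in> D1" if "x \<in> R" "ht x \<in> closed_under h" for x
    proof -
      have "ht x \<in> D1" "ht x \<in> closed_under d" using that(2) h by auto
      then show ?thesis using fixed[of "ht x"] dht[OF that(1)] by simp
    qed
    show ?thesis
    proof (rule special_aronszajnI[OF tree])
      show "{x \<in> R. ht x = \<alpha>} \<noteq> {}" "small {x \<in> R. ht x = \<alpha>}" for \<alpha>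
        unfolding levR by (rule streamlined_levels[OF T(1)])+
      show "club (closed_under h)" by (rule club_closed_under)
      show "f x < ht x" if "x \<in> R" "ht x \<in> closed_under h" for x
        using eq[OF that] reg[OF RT[OF that(1)]] by metis
      show "f x \<noteq> f y" if "(x, y) \<in> lt" "ht x \<in> closed_under h" "ht y \<in> closed_under h" for x y
        using eq[of x] eq[of y] fi[of x y] that by (auto simp: lt_def)
    qed
  qed
  moreover have "homogeneous \<kappa> R lt"
    unfolding homogeneous_def level
  proof (intro allI ballI)
    fix \<alpha> s t assume "s \<in> {x \<in> T. hgt x = d \<alpha>}" "t \<in> {x \<in> T. hgt x = d \<alpha>}"
    then have st: "s \<in> slevel T (d \<alpha>)" "t \<in> slevel T (d \<alpha>)"
      by (simp_all add: slevel_eq[OF T(1)])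
    note a = exchange_automorphism[OF T st] and b = exchange_automorphism[OF T st(2,1)]
    have R: "exchange s t u \<in> R" "exchange t s u \<in> R" if "u \<in> R" for u
      using that a(1,2) b(1,2) by (simp_all add: R_def)
    have "bij_betw (exchange s t) R R"
      by (rule bij_betw_byWitness[of _ "exchange t s"]) (use R a(3) b(3) in auto)
    moreover have "(exchange s t x, exchange s t y) \<in> lt \<longleftrightarrow> (x, y) \<in> lt" if "x \<in> R" "y \<in> R" for x y
      using a(5)[of x y] b(5)[of "exchange s t x" "exchange s t y"] a(3) R that by (auto simp: lt_def)
    ultimately have "automorphism R lt (exchange s t)"
      unfolding automorphism_def by blast
    then show "\<exists>\<pi>. automorphism R lt \<pi> \<and> \<pi> s = t"
      using a(4) by blast
  qed
  moreover have "(acc_kappa :: 'k set) \<subseteq> V_full R lt"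
  proof
    fix \<alpha> :: 'k assume \<alpha>: "\<alpha> \<in> acc_kappa"
    have "d \<alpha> \<in> V_full T (sorder T)" using D(2) rng by blast
    have "\<exists>B. branch R lt {..<\<alpha>} B \<and> vanishing R lt B \<and> x \<in> B" if "\<beta> < \<alpha>" "x \<in> level R lt \<beta>" for \<beta> x
    proof -
      have "x \<in> level T (sorder T) (d \<beta>)" "d \<beta> < d \<alpha>"
        using that mono by (simp_all add: level level_height_tree[OF height_tree_streamlined[OF T(1)]])
      then obtain B where B: "branch T (sorder T) {..<d \<alpha>} B" "vanishing T (sorder T) B" "x \<in> B"
        using \<open>d \<alpha> \<in> V_full T (sorder T)\<close> unfolding V_full_def by blast
      have BT: "B \<subseteq> T" and cmp: "\<And>x y. x \<in> B \<Longrightarrow> y \<in> B \<Longrightarrow> x = y \<or> (x, y) \<in> sorder T \<or> (y, x) \<in> sorder T"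
        and lev: "{\<gamma>. B \<inter> {t \<in> T. hgt t = \<gamma>} \<noteq> {}} = {..<d \<alpha>}"
        using B(1) by (simp_all only: branch_def level_height_tree[OF height_tree_streamlined[OF T(1)]])
      have at: "\<exists>y\<in>B. hgt y = \<gamma>" if "\<gamma> < d \<alpha>" for \<gamma>
        using lev that by blast
      have "branch R lt {..<\<alpha>} (B \<inter> R)"
        unfolding branch_def level
      proof (intro conjI ballI)
        show "x = y \<or> (x, y) \<in> lt \<or> (y, x) \<in> lt" if "x \<in> B \<inter> R" "y \<in> B \<inter> R" for x y
          using cmp[of x y] that by (auto simp: lt_def)
        show "{\<gamma>. B \<inter> R \<inter> {t \<in> T. hgt t = d \<gamma>} \<noteq> {}} = {..<\<alpha>}"
        proof (intro equalityI subsetI)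
          fix \<gamma> assume "\<gamma> \<in> {\<gamma>. B \<inter> R \<inter> {t \<in> T. hgt t = d \<gamma>} \<noteq> {}}"
          then have "d \<gamma> \<in> {..<d \<alpha>}" using lev by blast
          then show "\<gamma> \<in> {..<\<alpha>}" by (simp add: less_iff)
        next
          fix \<gamma> assume "\<gamma> \<in> {..<\<alpha>}"
          then obtain y where "y \<in> B" "hgt y = d \<gamma>" using at[of "d \<gamma>"] mono by auto
          then have "y \<in> B \<inter> R \<inter> {t \<in> T. hgt t = d \<gamma>}" using BT rng by (auto simp: R_def)
          then show "\<gamma> \<in> {\<gamma>. B \<inter> R \<inter> {t \<in> T. hgt t = d \<gamma>} \<noteq> {}}" by blast
        qed
      qed simp
      moreover have "vanishing R lt (B \<inter> R)"
        unfolding vanishing_def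
      proof
        assume "\<exists>t\<in>R. \<forall>y\<in>B \<inter> R. y = t \<or> (y, t) \<in> lt"
        then obtain t where t: "t \<in> R" "\<And>y. y \<in> B \<Longrightarrow> y \<in> R \<Longrightarrow> y = t \<or> (y, t) \<in> sorder T"
          by (auto simp: lt_def)
        have "(y, t) \<in> sorder T" if "y \<in> B" for y
        proof -
          \<comment> \<open>By continuity of d, some remaining level lies strictly between the
            height of y and d \<alpha>. So a bound of the remaining nodes of B bounds all of
            B.\<close>
          have "hgt y < d \<alpha>" using lev \<open>y \<in> B\<close> BT by blast
          then obtain \<gamma> where \<gamma>: "\<gamma> < \<alpha>" "hgt y < d \<gamma>" using lim[OF \<alpha>] by blast
          then obtain z where z: "z \<in> B" "hgt z = d \<gamma>" using at[of "d \<gamma>"] mono by auto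
          then have "z \<in> R" using BT rng by (auto simp: R_def)
          then have zt: "z = t \<or> (z, t) \<in> sorder T" using t(2) z(1) by blast
          have "(y, z) \<in> sorder T"
            using cmp[OF \<open>y \<in> B\<close> z(1)] T.ht_mono[of z y] \<gamma>(2) z(2) by auto
          then show ?thesis using zt T.lt_trans by (metis transD)
        qed
        then show False using B(2) RT[OF t(1)] unfolding vanishing_def by blast
      qed
      moreover have "x \<in> T \<and> hgt x = d \<beta>"
        using that(2) unfolding level by simp
      then have "x \<in> B \<inter> R"
        using B(3) rng by (auto simp: R_def)
      ultimately show ?thesis by blast
    qed
    with \<alpha> show "\<alpha> \<in> V_full R lt" unfolding V_full_def by blast
  qed
  ultimately show ?thesis by blast
qed

text \<open>A \<kappa>-tree has at most \<kappa> nodes, so it can be copied into any type with that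
  many elements; the theorem leaves the node types in (i) and (iv) open. Specialness is carried over
  by way of a colouring, which only has to be composed with the inverse of the copying map.\<close>

lemma special_aronszajn_transfer:
  fixes T :: "'a set"
  assumes sp: "special_aronszajn \<kappa> T lt" and card: "kappa \<kappa> \<le>o |UNIV :: 'b set|"
  obtains T' :: "'b set" and lt' where "special_aronszajn \<kappa> T' lt'"
    "homogeneous \<kappa> T lt \<longrightarrow> homogeneous \<kappa> T' lt'"
    "(acc_kappa :: 'k set) \<subseteq> V_full T lt \<longrightarrow> (acc_kappa :: 'k set) \<subseteq> V_full T' lt'"
proof -
  have kt: "kappa_tree \<kappa> T lt"
    using sp by (simp add: special_aronszajn_def aronszajn_def)
  obtain ht :: "'a \<Rightarrow> 'k" where tree: "height_tree T lt ht"
    using kappa_tree_height[OF kt] .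
  interpret height_tree T lt ht by fact
  note lev = kappa_tree_levels[OF kt tree]
  have "T = (\<Union>\<alpha>. {x \<in> T. ht x = \<alpha>})" by auto
  then have "atmost_kappa T" using atmost_kappa_UN[of "\<lambda>\<alpha>. {x \<in> T. ht x = \<alpha>}", OF lev(2)] by simp
  then obtain \<phi> :: "'a \<Rightarrow> 'b" where \<phi>: "inj_on \<phi> T"
    using ex_card_inj[OF _ card] by blast
  define \<psi> where "\<psi> = inv_into T \<phi>"
  have \<psi>\<phi>: "\<psi> (\<phi> x) = x" if "x \<in> T" for x using \<phi> that by (simp add: \<psi>_def)
  define T' where "T' = \<phi> ` T"
  define lt' where "lt' = map_prod \<phi> \<phi> ` lt"
  have \<psi>T: "\<psi> y \<in> T" "\<phi> (\<psi> y) = y" if "y \<in> T'" for y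
    using that \<psi>\<phi> by (auto simp: T'_def)
  have lt'_iff: "(\<phi> x, \<phi> y) \<in> lt' \<longleftrightarrow> (x, y) \<in> lt" if "x \<in> T" "y \<in> T" for x y
    using inj_onD[OF \<phi>] lt_subset that unfolding lt'_def by (auto simp: map_prod_def) blast+
  have lt'E: "\<exists>x y. x \<in> T \<and> y \<in> T \<and> (x, y) \<in> lt \<and> u = \<phi> x \<and> v = \<phi> y" if "(u, v) \<in> lt'" for u v
    using that lt_subset unfolding lt'_def by auto
  define ht' where "ht' y = ht (\<psi> y)" for y
  have ht': "ht' (\<phi> x) = ht x" if "x \<in> T" for x using \<psi>\<phi> that by (simp add: ht'_def)
  have tree': "height_tree T' lt' ht'"
  proof
    show "lt' \<subseteq> T' \<times> T'" using lt'E by (force simp: T'_def)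
    show "trans lt'"
    proof (rule transI)
      fix u v w assume "(u, v) \<in> lt'" "(v, w) \<in> lt'"
      then obtain x y y' z where *: "x \<in> T" "y \<in> T" "y' \<in> T" "z \<in> T" "(x, y) \<in> lt" "(y', z) \<in> lt"
        "u = \<phi> x" "v = \<phi> y" "v = \<phi> y'" "w = \<phi> z"
        using lt'E by metis
      then have "y = y'" using inj_onD[OF \<phi>] by metis
      then show "(u, w) \<in> lt'" using * lt_trans lt'_iff by (metis transD)
    qed
    show "ht' u < ht' v" if "(u, v) \<in> lt'" for u v
      using lt'E[OF that] ht_mono ht' by force
    show "\<exists>y. (y, x) \<in> lt' \<and> ht' y = \<gamma>" if "x \<in> T'" "\<gamma> < ht' x" for x \<gamma>
    proof -
      obtain y where "(y, \<psi> x) \<in> lt" "ht y = \<gamma>"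
        using ex_below[OF \<psi>T(1)[OF \<open>x \<in> T'\<close>]] \<open>\<gamma> < ht' x\<close> unfolding ht'_def by blast
      moreover from this have "y \<in> T" using lt_subset by blast
      ultimately show ?thesis using lt'_iff[of y "\<psi> x"] \<psi>T[OF that(1)] ht' by metis
    qed
    show "y = z" if "(y, x) \<in> lt'" "(z, x) \<in> lt'" "ht' y = ht' z" for x y z
    proof -
      obtain a b c e where *: "a \<in> T" "b \<in> T" "c \<in> T" "e \<in> T" "(a, b) \<in> lt" "(c, e) \<in> lt"
        "y = \<phi> a" "x = \<phi> b" "z = \<phi> c" "x = \<phi> e"
        using lt'E[OF \<open>(y, x) \<in> lt'\<close>] lt'E[OF \<open>(z, x) \<in> lt'\<close>] by metis
      then have "b = e" using inj_onD[OF \<phi>] by metis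
      then show ?thesis using * below_unique ht' that(3) by metis
    qed
  qed
  have levT': "{y \<in> T'. ht' y = \<alpha>} = \<phi> ` {x \<in> T. ht x = \<alpha>}" for \<alpha>
    using ht' by (auto simp: T'_def)
  have level': "level T' lt' \<alpha> = \<phi> ` level T lt \<alpha>" for \<alpha> :: 'k
    unfolding level_height_tree[OF tree'] level_height_tree[OF tree] by (rule levT')
  have levsub: "level T lt \<alpha> \<subseteq> T" for \<alpha> :: 'k
    unfolding level_height_tree[OF tree] by auto
  show thesis
  proof (rule that)
    obtain D and f :: "'a \<Rightarrow> 'k" where D: "club D" "D \<subseteq> acc_kappa"
      and reg: "\<And>x. x \<in> T \<Longrightarrow> ht x \<in> D \<Longrightarrow> f x < ht x"
      and inj: "\<And>x y. (x, y) \<in> lt \<Longrightarrow> ht x \<in> D \<Longrightarrow> ht y \<in> D \<Longrightarrow> f x \<noteq> f y"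
      by (rule special_aronszajn_colouring[OF sp tree]) blast
    show "special_aronszajn \<kappa> T' lt'"
    proof (rule special_aronszajnI[OF tree' _ _ D(1)])
      show "{x \<in> T'. ht' x = \<alpha>} \<noteq> {}" "small {x \<in> T'. ht' x = \<alpha>}" for \<alpha>
        unfolding levT' using lev[of \<alpha>] small_image by blast+
      show "f (\<psi> y) < ht' y" if "y \<in> T'" "ht' y \<in> D" for y
        using reg \<psi>T(1)[OF that(1)] that(2) by (simp add: ht'_def)
      show "f (\<psi> u) \<noteq> f (\<psi> v)" if "(u, v) \<in> lt'" "ht' u \<in> D" "ht' v \<in> D" for u v
        using lt'E[OF that(1)] inj that(2,3) \<psi>\<phi> ht' by force
    qed
    show "homogeneous \<kappa> T lt \<longrightarrow> homogeneous \<kappa> T' lt'"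
      unfolding homogeneous_def level'
    proof (intro impI allI ballI)
      fix \<alpha> :: 'k and u v
      assume hom: "\<forall>\<alpha>::'k. \<forall>s\<in>level T lt \<alpha>. \<forall>t\<in>level T lt \<alpha>. \<exists>\<pi>. automorphism T lt \<pi> \<and> \<pi> s = t"
        and "u \<in> \<phi> ` level T lt \<alpha>" "v \<in> \<phi> ` level T lt \<alpha>"
      then obtain s t where st: "u = \<phi> s" "v = \<phi> t" "s \<in> level T lt \<alpha>" "t \<in> level T lt \<alpha>" by blast
      then obtain \<pi> where \<pi>: "automorphism T lt \<pi>" "\<pi> s = t" using hom by blast
      have bij: "bij_betw \<pi> T T" and pres: "\<And>x y. x \<in> T \<Longrightarrow> y \<in> T \<Longrightarrow> (\<pi> x, \<pi> y) \<in> lt \<longleftrightarrow> (x, y) \<in> lt"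
        using \<pi>(1) by (auto simp: automorphism_def)
      let ?\<pi> = "\<phi> \<circ> \<pi> \<circ> \<psi>"
      have b1: "bij_betw \<phi> T T'" using \<phi> by (simp add: bij_betw_def T'_def)
      then have "bij_betw \<psi> T' T" unfolding \<psi>_def by (rule bij_betw_inv_into)
      then have "bij_betw ?\<pi> T' T'" using b1 bij bij_betw_trans by (metis comp_assoc)
      moreover have "(?\<pi> x, ?\<pi> y) \<in> lt' \<longleftrightarrow> (x, y) \<in> lt'" if "x \<in> T'" "y \<in> T'" for x y
      proof -
        have "\<pi> (\<psi> x) \<in> T" "\<pi> (\<psi> y) \<in> T" using bij \<psi>T that by (auto simp: bij_betw_def)
        then show ?thesis
          using lt'_iff pres \<psi>T(1)[OF that(1)] \<psi>T(1)[OF that(2)] \<psi>T(2)[OF that(1)] \<psi>T(2)[OF that(2)]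
          by (metis comp_apply)
      qed
      ultimately have "automorphism T' lt' ?\<pi>" unfolding automorphism_def by blast
      moreover have "?\<pi> u = v" using st(1,2) \<psi>\<phi>[OF subsetD[OF levsub st(3)]] \<pi>(2) by simp
      ultimately show "\<exists>\<pi>. automorphism T' lt' \<pi> \<and> \<pi> u = v" by blast
    qed
    show "(acc_kappa :: 'k set) \<subseteq> V_full T lt \<longrightarrow> (acc_kappa :: 'k set) \<subseteq> V_full T' lt'"
    proof (intro impI subsetI)
      fix \<alpha> :: 'k assume V: "(acc_kappa :: 'k set) \<subseteq> V_full T lt" and \<alpha>: "\<alpha> \<in> acc_kappa"
      have "\<exists>B. branch T' lt' {..<\<alpha>} B \<and> vanishing T' lt' B \<and> u \<in> B"
        if "\<beta> < \<alpha>" "u \<in> level T' lt' \<beta>" for \<beta> u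
      proof -
        obtain x where x: "x \<in> level T lt \<beta>" "u = \<phi> x" using \<open>u \<in> level T' lt' \<beta>\<close> unfolding level' by blast
        have "\<alpha> \<in> V_full T lt" using V \<alpha> by blast
        then obtain B where B: "branch T lt {..<\<alpha>} B" "vanishing T lt B" "x \<in> B"
          using x(1) \<open>\<beta> < \<alpha>\<close> unfolding V_full_def by blast
        have BT: "B \<subseteq> T" and cmp: "\<And>x y. x \<in> B \<Longrightarrow> y \<in> B \<Longrightarrow> x = y \<or> (x, y) \<in> lt \<or> (y, x) \<in> lt"
          and lv: "{\<gamma>. B \<inter> level T lt \<gamma> \<noteq> {}} = {..<\<alpha>}"
          using B(1) by (simp_all only: branch_def)
        have "branch T' lt' {..<\<alpha>} (\<phi> ` B)"
          unfolding branch_def level'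
        proof (intro conjI ballI)
          show "\<phi> ` B \<subseteq> T'" using BT by (auto simp: T'_def)
          show "y = z \<or> (y, z) \<in> lt' \<or> (z, y) \<in> lt'" if "y \<in> \<phi> ` B" "z \<in> \<phi> ` B" for y z
            using that cmp lt'_iff BT by blast
          have "\<phi> ` B \<inter> \<phi> ` level T lt \<gamma> = \<phi> ` (B \<inter> level T lt \<gamma>)" for \<gamma> :: 'k
            using inj_on_image_Int[OF \<phi> BT levsub] by simp
          then show "{\<gamma>. \<phi> ` B \<inter> \<phi> ` level T lt \<gamma> \<noteq> {}} = {..<\<alpha>}"
            using lv by simp
        qed
        moreover have "vanishing T' lt' (\<phi> ` B)"
          unfolding vanishing_def
        proof
          assume "\<exists>t\<in>T'. \<forall>y\<in>\<phi> ` B. y = t \<or> (y, t) \<in> lt'"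
          then obtain t where t: "t \<in> T" "\<forall>y\<in>B. \<phi> y = \<phi> t \<or> (\<phi> y, \<phi> t) \<in> lt'"
            by (auto simp: T'_def)
          then have "\<forall>y\<in>B. y = t \<or> (y, t) \<in> lt"
            using BT lt'_iff inj_onD[OF \<phi>] by blast
          then show False using B(2) t(1) unfolding vanishing_def by blast
        qed
        ultimately show ?thesis using x(2) B(3) by blast
      qed
      with \<alpha> show "\<alpha> \<in> V_full T' lt'" unfolding V_full_def by blast
    qed
  qed
qed

end

theorem theorem2p24:
  fixes \<kappa> :: "'k::wellorder itself"
  assumes "Card_order (kappa \<kappa>)" and "regularCard (kappa \<kappa>)" and "natLeq <o kappa \<kappa>"
    and "kappa \<kappa> \<le>o |UNIV :: 'b set|" and "kappa \<kappa> \<le>o |UNIV :: 'c set|"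
  shows
    "let i = (\<exists>(T :: 'b set) lt. special_aronszajn \<kappa> T lt);
         ii = (\<exists>(K :: 'k node set) (D :: 'k set) (f :: 'k node \<Rightarrow> 'k).
           streamlined K \<and> aronszajn \<kappa> K (sorder K) \<and>
           club D \<and> D \<subseteq> acc_kappa \<and>
           D \<subseteq> V_minus K (sorder K) \<and>
           (\<forall>\<alpha>\<in>D. \<forall>x \<in> slevel K \<alpha>. f x < \<alpha>) \<and>
           (\<forall>x \<in> srestrict K D. \<forall>y \<in> srestrict K D. (x, y) \<in> sorder K \<longrightarrow> f x \<noteq> f y) \<and>
           (\<forall>x\<in>K. \<forall>y\<in>K. \<forall>\<epsilon> \<in> dom x \<inter> dom y.
              x \<epsilon> = y \<epsilon> \<longrightarrow> x |` {..<\<epsilon>} = y |` {..<\<epsilon>}));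
         iii = (\<exists>T :: 'k node set.
           streamlined T \<and> uniformly_homogeneous T \<and> special_aronszajn \<kappa> T (sorder T) \<and>
           (\<exists>D :: 'k set. club D \<and> D \<subseteq> V_full T (sorder T)));
         iv = (\<exists>(T :: 'c set) lt.
           special_aronszajn \<kappa> T lt \<and> homogeneous \<kappa> T lt \<and> V_full T lt = (acc_kappa :: 'k set))
     in (i \<longleftrightarrow> ii) \<and> (ii \<longleftrightarrow> iii) \<and> (iii \<longleftrightarrow> iv)"
proof -
  interpret regular_uncountable \<kappa>
    by unfold_locales fact+
  define i where "i = (\<exists>(T :: 'b set) lt. special_aronszajn \<kappa> T lt)"
  define iii where "iii = (\<exists>T :: 'k node set.
           streamlined T \<and> uniformly_homogeneous T \<and> special_aronszajn \<kappa> T (sorder T) \<and>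
           (\<exists>D :: 'k set. club D \<and> D \<subseteq> V_full T (sorder T)))"
  define iv where "iv = (\<exists>(T :: 'c set) lt.
           special_aronszajn \<kappa> T lt \<and> homogeneous \<kappa> T lt \<and> V_full T lt = (acc_kappa :: 'k set))"
  \<comment> \<open>The implications are proved in a cycle. The last one, from (iv) to (i), forgets
    homogeneity and moves the tree to the type \<open>'b\<close>.\<close>
  have "injective_tree_with_colouring \<kappa>" if i
    using that injective_tree_of_special unfolding i_def by blast
  moreover have iii if "injective_tree_with_colouring \<kappa>"
    using uniformly_homogeneous_of_injective_tree[OF that] unfolding iii_def .
  moreover have iv if iii
  proof -
    obtain R :: "'k node set" and lt where R: "special_aronszajn \<kappa> R lt" "homogeneous \<kappa> R lt"
      "(acc_kappa :: 'k set) \<subseteq> V_full R lt"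
      using \<open>iii\<close> homogeneous_of_uniformly_homogeneous unfolding iii_def by blast
    obtain T :: "'c set" and lt' where "special_aronszajn \<kappa> T lt'" "homogeneous \<kappa> R lt \<longrightarrow> homogeneous \<kappa> T lt'"
      "(acc_kappa :: 'k set) \<subseteq> V_full R lt \<longrightarrow> (acc_kappa :: 'k set) \<subseteq> V_full T lt'"
      by (rule special_aronszajn_transfer[OF R(1) assms(5)])
    moreover have "V_full T lt' \<subseteq> (acc_kappa :: 'k set)"
      by (auto simp: V_full_def)
    ultimately show ?thesis
      using R(2,3) unfolding iv_def by blast
  qed
  moreover have i if iv
  proof -
    obtain T :: "'c set" and lt where "special_aronszajn \<kappa> T lt"
      using \<open>iv\<close> unfolding iv_def by blast
    then obtain T' :: "'b set" and lt' where "special_aronszajn \<kappa> T' lt'"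
      by (rule special_aronszajn_transfer[OF _ assms(4)])
    then show ?thesis unfolding i_def by blast
  qed
  ultimately have "(i \<longleftrightarrow> injective_tree_with_colouring \<kappa>) \<and> (injective_tree_with_colouring \<kappa> \<longleftrightarrow> iii) \<and> (iii \<longleftrightarrow> iv)"
    by blast
  then show ?thesis
    unfolding Let_def i_def iii_def iv_def injective_tree_with_colouring_def .
qed

end
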